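(* Let $F$ be a field (containing a square root of $-1$ if $\operatorname{char}(F)\neq 2$), let $n\ge 2$, and let $S$ be a finite right-linked set of (more than one) quadratic $n$-fold Pfister forms over $F$, whose image generates a subgroup of order $2^s$ in $I_q^nF/I_q^{n+1}F$. Then $\Sigma_S$ is the Witt class of a quadratic $(n+s-1)$-fold Pfister form.
   Context: $[a,b]$ denotes the quadratic form $ax^2+xy+by^2$. $\langle a_1,\dots,a_m\rangle$ denotes the diagonal symmetric bilinear form. $I_q^1F$ is the group of Witt classes of even-dimensional nonsingular quadratic forms over $F$ under orthogonal sum; it is a module (via tensor product) over the Witt ring of nondegenerate symmetric bilinear forms. Bilinear Pfister forms: $\langle\langle\beta\rangle\rangle=\langle 1,\beta\rangle$ and $\langle\langle\beta_1,\dots,\beta_m\rangle\rangle=\langle\langle\beta_1\rangle\rangle\otimes\cdots\otimes\langle\langle\beta_m\rangle\rangle$, $\beta_i\in F^\times$. Quadratic Pfister forms: the quadratic 1-fold ones are the nonsingular forms $\langle\langle\alpha]]=[1,\alpha]$; the quadratic $n$-fold ones are $\langle\langle\beta_1,\dots,\beta_{n-1},\alpha]]=\langle\langle\beta_1,\dots,\beta_{n-1}\rangle\rangle\otimes\langle\langle\alpha]]$. $I_q^nF$ is the subgroup of $I_q^1F$ generated by scalar multiples of quadratic $n$-fold Pfister forms. Forms are identified with their Witt classes. A set of quadratic $n$-fold Pfister forms is right-linked if there is a quadratic $(n-1)$-fold Pfister form $\varphi$ such that every form in the set is isometric to $\langle\langle\beta\rangle\rangle\otimes\varphi$ for some $\beta\in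 F^\times$. A set of quadratic $n$-fold Pfister forms is tight if every element of the subgroup it generates in $I_q^nF/I_q^{n+1}F$ is represented by a quadratic $n$-fold Pfister form (which is then unique up to isometry). Right-linked sets are tight. For a finite tight set $S$ of more than one $n$-fold Pfister forms, $\Sigma_S\in I_q^nF$ is the sum in $I_q^nF$ of the unique $n$-fold Pfister representatives of all the elements of the subgroup generated by the image of $S$ in $I_q^nF/I_q^{n+1}F$. *)

theory Defs
  imports
    "HOL-Library.FuncSet"
    "HOL-Algebra.Coset"
    "HOL-Algebra.Generated_Groups"
    "HOL-Algebra.FiniteProduct"
    "Jordan_Normal_Form.Matrix"
begin

section \<open>Bilinear forms\<close>

text \<open>
  A symmetric bilinear form on \<open>F\<^sup>m\<close> is given by its Gram matrix, so that the tensor product of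
  bilinear forms is the Kronecker product of matrices: the basis vector \<open>e\<^sub>i \<otimes> f\<^sub>k\<close> has index
  \<open>i * n + k\<close>, where \<open>n\<close> is the dimension of the second factor.
\<close>

definition diag_form :: "'a::field list \<Rightarrow> 'a mat" where
  "diag_form as = mat_diag (length as) (\<lambda>i. as ! i)"

definition bil_tensor :: "'a::field mat \<Rightarrow> 'a mat \<Rightarrow> 'a mat" where
  "bil_tensor A B = mat (dim_row A * dim_row B) (dim_col A * dim_col B)
     (\<lambda>(i, j). A $$ (i div dim_row B, j div dim_col B) * B $$ (i mod dim_row B, j mod dim_col B))"

fun bil_pfister :: "'a::field list \<Rightarrow> 'a mat" where
  "bil_pfister [] = diag_form [1]"
| "bil_pfister (\<beta> # \<beta>s) = bil_tensor (diag_form [1, \<beta>]) (bil_pfister \<beta>s)"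


section \<open>Quadratic forms\<close>

text \<open>
  A quadratic form on \<open>F\<^sup>n\<close> is a map \<open>F\<^sup>n \<rightarrow> F\<close>, made extensional (see \<open>is_qform\<close>) so that equality
  in the type below is equality of forms.
\<close>

datatype 'a qform = QForm (qdim: nat) (qval: "'a vec \<Rightarrow> 'a")

definition polar :: "'a::field qform \<Rightarrow> 'a vec \<Rightarrow> 'a vec \<Rightarrow> 'a" where
  "polar q u v = qval q (u + v) - qval q u - qval q v"

definition is_qform :: "'a::field qform \<Rightarrow> bool" where
  "is_qform q \<longleftrightarrow>
     qval q \<in> extensional (carrier_vec (qdim q)) \<and>
     (\<forall>c. \<forall>v\<in>carrier_vec (qdim q). qval q (c \<cdot>\<^sub>v v) = c\<^sup>2 * qval q v) \<and>
     (\<forall>u\<in>carrier_vec (qdim q). \<forall>v\<in>carrier_vec (qdim q). \<forall>w\<in>carrier_vec (qdim q).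
        polar q (u + v) w = polar q u w + polar q v w) \<and>
     (\<forall>c. \<forall>u\<in>carrier_vec (qdim q). \<forall>v\<in>carrier_vec (qdim q).
        polar q (c \<cdot>\<^sub>v u) v = c * polar q u v)"

text \<open>
  This is the notion of nonsingularity for even-dimensional forms in every characteristic
  (nondegenerate polar form); it is used for such forms only.
\<close>

definition nonsingular :: "'a::field qform \<Rightarrow> bool" where
  "nonsingular q \<longleftrightarrow>
     (\<forall>v\<in>carrier_vec (qdim q). (\<forall>w\<in>carrier_vec (qdim q). polar q v w = 0) \<longrightarrow> v = 0\<^sub>v (qdim q))"

definition isometric :: "'a::field qform \<Rightarrow> 'a qform \<Rightarrow> bool" where
  "isometric q r \<longleftrightarrow> qdim q = qdim r \<and>
     (\<exists>P\<in>carrier_mat (qdim q) (qdim q). invertible_mat P \<and>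
        (\<forall>v\<in>carrier_vec (qdim q). qval r (P *\<^sub>v v) = qval q v))"

definition binary_form :: "'a::field \<Rightarrow> 'a \<Rightarrow> 'a qform" where
  "binary_form a b =
     QForm 2 (\<lambda>v\<in>carrier_vec 2. a * (v $ 0)\<^sup>2 + (v $ 0) * (v $ 1) + b * (v $ 1)\<^sup>2)"

definition qscale :: "'a::field \<Rightarrow> 'a qform \<Rightarrow> 'a qform" where
  "qscale c q = QForm (qdim q) (\<lambda>v\<in>carrier_vec (qdim q). c * qval q v)"

definition orth_sum :: "'a::field qform \<Rightarrow> 'a qform \<Rightarrow> 'a qform" where
  "orth_sum q r = QForm (qdim q + qdim r)
     (\<lambda>v\<in>carrier_vec (qdim q + qdim r).
        qval q (vec_first v (qdim q)) + qval r (vec_last v (qdim r)))"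

definition zero_form :: "'a::field qform" where
  "zero_form = QForm 0 (\<lambda>v\<in>carrier_vec 0. 0)"

text \<open>
  The tensor product of a symmetric bilinear form \<open>B\<close> and a quadratic form \<open>q\<close> is the quadratic form
  with value \<open>B(u, u) q(w)\<close> at \<open>u \<otimes> w\<close> and with polar form \<open>B \<otimes> b\<^sub>q\<close>, where \<open>b\<^sub>q\<close> is the polar
  form of \<open>q\<close>.  Writing a vector as \<open>\<Sum>\<^sub>i e\<^sub>i \<otimes> v\<^sub>i\<close>, its value is therefore
  \<open>\<Sum>\<^sub>i B(e\<^sub>i, e\<^sub>i) q(v\<^sub>i) + \<Sum>\<^sub>i\<^sub><\<^sub>j B(e\<^sub>i, e\<^sub>j) b\<^sub>q(v\<^sub>i, v\<^sub>j)\<close>.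
\<close>

definition vec_block :: "nat \<Rightarrow> 'a vec \<Rightarrow> nat \<Rightarrow> 'a vec" where
  "vec_block n v i = vec n (\<lambda>k. v $ (i * n + k))"

definition qtensor :: "'a::field mat \<Rightarrow> 'a qform \<Rightarrow> 'a qform" where
  "qtensor B q = QForm (dim_row B * qdim q)
     (\<lambda>v\<in>carrier_vec (dim_row B * qdim q).
        (\<Sum>i<dim_row B. B $$ (i, i) * qval q (vec_block (qdim q) v i)) +
        (\<Sum>j<dim_row B. \<Sum>i<j.
           B $$ (i, j) * polar q (vec_block (qdim q) v i) (vec_block (qdim q) v j)))"


section \<open>Quadratic Pfister forms\<close>

text \<open>As Pfister forms are taken up to isometry, being one is an isometry-invariant property.\<close>

definition quad_pfister :: "nat \<Rightarrow> 'a::field qform \<Rightarrow> bool" where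
  "quad_pfister n q \<longleftrightarrow> is_qform q \<and>
     (\<exists>\<beta>s \<alpha>. Suc (length \<beta>s) = n \<and> 0 \<notin> set \<beta>s \<and> nonsingular (binary_form 1 \<alpha>) \<and>
        isometric q (qtensor (bil_pfister \<beta>s) (binary_form 1 \<alpha>)))"

definition right_linked :: "nat \<Rightarrow> 'a::field qform set \<Rightarrow> bool" where
  "right_linked n S \<longleftrightarrow>
     (\<exists>\<phi>. quad_pfister (n - 1) \<phi> \<and>
        (\<forall>q\<in>S. \<exists>\<beta>. \<beta> \<noteq> 0 \<and> isometric q (qtensor (diag_form [1, \<beta>]) \<phi>)))"


section \<open>The Witt group of even-dimensional nonsingular quadratic forms\<close>

definition even_nonsingular :: "'a::field qform set" where
  "even_nonsingular = {q. is_qform q \<and> even (qdim q) \<and> nonsingular q}"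

fun hyperbolic :: "nat \<Rightarrow> 'a::field qform" where
  "hyperbolic 0 = zero_form"
| "hyperbolic (Suc k) = orth_sum (binary_form 0 0) (hyperbolic k)"

definition witt_rel :: "('a::field qform \<times> 'a qform) set" where
  "witt_rel = {(q, r). q \<in> even_nonsingular \<and> r \<in> even_nonsingular \<and>
     (\<exists>k l. isometric (orth_sum q (hyperbolic k)) (orth_sum r (hyperbolic l)))}"

definition witt_class :: "'a::field qform \<Rightarrow> 'a qform set" where
  "witt_class q = witt_rel `` {q}"

text \<open>The group \<open>I\<^sub>q\<^sup>1F\<close>; its group law, orthogonal sum, is written multiplicatively.\<close>

definition witt_group :: "'a::field qform set monoid" where
  "witt_group =
     \<lparr>carrier = even_nonsingular // witt_rel,
      monoid.mult = (\<lambda>X Y. \<Union>q\<in>X. \<Union>r\<in>Y. witt_class (orth_sum q r)),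
      one = witt_class zero_form\<rparr>"

text \<open>The subgroup \<open>I\<^sub>q\<^sup>nF\<close>, for \<open>n \<ge> 1\<close>.\<close>

definition Iq :: "nat \<Rightarrow> 'a::field qform set set" where
  "Iq n = generate witt_group {witt_class (qscale c \<pi>) |c \<pi>. c \<noteq> 0 \<and> quad_pfister n \<pi>}"

text \<open>The quotient \<open>I\<^sub>q\<^sup>nF / I\<^sub>q\<^sup>n\<^sup>+\<^sup>1F\<close> and the class in it of a form.\<close>

definition Iq_quot :: "nat \<Rightarrow> 'a::field qform set set monoid" where
  "Iq_quot n = (witt_group\<lparr>carrier := Iq n\<rparr>) Mod (Iq (n + 1))"

definition quot_class :: "nat \<Rightarrow> 'a::field qform \<Rightarrow> 'a qform set set" where
  "quot_class n q = Iq (n + 1) #>\<^bsub>witt_group\<^esub> witt_class q"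

definition quot_span :: "nat \<Rightarrow> 'a::field qform set \<Rightarrow> 'a qform set set set" where
  "quot_span n S = generate (Iq_quot n) (quot_class n ` S)"

text \<open>
  The Witt class of the \<open>n\<close>-fold Pfister form, unique up to isometry if it exists, that represents
  the element \<open>x\<close> of \<open>I\<^sub>q\<^sup>nF / I\<^sub>q\<^sup>n\<^sup>+\<^sup>1F\<close>.
\<close>

definition pfister_rep :: "nat \<Rightarrow> 'a::field qform set set \<Rightarrow> 'a qform set" where
  "pfister_rep n x = (THE w. \<exists>\<pi>. quad_pfister n \<pi> \<and> quot_class n \<pi> = x \<and> w = witt_class \<pi>)"

text \<open>
  The element \<open>\<Sigma>\<^sub>S\<close> (meaningful for finite tight \<open>S\<close>); the product is taken in the multiplicatively
  written group \<open>I\<^sub>q\<^sup>1F\<close>, i.e. it is the sum of Witt classes.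
\<close>

definition pfister_sum :: "nat \<Rightarrow> 'a::field qform set \<Rightarrow> 'a qform set" where
  "pfister_sum n S = finprod witt_group (pfister_rep n) (quot_span n S)"

end

theory Submission
  imports
    Defs
    "HOL-Library.Function_Algebras"
    "HOL-Library.Countable_Set"
    "HOL-Computational_Algebra.Computational_Algebra"
    "HOL-Algebra.Algebraic_Closure_Type"
begin

text \<open>
  Let \<open>\<phi>\<close> be the common factor and \<open>P c = \<langle>\<langle>c\<rangle>\<rangle> \<otimes> \<phi>\<close>.  Modulo \<open>I\<^sub>q\<^sup>n\<^sup>+\<^sup>1F\<close> the class of \<open>P c\<close> is
  multiplicative in \<open>c\<close>, so that the subgroup generated by the image of \<open>S\<close> consists of the classes
  of \<open>P c\<close>, where \<open>c\<close> runs through the \<open>2\<^sup>s\<close> subproducts of some \<open>b\<^sub>1, \<dots>, b\<^sub>s\<close>.  Since \<open>-1\<close> is a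
  square, \<open>2 \<phi> = 0\<close>; for \<open>s > 0\<close> the summands \<open>\<phi>\<close> of the \<open>P c = \<phi> + c \<phi>\<close> therefore cancel, and
  \<open>\<Sigma>\<^sub>S\<close> is the sum of all \<open>c \<phi>\<close>, which is \<open>\<langle>\<langle>b\<^sub>1, \<dots>, b\<^sub>s\<rangle>\<rangle> \<otimes> \<phi>\<close>.

  That \<open>P c\<close> is the only Pfister form in its class is a case of the Arason-Pfister Hauptsatz: the
  difference of two \<open>n\<close>-fold Pfister forms, being isotropic of dimension \<open>2\<^sup>n\<^sup>+\<^sup>1\<close>, is hyperbolic if it
  is a sum of multiples of \<open>(n+1)\<close>-fold Pfister forms.  One passes to the function fields of these
  summands in turn.  A form that becomes hyperbolic over the function field of \<open>r\<close> represents a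
  multiple of the generic value of \<open>r\<close>, hence contains a multiple of \<open>r\<close> by the theorem of
  Cassels and Pfister.  All function fields are realised as countable subfields of one uncountable
  algebraically closed field.
\<close>

section \<open>Linear algebra over a subfield\<close>

text \<open>Each step of the Hauptsatz enlarges the base field by elements that depend on the forms
  at hand, which no type fixed in advance can provide. Base fields are therefore subsets of one
  ambient type, and vectors and Gram matrices are functions with values in it, so that one and the
  same form can be read over every intermediate field. Countability of the current field guarantees
  a further transcendental; algebraic closedness supplies the quadratic irrationality of each
  function field.

  Hyperbolicity is expressed by a totally isotropic subspace of half the dimension
  (\<open>metab\<close>). Such subspaces can be exhibited as graphs, cancelled and moved between
  fields in every characteristic, without inverting 2.

  The difference of the two Pfister forms has exactly the dimension of the summands in the relation,
  the borderline at which it could be a multiple of a summand. Both forms represent 1, so a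
  hyperbolic plane splits off; the anisotropic part is then too small to contain such a multiple,
  and it vanishes.

  For \<open>s = 0\<close> the sum is 0, which has to be realised by a hyperbolic Pfister
  form.\<close>

definition is_subfield :: "'b::field set \<Rightarrow> bool" where
  "is_subfield K \<longleftrightarrow> 0 \<in> K \<and> 1 \<in> K \<and> (\<forall>x\<in>K. \<forall>y\<in>K. x + y \<in> K \<and> x * y \<in> K) \<and>
     (\<forall>x\<in>K. - x \<in> K \<and> inverse x \<in> K)"

lemma is_subfieldD:
  assumes "is_subfield K"
  shows "0 \<in> K" "1 \<in> K" "x \<in> K \<Longrightarrow> y \<in> K \<Longrightarrow> x + y \<in> K" "x \<in> K \<Longrightarrow> y \<in> K \<Longrightarrow> x * y \<in> K"
    "x \<in> K \<Longrightarrow> - x \<in> K" "x \<in> K \<Longrightarrow> inverse x \<in> K" "x \<in> K \<Longrightarrow> y \<in> K \<Longrightarrow> x - y \<in> K"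
    "x \<in> K \<Longrightarrow> y \<in> K \<Longrightarrow> x / y \<in> K"
proof -
  show a: "0 \<in> K" "1 \<in> K" "x \<in> K \<Longrightarrow> y \<in> K \<Longrightarrow> x + y \<in> K" "x \<in> K \<Longrightarrow> y \<in> K \<Longrightarrow> x * y \<in> K"
    "x \<in> K \<Longrightarrow> - x \<in> K" "x \<in> K \<Longrightarrow> inverse x \<in> K" for x y
    using assms by (auto simp: is_subfield_def)
  show "x \<in> K \<Longrightarrow> y \<in> K \<Longrightarrow> x - y \<in> K" using a(3)[OF _ a(5), of x y] by simp
  show "x \<in> K \<Longrightarrow> y \<in> K \<Longrightarrow> x / y \<in> K" using a(4)[OF _ a(6), of x y] by (simp add: divide_inverse)
qed

lemma subfield_sum: "is_subfield K \<Longrightarrow> (\<And>i. i \<in> I \<Longrightarrow> f i \<in> K) \<Longrightarrow> sum f I \<in> K"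
  by (induction I rule: infinite_finite_induct) (auto simp: is_subfieldD)

lemma is_subfield_UNIV: "is_subfield UNIV"
  by (simp add: is_subfield_def)

text \<open>Vectors of length \<open>D\<close> are functions of which only the first
  \<open>D\<close> values matter. The remaining values are arbitrary, so equality of vectors is
  always tested below \<open>D\<close>.\<close>

definition ovec :: "'b set \<Rightarrow> nat \<Rightarrow> (nat \<Rightarrow> 'b) \<Rightarrow> bool" where
  "ovec K D v \<longleftrightarrow> (\<forall>i<D. v i \<in> K)"

definition smul :: "'b::comm_ring_1 \<Rightarrow> (nat \<Rightarrow> 'b) \<Rightarrow> nat \<Rightarrow> 'b" (infixr \<open>\<star>\<close> 75) where
  "c \<star> v = (\<lambda>i. c * v i)"

definition lincomb :: "'i set \<Rightarrow> ('i \<Rightarrow> 'b::comm_ring_1) \<Rightarrow> ('i \<Rightarrow> nat \<Rightarrow> 'b) \<Rightarrow> nat \<Rightarrow> 'b" where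
  "lincomb I c w = (\<lambda>j. \<Sum>i\<in>I. c i * w i j)"

definition indep :: "'b::field set \<Rightarrow> 'i set \<Rightarrow> nat \<Rightarrow> ('i \<Rightarrow> nat \<Rightarrow> 'b) \<Rightarrow> bool" where
  "indep K I D w \<longleftrightarrow>
     (\<forall>c. (\<forall>i\<in>I. c i \<in> K) \<longrightarrow> (\<forall>j<D. lincomb I c w j = 0) \<longrightarrow> (\<forall>i\<in>I. c i = 0))"

definition unitv :: "nat \<Rightarrow> nat \<Rightarrow> 'b::comm_ring_1" where
  "unitv i = (\<lambda>j. if j = i then 1 else 0)"

lemma smul_apply [simp]: "(c \<star> v) i = c * v i"
  by (simp add: smul_def)

lemma ovec_add: "is_subfield K \<Longrightarrow> ovec K D u \<Longrightarrow> ovec K D v \<Longrightarrow> ovec K D (u + v)"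
  and ovec_diff: "is_subfield K \<Longrightarrow> ovec K D u \<Longrightarrow> ovec K D v \<Longrightarrow> ovec K D (u - v)"
  and ovec_smul: "is_subfield K \<Longrightarrow> c \<in> K \<Longrightarrow> ovec K D u \<Longrightarrow> ovec K D (c \<star> u)"
  and ovec_zero: "is_subfield K \<Longrightarrow> ovec K D 0"
  and ovec_unitv: "is_subfield K \<Longrightarrow> ovec K D (unitv i)"
  by (auto simp: ovec_def is_subfieldD unitv_def)

lemma ovec_lincomb:
  "is_subfield K \<Longrightarrow> (\<And>i. i \<in> I \<Longrightarrow> c i \<in> K) \<Longrightarrow> (\<And>i. i \<in> I \<Longrightarrow> ovec K D (w i)) \<Longrightarrow>
     ovec K D (lincomb I c w)"
  by (auto simp: ovec_def lincomb_def intro!: subfield_sum is_subfieldD(4))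

lemma ovec_mono: "ovec K D v \<Longrightarrow> K \<subseteq> L \<Longrightarrow> ovec L D v"
  by (auto simp: ovec_def)

lemma lincomb_unitv: "j < D \<Longrightarrow> lincomb {..<D} v unitv j = v j"
  by (simp add: lincomb_def unitv_def if_distrib cong: if_cong)

text \<open>Elimination by induction on the number of equations: a pivot row \<open>k\<close> clears
  the last column of the other rows, and its own coefficient is then determined by theirs.\<close>

lemma exists_nontrivial_solution:
  assumes K: "is_subfield K" and "finite I" and "card I > m"
    and "\<And>i j. i \<in> I \<Longrightarrow> j < m \<Longrightarrow> a i j \<in> K"
  shows "\<exists>c. (\<forall>i\<in>I. c i \<in> K) \<and> (\<exists>i\<in>I. c i \<noteq> 0) \<and> (\<forall>j<m. lincomb I c a j = 0)"
  using assms(2-4)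
proof (induction m arbitrary: I a)
  case 0
  then obtain i where "i \<in> I" by fastforce
  then show ?case using K by (intro exI[of _ "\<lambda>_. 1"]) (auto simp: is_subfieldD)
next
  case (Suc m)
  show ?case
  proof (cases "\<forall>i\<in>I. a i m = 0")
    case True
    obtain c where "\<forall>i\<in>I. c i \<in> K" "\<exists>i\<in>I. c i \<noteq> 0" "\<forall>j<m. lincomb I c a j = 0"
      using Suc.IH[of I a] Suc.prems by auto
    then show ?thesis using True
      by (intro exI[of _ c]) (auto simp: less_Suc_eq lincomb_def)
  next
    case False
    then obtain k where k: "k \<in> I" "a k m \<noteq> 0" by blast
    let ?J = "I - {k}" and ?b = "\<lambda>i j. a i j - a i m / a k m * a k j"
    have J: "finite ?J" "card ?J > m" using Suc.prems k by auto
    have "\<exists>c. (\<forall>i\<in>?J. c i \<in> K) \<and> (\<exists>i\<in>?J. c i \<noteq> 0) \<and> (\<forall>j<m. lincomb ?J c ?b j = 0)"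
      by (rule Suc.IH[OF J]) (use k Suc.prems in \<open>auto intro!: is_subfieldD[OF K]\<close>)
    then obtain c where c: "\<forall>i\<in>?J. c i \<in> K" "\<exists>i\<in>?J. c i \<noteq> 0" "\<forall>j<m. lincomb ?J c ?b j = 0"
      by blast
    define d where "d = c(k := - (\<Sum>i\<in>?J. c i * (a i m / a k m)))"
    have dk: "d k \<in> K" unfolding d_def using c(1) k Suc.prems
      by (auto intro!: is_subfieldD[OF K] subfield_sum[OF K])
    have eq: "lincomb I d a j = lincomb ?J c ?b j" for j
    proof -
      have "lincomb I d a j = d k * a k j + (\<Sum>i\<in>?J. d i * a i j)"
        unfolding lincomb_def using k Suc.prems(1) by (simp add: sum.remove)
      also have "(\<Sum>i\<in>?J. d i * a i j) = (\<Sum>i\<in>?J. c i * a i j)"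
        by (rule sum.cong) (auto simp: d_def)
      finally have "lincomb I d a j = d k * a k j + (\<Sum>i\<in>?J. c i * a i j)" .
      moreover have "d k * a k j = - (\<Sum>i\<in>?J. c i * (a i m / a k m) * a k j)"
        by (simp add: d_def sum_distrib_right)
      ultimately show ?thesis
        by (simp add: lincomb_def sum_subtractf right_diff_distrib mult.assoc)
    qed
    have "lincomb ?J c ?b m = 0" using k by (simp add: lincomb_def)
    then have "\<forall>j<Suc m. lincomb I d a j = 0" using c(3) eq by (auto simp: less_Suc_eq)
    moreover have "\<forall>i\<in>I. d i \<in> K" using dk c(1) by (auto simp: d_def)
    moreover have "\<exists>i\<in>I. d i \<noteq> 0" using c(2) by (auto simp: d_def)
    ultimately show ?thesis by blast
  qed
qed

lemma indep_card_le:
  assumes "is_subfield K" "finite I" "\<And>i. i \<in> I \<Longrightarrow> ovec K D (w i)" "indep K I D w"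
  shows "card I \<le> D"
proof (rule ccontr)
  assume "\<not> card I \<le> D"
  then obtain c where "\<forall>i\<in>I. c i \<in> K" "\<exists>i\<in>I. c i \<noteq> 0" "\<forall>j<D. lincomb I c w j = 0"
    using exists_nontrivial_solution[OF assms(1,2), of D w] assms(3) by (auto simp: ovec_def)
  then show False using assms(4) unfolding indep_def by blast
qed

text \<open>Independent families have at most \<open>D\<close> members, so there is a longest one
  inside \<open>C\<close>. Appending a further \<open>v\<close> from \<open>C\<close> makes it
  dependent, and the relation can be solved for \<open>v\<close>.\<close>

lemma exists_basis:
  assumes K: "is_subfield K" and C: "\<And>v. v \<in> C \<Longrightarrow> ovec K D v"
  shows "\<exists>(n::nat) f. (\<forall>i<n. f i \<in> C) \<and> indep K {..<n} D f \<and>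
    (\<forall>v\<in>C. \<exists>c. (\<forall>i<n. c i \<in> K) \<and> (\<forall>j<D. v j = lincomb {..<n} c f j))"
proof -
  define P where "P n \<longleftrightarrow> (\<exists>f. (\<forall>i<n. f i \<in> C) \<and> indep K {..<n} D f)" for n :: nat
  have "P 0" by (simp add: P_def indep_def)
  moreover have "\<forall>n. P n \<longrightarrow> n \<le> D"
  proof (intro allI impI)
    fix n assume "P n"
    then obtain f where "\<forall>i<n. f i \<in> C" "indep K {..<n} D f" by (auto simp: P_def)
    then show "n \<le> D" using indep_card_le[OF K, of "{..<n}" D f] C by auto
  qed
  ultimately have n: "P (Greatest P)" "\<And>m. P m \<Longrightarrow> m \<le> Greatest P"
    using GreatestI_nat[of P 0 D] Greatest_le_nat[of P _ D] by simp_all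
  define n where "n = Greatest P"
  note n = n[folded n_def]
  then obtain f where f: "\<forall>i<n. f i \<in> C" "indep K {..<n} D f" by (auto simp: P_def)
  have "\<exists>c. (\<forall>i<n. c i \<in> K) \<and> (\<forall>j<D. v j = lincomb {..<n} c f j)" if v: "v \<in> C" for v
  proof -
    let ?f = "f(n := v)"
    have "\<forall>i<Suc n. ?f i \<in> C" using f(1) v by (simp add: less_Suc_eq)
    then have "\<not> indep K {..<Suc n} D ?f"
      using n(2)[of "Suc n"] unfolding P_def by (metis Suc_n_not_le_n)
    then obtain c where c: "\<forall>i<Suc n. c i \<in> K" "\<forall>j<D. lincomb {..<Suc n} c ?f j = 0" "\<exists>i<Suc n. c i \<noteq> 0"
      by (auto simp: indep_def)
    have e: "lincomb {..<Suc n} c ?f j = lincomb {..<n} c f j + c n * v j" for j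
      by (simp add: lincomb_def)
    have "c n \<noteq> 0"
    proof
      assume "c n = 0"
      then have "\<forall>j<D. lincomb {..<n} c f j = 0" using c(2) e by simp
      then have "\<forall>i<n. c i = 0" using f(2) c(1) unfolding indep_def by auto
      then show False using c(3) \<open>c n = 0\<close> by (auto simp: less_Suc_eq)
    qed
    let ?d = "\<lambda>i. - c i / c n"
    have "v j = lincomb {..<n} ?d f j" if "j < D" for j
    proof -
      have "c n * v j = - lincomb {..<n} c f j" using c(2) e that by (simp add: eq_neg_iff_add_eq_0 add.commute)
      then have "v j = - lincomb {..<n} c f j / c n" using \<open>c n \<noteq> 0\<close> by (simp add: field_simps)
      then show ?thesis by (simp add: lincomb_def sum_negf sum_divide_distrib)
    qed
    then show ?thesis using c(1) by (intro exI[of _ ?d]) (auto intro!: is_subfieldD[OF K])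
  qed
  then have "\<forall>v\<in>C. \<exists>c. (\<forall>i<n. c i \<in> K) \<and> (\<forall>j<D. v j = lincomb {..<n} c f j)" by blast
  with f show ?thesis by (intro exI[of _ n] exI[of _ f]) simp
qed

text \<open>A matrix over \<open>K\<close>, acting on all vectors over the ambient field and not
  only on those over \<open>K\<close>. The same map therefore serves over every larger subfield
  (\<open>linmap_mono\<close>). The third clause makes the irrelevant coordinates harmless.\<close>

definition linmap :: "'b::field set \<Rightarrow> nat \<Rightarrow> nat \<Rightarrow> ((nat \<Rightarrow> 'b) \<Rightarrow> nat \<Rightarrow> 'b) \<Rightarrow> bool" where
  "linmap K D D' f \<longleftrightarrow> (\<forall>u v. f (u + v) = f u + f v) \<and> (\<forall>c u. f (c \<star> u) = c \<star> f u) \<and>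
     (\<forall>u v. (\<forall>i<D. u i = v i) \<longrightarrow> (\<forall>i<D'. f u i = f v i)) \<and>
     (\<forall>u. ovec K D u \<longrightarrow> ovec K D' (f u))"

lemma linmapD:
  assumes "linmap K D D' f"
  shows "f (u + v) = f u + f v" "f (c \<star> u) = c \<star> f u"
    "(\<And>i. i < D \<Longrightarrow> u i = v i) \<Longrightarrow> i < D' \<Longrightarrow> f u i = f v i" "ovec K D u \<Longrightarrow> ovec K D' (f u)"
  using assms unfolding linmap_def by blast+

lemma lincomb_insert:
  "finite I \<Longrightarrow> k \<notin> I \<Longrightarrow> lincomb (insert k I) c w = c k \<star> w k + lincomb I c w"
  by (auto simp: lincomb_def)

lemma lincomb_empty [simp]: "lincomb {} c w = 0"
  by (auto simp: lincomb_def)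

lemma smul_0 [simp]: "0 \<star> v = 0" "c \<star> (0::nat \<Rightarrow> 'b::comm_ring_1) = 0" "1 \<star> v = v"
  by auto

lemma linmap_zero: "linmap K D D' f \<Longrightarrow> f 0 = 0"
  using linmapD(2)[of K D D' f 0 0] by simp

lemma linmap_lincomb:
  assumes "linmap K D D' f" "finite I"
  shows "f (lincomb I c w) = lincomb I c (\<lambda>i. f (w i))"
  using assms(2)
proof (induction)
  case empty
  show "f (lincomb {} c w) = lincomb {} c (\<lambda>i. f (w i))"
    by (simp add: linmap_zero[OF assms(1)])
next
  case (insert k I)
  then show "f (lincomb (insert k I) c w) = lincomb (insert k I) c (\<lambda>i. f (w i))"
    unfolding lincomb_insert[OF insert.hyps] linmapD(1,2)[OF assms(1)] by metis
qed

lemma linmap_id: "linmap K D D id"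
  by (simp add: linmap_def)

lemma linmap_comp:
  assumes "linmap K D D' f" "linmap K D' D'' h" shows "linmap K D D'' (\<lambda>v. h (f v))"
  unfolding linmap_def
proof (intro conjI allI impI)
  fix u v :: "nat \<Rightarrow> 'a" and i assume "\<forall>i<D. u i = v i" "i < D''"
  then show "h (f u) i = h (f v) i"
    by (intro linmapD(3)[OF assms(2)] linmapD(3)[OF assms(1)]) auto
qed (simp_all add: linmapD(1,2,4)[OF assms(1)] linmapD(1,2,4)[OF assms(2)])

lemma linmap_add:
  assumes "is_subfield K" and f: "linmap K D D' f" and h: "linmap K D D' h"
  shows "linmap K D D' (\<lambda>v. f v + h v)"
  unfolding linmap_def
proof (intro conjI allI impI)
  fix u v :: "nat \<Rightarrow> 'a" and i assume "\<forall>i<D. u i = v i" "i < D'"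
  then show "(f u + h u) i = (f v + h v) i"
    using linmapD(3)[OF f, of u v i] linmapD(3)[OF h, of u v i] by simp
qed (auto simp: linmapD(1,2,4)[OF f] linmapD(1,2,4)[OF h] ovec_add assms(1) fun_eq_iff algebra_simps)

lemma linmap_smul:
  assumes "is_subfield K" and "a \<in> K" and f: "linmap K D D' f"
  shows "linmap K D D' (\<lambda>v. a \<star> f v)"
  unfolding linmap_def
proof (intro conjI allI impI)
  fix u v :: "nat \<Rightarrow> 'a" and i assume "\<forall>i<D. u i = v i" "i < D'"
  then show "(a \<star> f u) i = (a \<star> f v) i"
    using linmapD(3)[OF f, of u v i] by simp
qed (auto simp: linmapD(1,2,4)[OF f] ovec_smul assms(1,2) fun_eq_iff algebra_simps)

lemma linmap_coords:
  assumes "is_subfield K" "\<And>i. i < m \<Longrightarrow> ovec K D (P i)"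
  shows "linmap K m D (\<lambda>c. lincomb {..<m} c P)"
  unfolding linmap_def
proof (intro conjI allI impI)
  fix u assume "ovec K m u"
  then show "ovec K D (lincomb {..<m} u P)"
    by (intro ovec_lincomb assms) (auto simp: ovec_def)
qed (auto simp: lincomb_def fun_eq_iff sum_distrib_left distrib_right sum.distrib mult.assoc)

section \<open>Quadratic forms given by Gram matrices\<close>

text \<open>The matrix need not be symmetric; this makes quadratic forms in characteristic 2 available
  as \<open>v \<mapsto> bil v v\<close>.\<close>

definition bil :: "nat \<Rightarrow> (nat \<Rightarrow> nat \<Rightarrow> 'b::comm_ring_1) \<Rightarrow> (nat \<Rightarrow> 'b) \<Rightarrow> (nat \<Rightarrow> 'b) \<Rightarrow> 'b" where
  "bil D g u v = (\<Sum>i<D. \<Sum>j<D. g i j * u i * v j)"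

definition qd :: "nat \<Rightarrow> (nat \<Rightarrow> nat \<Rightarrow> 'b::comm_ring_1) \<Rightarrow> (nat \<Rightarrow> 'b) \<Rightarrow> 'b" where
  "qd D g v = bil D g v v"

definition pol :: "nat \<Rightarrow> (nat \<Rightarrow> nat \<Rightarrow> 'b::comm_ring_1) \<Rightarrow> (nat \<Rightarrow> 'b) \<Rightarrow> (nat \<Rightarrow> 'b) \<Rightarrow> 'b" where
  "pol D g u v = bil D g u v + bil D g v u"

lemma bil_simps [simp]:
  "bil D g (u + v) w = bil D g u w + bil D g v w"
  "bil D g w (u + v) = bil D g w u + bil D g w v"
  "bil D g (c \<star> u) w = c * bil D g u w"
  "bil D g w (c \<star> u) = c * bil D g w u"
  "bil D g (u - v) w = bil D g u w - bil D g v w"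
  "bil D g w (u - v) = bil D g w u - bil D g w v"
  "bil D g 0 w = 0" "bil D g w 0 = 0"
  by (simp_all add: bil_def algebra_simps sum.distrib sum_distrib_left sum_subtractf)

lemma pol_simps [simp]:
  "pol D g (u + v) w = pol D g u w + pol D g v w"
  "pol D g w (u + v) = pol D g w u + pol D g w v"
  "pol D g (c \<star> u) w = c * pol D g u w"
  "pol D g w (c \<star> u) = c * pol D g w u"
  "pol D g (u - v) w = pol D g u w - pol D g v w"
  "pol D g w (u - v) = pol D g w u - pol D g w v"
  "pol D g 0 w = 0" "pol D g w 0 = 0"
  by (simp_all add: pol_def algebra_simps)

lemma pol_sym: "pol D g u v = pol D g v u"
  by (simp add: pol_def)

lemma pol_self: "pol D g u u = 2 * qd D g u"
  by (simp add: pol_def qd_def)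

lemma qd_add: "qd D g (u + v) = qd D g u + qd D g v + pol D g u v"
  by (simp add: qd_def pol_def algebra_simps)

lemma qd_diff: "qd D g (u - v) = qd D g u + qd D g v - pol D g u v"
  by (simp add: qd_def pol_def algebra_simps)

lemma qd_smul: "qd D g (c \<star> u) = c * c * qd D g u"
  by (simp add: qd_def)

lemma qd_zero [simp]: "qd D g 0 = 0"
  by (simp add: qd_def)

lemma bil_cong:
  "(\<And>i. i < D \<Longrightarrow> u i = u' i) \<Longrightarrow> (\<And>i. i < D \<Longrightarrow> v i = v' i) \<Longrightarrow>
   (\<And>i j. i < D \<Longrightarrow> j < D \<Longrightarrow> g i j = g' i j) \<Longrightarrow> bil D g u v = bil D g' u' v'"
  unfolding bil_def by (intro sum.cong refl) auto

lemma qd_cong: "(\<And>i. i < D \<Longrightarrow> u i = u' i) \<Longrightarrow> qd D g u = qd D g u'"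
  unfolding qd_def by (intro bil_cong) auto

lemma pol_cong:
  "(\<And>i. i < D \<Longrightarrow> u i = u' i) \<Longrightarrow> (\<And>i. i < D \<Longrightarrow> v i = v' i) \<Longrightarrow> pol D g u v = pol D g u' v'"
  unfolding pol_def by (intro arg_cong2[of _ _ _ _ "(+)"] bil_cong) auto

lemma bil_lincomb_left: "bil D g (lincomb I c w) v = (\<Sum>i\<in>I. c i * bil D g (w i) v)"
proof -
  have "bil D g (lincomb I c w) v = (\<Sum>k<D. \<Sum>j<D. \<Sum>i\<in>I. c i * (g k j * w i k * v j))"
    by (simp add: bil_def lincomb_def sum_distrib_left sum_distrib_right mult_ac)
  also have "\<dots> = (\<Sum>k<D. \<Sum>i\<in>I. \<Sum>j<D. c i * (g k j * w i k * v j))"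
    by (intro sum.cong refl sum.swap)
  also have "\<dots> = (\<Sum>i\<in>I. \<Sum>k<D. \<Sum>j<D. c i * (g k j * w i k * v j))"
    by (rule sum.swap)
  finally show ?thesis by (simp add: bil_def sum_distrib_left)
qed

lemma bil_transpose: "bil D g u v = bil D (\<lambda>i j. g j i) v u"
  unfolding bil_def by (subst sum.swap) (simp add: mult_ac)

lemma bil_lincomb_right: "bil D g v (lincomb I c w) = (\<Sum>i\<in>I. c i * bil D g v (w i))"
  unfolding bil_transpose[of D g v] by (rule bil_lincomb_left)

lemma pol_lincomb_left: "pol D g (lincomb I c w) v = (\<Sum>i\<in>I. c i * pol D g (w i) v)"
  by (simp add: pol_def bil_lincomb_left bil_lincomb_right sum.distrib distrib_left)

lemma bil_lincomb:
  "bil D g (lincomb {..<m} c P) (lincomb {..<m} d P) = bil m (\<lambda>i k. bil D g (P i) (P k)) c d"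
proof -
  have "bil D g (lincomb {..<m} c P) (lincomb {..<m} d P) =
      (\<Sum>i<m. c i * (\<Sum>k<m. d k * bil D g (P i) (P k)))"
    by (simp only: bil_lincomb_left) (simp only: bil_lincomb_right)
  then show ?thesis by (simp add: bil_def[of m] sum_distrib_left mult_ac)
qed

lemma qd_lincomb:
  "qd D g (lincomb {..<m} c P) = qd m (\<lambda>i k. bil D g (P i) (P k)) c"
  unfolding qd_def by (rule bil_lincomb)

definition ogram :: "'b set \<Rightarrow> nat \<Rightarrow> (nat \<Rightarrow> nat \<Rightarrow> 'b) \<Rightarrow> bool" where
  "ogram K D g \<longleftrightarrow> (\<forall>i<D. \<forall>j<D. g i j \<in> K)"

lemma ogram_mono: "ogram K D g \<Longrightarrow> K \<subseteq> L \<Longrightarrow> ogram L D g"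
  by (auto simp: ogram_def)

lemma bil_over:
  "is_subfield K \<Longrightarrow> ogram K D g \<Longrightarrow> ovec K D u \<Longrightarrow> ovec K D v \<Longrightarrow> bil D g u v \<in> K"
  unfolding bil_def by (auto simp: ogram_def ovec_def intro!: subfield_sum is_subfieldD(4))

lemma qd_over: "is_subfield K \<Longrightarrow> ogram K D g \<Longrightarrow> ovec K D u \<Longrightarrow> qd D g u \<in> K"
  by (simp add: qd_def bil_over)

lemma pol_over:
  "is_subfield K \<Longrightarrow> ogram K D g \<Longrightarrow> ovec K D u \<Longrightarrow> ovec K D v \<Longrightarrow> pol D g u v \<in> K"
  by (simp add: pol_def bil_over is_subfieldD)

definition nonsing :: "'b::field set \<Rightarrow> nat \<Rightarrow> (nat \<Rightarrow> nat \<Rightarrow> 'b) \<Rightarrow> bool" where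
  "nonsing K D g \<longleftrightarrow>
     (\<forall>v. ovec K D v \<longrightarrow> (\<forall>u. ovec K D u \<longrightarrow> pol D g v u = 0) \<longrightarrow> (\<forall>i<D. v i = 0))"

definition aniso :: "'b::field set \<Rightarrow> nat \<Rightarrow> (nat \<Rightarrow> nat \<Rightarrow> 'b) \<Rightarrow> bool" where
  "aniso K D g \<longleftrightarrow> (\<forall>v. ovec K D v \<longrightarrow> qd D g v = 0 \<longrightarrow> (\<forall>i<D. v i = 0))"

text \<open>A Lagrangian, given by an independent spanning family. For nonsingular forms its
  existence amounts to hyperbolicity (\<open>metab_isom_hyp_sum\<close>). Indices are natural
  numbers so that no further type variable enters the definition.\<close>

definition metab :: "'b::field set \<Rightarrow> nat \<Rightarrow> (nat \<Rightarrow> nat \<Rightarrow> 'b) \<Rightarrow> bool" where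
  "metab K D g \<longleftrightarrow> (\<exists>(I::nat set) w. finite I \<and> D = 2 * card I \<and> (\<forall>i\<in>I. ovec K D (w i)) \<and>
     indep K I D w \<and> (\<forall>c. (\<forall>i\<in>I. c i \<in> K) \<longrightarrow> qd D g (lincomb I c w) = 0))"

text \<open>Frees the index type: a family over any finite set is renumbered, which allows disjoint
  sums of index sets as in \<open>metab_gsum\<close>.\<close>

lemma metabI:
  assumes "finite I" "D = 2 * card I" "\<And>i. i \<in> I \<Longrightarrow> ovec K D (w i)" "indep K I D w"
    "\<And>c. (\<And>i. i \<in> I \<Longrightarrow> c i \<in> K) \<Longrightarrow> qd D g (lincomb I c w) = 0"
  shows "metab K D g"
proof -
  obtain h where h: "bij_betw h {..<card I} I"
    using assms(1) ex_bij_betw_nat_finite[of I] by (auto simp: atLeast0LessThan)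
  define h' where "h' = the_inv_into {..<card I} h"
  have inj: "inj_on h {..<card I}" using h by (simp add: bij_betw_def)
  have hh: "h' (h i) = i" if "i < card I" for i
    unfolding h'_def using inj that by (simp add: the_inv_into_f_f)
  have eq: "lincomb {..<card I} c (w \<circ> h) = lincomb I (c \<circ> h') w" for c
  proof
    fix j
    have "lincomb {..<card I} c (w \<circ> h) j = (\<Sum>i<card I. (c \<circ> h') (h i) * w (h i) j)"
      unfolding lincomb_def by (rule sum.cong) (auto simp: hh)
    then show "lincomb {..<card I} c (w \<circ> h) j = lincomb I (c \<circ> h') w j"
      unfolding lincomb_def using sum.reindex_bij_betw[OF h, of "\<lambda>i. (c \<circ> h') i * w i j"] by simp
  qed
  have h'I: "h' i < card I" "h (h' i) = i" if "i \<in> I" for i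
    using h that the_inv_into_into[OF inj, of i "{..<card I}"] f_the_inv_into_f[OF inj, of i]
    by (auto simp: h'_def bij_betw_def)
  have hI: "h i \<in> I" if "i < card I" for i using h that by (auto simp: bij_betw_def)
  have "indep K {..<card I} D (w \<circ> h)"
    unfolding indep_def eq
  proof (intro allI impI ballI)
    fix c i
    assume c: "\<forall>i\<in>{..<card I}. c i \<in> K" "\<forall>j<D. lincomb I (c \<circ> h') w j = 0"
      and i: "i \<in> {..<card I}"
    have "\<forall>i\<in>I. (c \<circ> h') i \<in> K" using c(1) h'I by simp
    then have "\<forall>i\<in>I. (c \<circ> h') i = 0"
      using assms(4) c(2) unfolding indep_def by blast
    then have "(c \<circ> h') (h i) = 0" using hI i by blast
    then show "c i = 0" using hh i by simp
  qed
  moreover have "qd D g (lincomb {..<card I} c (w \<circ> h)) = 0" if "\<forall>i\<in>{..<card I}. c i \<in> K" for c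
    unfolding eq using that h'I by (intro assms(5)) simp
  ultimately show ?thesis unfolding metab_def using assms(1-3) hI
    by (intro exI[of _ "{..<card I}"] exI[of _ "w \<circ> h"]) simp
qed

lemma metab_vectors_nonzero:
  assumes "is_subfield K" "indep K I D w" "finite I" "i \<in> I"
  shows "\<exists>j<D. w i j \<noteq> 0"
proof (rule ccontr)
  assume *: "\<not> (\<exists>j<D. w i j \<noteq> 0)"
  define c where "c k = (if k = i then 1 else 0 :: 'a)" for k
  have "lincomb I c w j = w i j" for j
    using assms(3,4) by (simp add: c_def lincomb_def if_distrib[of "\<lambda>x. x * _"] cong: if_cong)
  then have "\<forall>j<D. lincomb I c w j = 0" using * by auto
  moreover have "\<forall>k\<in>I. c k \<in> K" using is_subfieldD(1,2)[OF assms(1)] by (simp add: c_def)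
  ultimately have "\<forall>k\<in>I. c k = 0" using assms(2) unfolding indep_def by blast
  then show False using assms(4) by (auto simp: c_def)
qed

section \<open>Isometries\<close>

text \<open>The values are compared on all ambient vectors, not only on those over \<open>K\<close>.
  This is what lets an isometry persist over larger subfields.\<close>

definition isom :: "'b::field set \<Rightarrow> nat \<Rightarrow> (nat \<Rightarrow> nat \<Rightarrow> 'b) \<Rightarrow> (nat \<Rightarrow> nat \<Rightarrow> 'b) \<Rightarrow> bool" where
  "isom K D g g' \<longleftrightarrow> (\<exists>f h. linmap K D D f \<and> linmap K D D h \<and>
     (\<forall>v. \<forall>i<D. h (f v) i = v i) \<and> (\<forall>v. \<forall>i<D. f (h v) i = v i) \<and>
     (\<forall>v. qd D g' (f v) = qd D g v))"

lemma isomI: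
  assumes "linmap K D D f" "linmap K D D h" "\<And>v i. i < D \<Longrightarrow> h (f v) i = v i"
    "\<And>v i. i < D \<Longrightarrow> f (h v) i = v i" "\<And>v. qd D g' (f v) = qd D g v"
  shows "isom K D g g'"
  using assms unfolding isom_def by blast

lemma isomE:
  assumes "isom K D g g'"
  obtains f h where "linmap K D D f" "linmap K D D h" "\<And>v i. i < D \<Longrightarrow> h (f v) i = v i"
    "\<And>v i. i < D \<Longrightarrow> f (h v) i = v i" "\<And>v. qd D g' (f v) = qd D g v"
  using assms unfolding isom_def by blast

lemma isom_of_qd_eq: "(\<And>v. qd D g v = qd D g' v) \<Longrightarrow> isom K D g g'"
  by (rule isomI[of _ _ id id]) (auto simp: linmap_id)

lemma isom_sym: assumes "isom K D g g'" shows "isom K D g' g"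
proof -
  obtain f h where *: "linmap K D D f" "linmap K D D h" "\<And>v i. i < D \<Longrightarrow> h (f v) i = v i"
    "\<And>v i. i < D \<Longrightarrow> f (h v) i = v i" "\<And>v. qd D g' (f v) = qd D g v"
    using isomE[OF assms] by blast
  have "qd D g (h v) = qd D g' v" for v
    unfolding *(5)[symmetric] by (rule qd_cong) (rule *(4))
  then show ?thesis using * by (intro isomI[of _ _ h f]) auto
qed

lemma isom_trans: assumes "isom K D g g'" "isom K D g' g''" shows "isom K D g g''"
proof -
  obtain f h where 1: "linmap K D D f" "linmap K D D h" "\<And>v i. i < D \<Longrightarrow> h (f v) i = v i"
    "\<And>v i. i < D \<Longrightarrow> f (h v) i = v i" "\<And>v. qd D g' (f v) = qd D g v"
    using isomE[OF assms(1)] by blast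
  obtain f' h' where 2: "linmap K D D f'" "linmap K D D h'" "\<And>v i. i < D \<Longrightarrow> h' (f' v) i = v i"
    "\<And>v i. i < D \<Longrightarrow> f' (h' v) i = v i" "\<And>v. qd D g'' (f' v) = qd D g' v"
    using isomE[OF assms(2)] by blast
  show ?thesis
  proof (rule isomI[OF linmap_comp[OF 1(1) 2(1)] linmap_comp[OF 2(2) 1(2)]])
    fix v i assume i: "i < D"
    show "h (h' (f' (f v))) i = v i"
      using linmapD(3)[OF 1(2), of "h' (f' (f v))" "f v" i] 2(3) 1(3) i by simp
    show "f' (f (h (h' v))) i = v i"
      using linmapD(3)[OF 2(1), of "f (h (h' v))" "h' v" i] 2(4) 1(4) i by simp
  qed (simp add: 1 2)
qed

lemma isom_pol:
  assumes "\<And>v. qd D g' (f v) = qd D g v" "linmap K D D f"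
  shows "pol D g' (f u) (f v) = pol D g u v"
proof -
  have "qd D g' (f u + f v) = qd D g (u + v)"
    using assms(1)[of "u + v"] by (simp add: linmapD(1)[OF assms(2)])
  then show ?thesis by (simp add: qd_add assms(1))
qed

lemma isom_metab: assumes "isom K D g g'" "metab K D g" shows "metab K D g'"
proof -
  obtain f h where *: "linmap K D D f" "linmap K D D h" "\<And>v i. i < D \<Longrightarrow> h (f v) i = v i"
    "\<And>v i. i < D \<Longrightarrow> f (h v) i = v i" "\<And>v. qd D g' (f v) = qd D g v"
    using isomE[OF assms(1)] by blast
  obtain I w where w: "finite (I::nat set)" "D = 2 * card I" "\<forall>i\<in>I. ovec K D (w i)"
     "indep K I D w" "\<forall>c. (\<forall>i\<in>I. c i \<in> K) \<longrightarrow> qd D g (lincomb I c w) = 0"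
    using assms(2) unfolding metab_def by blast
  show ?thesis
  proof (rule metabI[of I D K "\<lambda>i. f (w i)"])
    show "indep K I D (\<lambda>i. f (w i))"
      unfolding indep_def
    proof (intro allI impI)
      fix c assume c: "\<forall>i\<in>I. c i \<in> K" "\<forall>j<D. lincomb I c (\<lambda>i. f (w i)) j = 0"
      have "lincomb I c w j = 0" if "j < D" for j
      proof -
        have "lincomb I c w j = h (f (lincomb I c w)) j" using *(3) that by simp
        also have "\<dots> = h 0 j"
          using c(2) that by (intro linmapD(3)[OF *(2)]) (auto simp: linmap_lincomb[OF *(1) w(1)])
        finally show ?thesis by (simp add: linmap_zero[OF *(2)])
      qed
      then show "\<forall>i\<in>I. c i = 0" using w(4) c(1) unfolding indep_def by blast
    qed
    show "qd D g' (lincomb I c (\<lambda>i. f (w i))) = 0" if "\<And>i. i \<in> I \<Longrightarrow> c i \<in> K" for c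
      using w(5) that by (simp add: linmap_lincomb[OF *(1) w(1), symmetric] *(5))
  qed (use w linmapD(4)[OF *(1)] in auto)
qed

lemma isom_nonsing: assumes "isom K D g g'" "nonsing K D g" shows "nonsing K D g'"
proof -
  obtain f h where *: "linmap K D D f" "linmap K D D h" "\<And>v i. i < D \<Longrightarrow> h (f v) i = v i"
    "\<And>v i. i < D \<Longrightarrow> f (h v) i = v i" "\<And>v. qd D g' (f v) = qd D g v"
    using isomE[OF assms(1)] by blast
  show ?thesis
    unfolding nonsing_def
  proof (intro allI impI)
    fix v i assume v: "ovec K D v" "\<forall>u. ovec K D u \<longrightarrow> pol D g' v u = 0" and i: "i < D"
    have "pol D g (h v) u = 0" if "ovec K D u" for u
    proof -
      have "pol D g (h v) u = pol D g' (f (h v)) (f u)" by (simp add: isom_pol[OF *(5,1)])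
      also have "\<dots> = pol D g' v (f u)" by (rule pol_cong) (auto simp: *(4))
      finally show ?thesis using v(2) linmapD(4)[OF *(1) that] by simp
    qed
    then have "\<forall>i<D. h v i = 0"
      using assms(2) linmapD(4)[OF *(2) v(1)] unfolding nonsing_def by blast
    then have "f (h v) i = f 0 i" using i by (intro linmapD(3)[OF *(1)]) auto
    then show "v i = 0" using *(4) i by (simp add: linmap_zero[OF *(1)])
  qed
qed

section \<open>Orthogonal sums\<close>

definition gsum :: "nat \<Rightarrow> (nat \<Rightarrow> nat \<Rightarrow> 'b::zero) \<Rightarrow> (nat \<Rightarrow> nat \<Rightarrow> 'b) \<Rightarrow> nat \<Rightarrow> nat \<Rightarrow> 'b" where
  "gsum m g h = (\<lambda>i j. if i < m \<and> j < m then g i j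
     else if i \<ge> m \<and> j \<ge> m then h (i - m) (j - m) else 0)"

definition gscale :: "'b::times \<Rightarrow> (nat \<Rightarrow> nat \<Rightarrow> 'b) \<Rightarrow> nat \<Rightarrow> nat \<Rightarrow> 'b" where
  "gscale c g = (\<lambda>i j. c * g i j)"

definition tailv :: "nat \<Rightarrow> (nat \<Rightarrow> 'b) \<Rightarrow> nat \<Rightarrow> 'b" where
  "tailv m v = (\<lambda>i. v (m + i))"

definition appv :: "nat \<Rightarrow> (nat \<Rightarrow> 'b) \<Rightarrow> (nat \<Rightarrow> 'b) \<Rightarrow> nat \<Rightarrow> 'b" where
  "appv m u v = (\<lambda>i. if i < m then u i else v (i - m))"

lemma tailv_simps [simp]:
  "tailv m (u + v) = tailv m u + tailv m v" "tailv m (u - v) = tailv m u - tailv m v"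
  "tailv m (c \<star> v) = c \<star> tailv m v" "tailv m (0 :: nat \<Rightarrow> 'b::comm_ring_1) = 0"
  "tailv m (appv m u v) = v" "tailv m (tailv n w) = tailv (n + m) w"
  for u v :: "nat \<Rightarrow> 'b::comm_ring_1"
  by (auto simp: tailv_def appv_def add.assoc)

lemma tailv_lincomb: "tailv m (lincomb I c w) = lincomb I c (\<lambda>i. tailv m (w i))"
  by (simp add: tailv_def lincomb_def)

lemma appv_less [simp]: "i < m \<Longrightarrow> appv m u v i = u i"
  by (simp add: appv_def)

lemma appv_ge [simp]: "appv m u v (m + i) = v i"
  by (simp add: appv_def)

lemma appv_linear:
  "appv m (u + u') (v + v') = appv m u v + appv m u' v'"
  "appv m (c \<star> u) (c \<star> v) = c \<star> appv m u v"
  for u v :: "nat \<Rightarrow> 'b::comm_ring_1"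
  by (auto simp: appv_def)

lemma ovec_appv: "ovec K m u \<Longrightarrow> ovec K n v \<Longrightarrow> ovec K (m + n) (appv m u v)"
  by (auto simp: ovec_def appv_def)

lemma ovec_tailv: "ovec K (m + n) v \<Longrightarrow> ovec K n (tailv m v)"
  by (auto simp: ovec_def tailv_def)

lemma ovec_less: "ovec K (m + n) v \<Longrightarrow> ovec K m v"
  by (auto simp: ovec_def)

lemma sum_lessThan_add: "(\<Sum>i<m + n. f i) = (\<Sum>i<m. f i) + (\<Sum>i<n. f (m + i))"
  for f :: "nat \<Rightarrow> 'c::comm_monoid_add"
  by (induction n) (simp_all add: add.assoc)

lemma bil_gsum: "bil (m + n) (gsum m g h) u v = bil m g u v + bil n h (tailv m u) (tailv m v)"
  unfolding bil_def sum_lessThan_add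
  by (simp add: gsum_def tailv_def)

lemma qd_gsum: "qd (m + n) (gsum m g h) v = qd m g v + qd n h (tailv m v)"
  by (simp add: qd_def bil_gsum)

lemma pol_gsum: "pol (m + n) (gsum m g h) u v = pol m g u v + pol n h (tailv m u) (tailv m v)"
  by (simp add: pol_def bil_gsum)

lemma bil_gscale: "bil m (gscale c g) u v = c * bil m g u v"
  by (simp add: bil_def gscale_def sum_distrib_left mult_ac)

lemma qd_gscale: "qd m (gscale c g) v = c * qd m g v"
  by (simp add: qd_def bil_gscale)

lemma pol_gscale: "pol m (gscale c g) u v = c * pol m g u v"
  by (simp add: pol_def bil_gscale distrib_left)

lemma qd_appv [simp]: "qd m g (appv m u v) = qd m g u"
  by (rule qd_cong) simp

lemma pol_appv [simp]: "pol m g (appv m u v) w = pol m g u w" "pol m g w (appv m u v) = pol m g w u"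
  by (rule pol_cong; simp)+

lemma ogram_gsum: "is_subfield K \<Longrightarrow> ogram K m g \<Longrightarrow> ogram K n h \<Longrightarrow> ogram K (m + n) (gsum m g h)"
  by (auto simp: ogram_def gsum_def is_subfieldD)

lemma ogram_gscale: "is_subfield K \<Longrightarrow> c \<in> K \<Longrightarrow> ogram K m g \<Longrightarrow> ogram K m (gscale c g)"
  by (auto simp: ogram_def gscale_def is_subfieldD)

lemma gsum_assoc: "gsum m g (gsum n h k) = gsum (m + n) (gsum m g h) k"
  by (rule ext, rule ext) (auto simp: gsum_def)

lemma gsum_0 [simp]: "gsum 0 g h = h"
  by (simp add: gsum_def)

lemma linmap_block:
  assumes "is_subfield K" "linmap K m m' f" "linmap K n n' h"
  shows "linmap K (m + n) (m' + n') (\<lambda>v. appv m' (f v) (h (tailv m v)))"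
  unfolding linmap_def
proof (intro conjI allI impI)
  fix u v :: "nat \<Rightarrow> 'a" and i assume *: "\<forall>i<m + n. u i = v i" "i < m' + n'"
  show "appv m' (f u) (h (tailv m u)) i = appv m' (f v) (h (tailv m v)) i"
  proof (cases "i < m'")
    case True
    then show ?thesis using linmapD(3)[OF assms(2), of u v i] * by simp
  next
    case False
    then show ?thesis using linmapD(3)[OF assms(3), of "tailv m u" "tailv m v" "i - m'"] *
      by (simp add: appv_def tailv_def)
  qed
qed (auto simp: linmapD(1,2)[OF assms(2)] linmapD(1,2)[OF assms(3)] appv_linear
      intro!: ovec_appv linmapD(4)[OF assms(2)] linmapD(4)[OF assms(3)] ovec_tailv ovec_less[of K m n])

lemma isom_gsum:
  assumes K: "is_subfield K" and "isom K m g g'" "isom K n h h'"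
  shows "isom K (m + n) (gsum m g h) (gsum m g' h')"
proof -
  obtain f k where 1: "linmap K m m f" "linmap K m m k" "\<And>v i. i < m \<Longrightarrow> k (f v) i = v i"
    "\<And>v i. i < m \<Longrightarrow> f (k v) i = v i" "\<And>v. qd m g' (f v) = qd m g v"
    using isomE[OF assms(2)] by blast
  obtain f' k' where 2: "linmap K n n f'" "linmap K n n k'" "\<And>v i. i < n \<Longrightarrow> k' (f' v) i = v i"
    "\<And>v i. i < n \<Longrightarrow> f' (k' v) i = v i" "\<And>v. qd n h' (f' v) = qd n h v"
    using isomE[OF assms(3)] by blast
  have inv: "appv m (a (appv m (b v) w)) (c (d (tailv m v))) i = v i"
    if "linmap K m m a" "\<And>v i. i < m \<Longrightarrow> a (b v) i = v i" "\<And>v i. i < n \<Longrightarrow> c (d v) i = v i"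
       "i < m + n" for a b c d :: "(nat \<Rightarrow> 'a) \<Rightarrow> nat \<Rightarrow> 'a" and v w i
  proof (cases "i < m")
    case True
    have "a (appv m (b v) w) i = a (b v) i" using True by (intro linmapD(3)[OF that(1)]) auto
    then show ?thesis using True that by simp
  next
    case False
    then show ?thesis using that(3)[of "i - m"] that(4) by (simp add: appv_def tailv_def)
  qed
  show ?thesis
    by (rule isomI[OF linmap_block[OF K 1(1) 2(1)] linmap_block[OF K 1(2) 2(2)]])
       (use inv 1 2 in \<open>simp_all add: qd_gsum\<close>)
qed

lemma linmap_swap: "linmap K (m + n) (n + m) (\<lambda>v. appv n (tailv m v) v)"
  unfolding linmap_def
proof (intro conjI allI impI)
  fix u v :: "nat \<Rightarrow> 'a" and i assume *: "\<forall>i<m + n. u i = v i" "i < n + m"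
  then show "appv n (tailv m u) u i = appv n (tailv m v) v i"
    by (simp add: appv_def tailv_def)
qed (auto simp: appv_linear intro!: ovec_appv ovec_tailv ovec_less[of K m n])

lemma isom_swap: "isom K (m + n) (gsum m g h) (gsum n h g)"
proof (rule isomI)
  show "linmap K (m + n) (m + n) (\<lambda>v. appv n (tailv m v) v)"
    using linmap_swap[of K m n] by (simp add: add.commute)
  show "linmap K (m + n) (m + n) (\<lambda>v. appv m (tailv n v) v)"
    using linmap_swap[of K n m] by (simp add: add.commute)
  fix v :: "nat \<Rightarrow> 'a"
  show "qd (m + n) (gsum n h g) (appv n (tailv m v) v) = qd (m + n) (gsum m g h) v"
    using qd_gsum[of n m h g "appv n (tailv m v) v"] by (simp add: add.commute qd_gsum)
qed (auto simp: appv_def tailv_def)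

lemma nonsing_gsum:
  assumes K: "is_subfield K" and g: "nonsing K m g" and h: "nonsing K n h"
  shows "nonsing K (m + n) (gsum m g h)"
  unfolding nonsing_def
proof (intro allI impI)
  fix v i assume v: "ovec K (m + n) v" "\<forall>u. ovec K (m + n) u \<longrightarrow> pol (m + n) (gsum m g h) v u = 0"
    and i: "i < m + n"
  have "pol m g v u = 0" if "ovec K m u" for u
    using v(2)[rule_format, OF ovec_appv[OF that ovec_zero[OF K]]] by (simp add: pol_gsum)
  then have 1: "\<forall>i<m. v i = 0"
    using g ovec_less[OF v(1)] unfolding nonsing_def by blast
  have "pol n h (tailv m v) u = 0" if "ovec K n u" for u
    using v(2)[rule_format, OF ovec_appv[OF ovec_zero[OF K] that]] by (simp add: pol_gsum)
  then have "\<forall>i<n. tailv m v i = 0"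
    using h ovec_tailv[OF v(1)] unfolding nonsing_def by blast
  then show "v i = 0" using 1 i by (cases "i < m") (auto simp: tailv_def not_less le_iff_add)
qed

lemma nonsing_gscale:
  "c \<noteq> 0 \<Longrightarrow> nonsing K m g \<Longrightarrow> nonsing K m (gscale c g)" for c :: "'b::field"
  unfolding nonsing_def by (simp add: pol_gscale)

lemma isom_gscale: "isom K m g g' \<Longrightarrow> isom K m (gscale c g) (gscale c g')"
  unfolding isom_def by (simp add: qd_gscale) metis

text \<open>The graph of an anti-isometry is totally isotropic.\<close>

lemma metab_graph:
  assumes K: "is_subfield K" and f: "linmap K m m f" "\<And>v. qd m h (f v) = - qd m g v"
  shows "metab K (m + m) (gsum m g h)"
proof (rule metabI[of "{..<m}" _ _ "\<lambda>i. appv m (unitv i) (f (unitv i))"])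
  have e: "tailv m (lincomb {..<m} c (\<lambda>i. appv m (unitv i) (f (unitv i)))) = f (lincomb {..<m} c unitv)" for c
    by (simp add: tailv_lincomb linmap_lincomb[OF f(1)])
  have e': "lincomb {..<m} c (\<lambda>i. appv m (unitv i) (f (unitv i))) j = c j" if "j < m" for c j
    using lincomb_unitv[OF that, of c] that by (simp add: lincomb_def)
  show "indep K {..<m} (m + m) (\<lambda>i. appv m (unitv i) (f (unitv i)))"
    unfolding indep_def
  proof (intro allI impI ballI)
    fix c i assume "\<forall>j<m + m. lincomb {..<m} c (\<lambda>i. appv m (unitv i) (f (unitv i))) j = 0"
      and i: "i \<in> {..<m}"
    then show "c i = 0" using e'[of i c] by simp
  qed
  fix c :: "nat \<Rightarrow> 'a"
  have "qd m g (lincomb {..<m} c (\<lambda>i. appv m (unitv i) (f (unitv i)))) = qd m g (lincomb {..<m} c unitv)"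
    by (rule qd_cong) (simp add: e' lincomb_unitv)
  then show "qd (m + m) (gsum m g h) (lincomb {..<m} c (\<lambda>i. appv m (unitv i) (f (unitv i)))) = 0"
    by (simp add: qd_gsum e f(2))
qed (auto intro!: ovec_appv ovec_unitv linmapD(4)[OF f(1)] K)

lemma metab_gsum:
  assumes K: "is_subfield K" and "metab K m g" "metab K n h"
  shows "metab K (m + n) (gsum m g h)"
proof -
  obtain I w where w: "finite (I::nat set)" "m = 2 * card I" "\<forall>i\<in>I. ovec K m (w i)"
     "indep K I m w" "\<forall>c. (\<forall>i\<in>I. c i \<in> K) \<longrightarrow> qd m g (lincomb I c w) = 0"
    using assms(2) unfolding metab_def by blast
  obtain J z where z: "finite (J::nat set)" "n = 2 * card J" "\<forall>i\<in>J. ovec K n (z i)"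
     "indep K J n z" "\<forall>c. (\<forall>i\<in>J. c i \<in> K) \<longrightarrow> qd n h (lincomb J c z) = 0"
    using assms(3) unfolding metab_def by blast
  let ?S = "I <+> J" and ?x = "case_sum (\<lambda>i. appv m (w i) 0) (\<lambda>j. appv m 0 (z j))"
  have e: "lincomb ?S c ?x = appv m (lincomb I (c \<circ> Inl) w) (lincomb J (c \<circ> Inr) z)" for c
    using w(1) z(1) by (auto simp: fun_eq_iff lincomb_def sum.Plus appv_def)
  show ?thesis
  proof (rule metabI[of ?S _ _ ?x])
    show "indep K ?S (m + n) ?x"
      unfolding indep_def
    proof (intro allI impI)
      fix c assume c: "\<forall>i\<in>?S. c i \<in> K" "\<forall>j<m + n. lincomb ?S c ?x j = 0"
      have 1: "\<forall>j<m. lincomb I (c \<circ> Inl) w j = 0"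
      proof (intro allI impI)
        fix j assume "j < m"
        then show "lincomb I (c \<circ> Inl) w j = 0" using c(2)[rule_format, of j] by (simp add: e)
      qed
      have 2: "\<forall>j<n. lincomb J (c \<circ> Inr) z j = 0"
      proof (intro allI impI)
        fix j assume "j < n"
        then show "lincomb J (c \<circ> Inr) z j = 0" using c(2)[rule_format, of "m + j"] by (simp add: e)
      qed
      have "\<forall>i\<in>I. (c \<circ> Inl) i \<in> K" "\<forall>i\<in>J. (c \<circ> Inr) i \<in> K" using c(1) by auto
      then have "\<forall>i\<in>I. (c \<circ> Inl) i = 0" "\<forall>i\<in>J. (c \<circ> Inr) i = 0"
        using w(4)[unfolded indep_def] z(4)[unfolded indep_def] 1 2 by metis+
      then show "\<forall>i\<in>?S. c i = 0" by auto
    qed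
    show "qd (m + n) (gsum m g h) (lincomb ?S c ?x) = 0" if "\<And>i. i \<in> ?S \<Longrightarrow> c i \<in> K" for c
    proof -
      have "\<forall>i\<in>I. (c \<circ> Inl) i \<in> K" "\<forall>i\<in>J. (c \<circ> Inr) i \<in> K" using that by auto
      then show ?thesis using w(5) z(5) by (simp add: e qd_gsum)
    qed
    show "ovec K (m + n) (?x i)" if "i \<in> ?S" for i
      using that w(3) z(3) ovec_zero[OF K] by (auto intro!: ovec_appv)
  qed (use w z in \<open>simp_all add: card_Plus\<close>)
qed

section \<open>Hyperbolic planes\<close>

text \<open>\<open>F\<close> sends coordinates to vectors and \<open>G\<close> sends the unit
  vectors to chosen coordinates. A relation among the rows of \<open>Q\<close> would be killed by
  \<open>F\<close>, which excludes \<open>m < D\<close>.\<close>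

lemma isom_of_basis:
  assumes K: "is_subfield K" and P: "\<And>i. i < m \<Longrightarrow> ovec K D (P i)" and ind: "indep K {..<m} D P"
    and span: "\<And>v. ovec K D v \<Longrightarrow> \<exists>c. (\<forall>i<m. c i \<in> K) \<and> (\<forall>j<D. v j = lincomb {..<m} c P j)"
  shows "m = D" "isom K D (\<lambda>i k. bil D g (P i) (P k)) g"
proof -
  have "\<exists>Q. \<forall>i. (\<forall>k<m. Q i k \<in> K) \<and> (\<forall>j<D. unitv i j = lincomb {..<m} (Q i) P j)"
    by (intro choice allI span ovec_unitv K)
  then obtain Q where Q: "\<And>i k. k < m \<Longrightarrow> Q i k \<in> K"
    "\<And>i j. j < D \<Longrightarrow> unitv i j = lincomb {..<m} (Q i) P j" by blast
  define F where "F c = lincomb {..<m} c P" for c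
  define G where "G v = lincomb {..<D} v Q" for v
  have lF: "linmap K m D F" unfolding F_def by (rule linmap_coords[OF K P])
  have lG: "linmap K D m G" unfolding G_def
    by (rule linmap_coords[OF K]) (simp add: ovec_def Q(1))
  have FG: "F (G v) j = v j" if j: "j < D" for v j
  proof -
    have "F (G v) j = (\<Sum>i<D. v i * lincomb {..<m} (Q i) P j)"
      unfolding G_def linmap_lincomb[OF lF finite_lessThan] by (simp add: lincomb_def F_def)
    also have "\<dots> = (\<Sum>i<D. v i * unitv i j)" using Q(2)[OF j] by simp
    also have "\<dots> = v j" using lincomb_unitv[OF j, of v] by (simp add: lincomb_def)
    finally show ?thesis .
  qed
  have inj: "\<forall>i<m. c i = 0" if "ovec K m c" "\<And>j. j < D \<Longrightarrow> F c j = 0" for c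
    using ind that unfolding indep_def F_def ovec_def by auto
  show mD: "m = D"
  proof (rule antisym)
    show "m \<le> D" using indep_card_le[OF K finite_lessThan _ ind] P by simp
    show "D \<le> m"
    proof (rule ccontr)
      assume "\<not> D \<le> m"
      then obtain c where c: "\<exists>i<D. c i \<noteq> 0" "\<forall>j<m. lincomb {..<D} c Q j = 0"
        using exists_nontrivial_solution[OF K, of "{..<D}" m Q] Q(1) by auto
      have "c j = 0" if "j < D" for j
      proof -
        have "F (G c) j = F 0 j"
          using c(2) that by (intro linmapD(3)[OF lF]) (auto simp: G_def)
        then show ?thesis using FG[OF that, of c] by (simp add: linmap_zero[OF lF])
      qed
      then show False using c(1) by blast
    qed
  qed
  have GFK: "G (F c) i = c i" if c: "ovec K m c" and i: "i < m" for c i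
  proof -
    let ?d = "G (F c) - c"
    have "ovec K m ?d"
      using linmapD(4)[OF lG linmapD(4)[OF lF c]] c by (intro ovec_diff[OF K])
    moreover have "F ?d j = 0" if "j < D" for j
    proof -
      have "F (?d + c) j = F ?d j + F c j" by (simp only: linmapD(1)[OF lF] plus_fun_apply)
      moreover have "?d + c = G (F c)" by simp
      ultimately show ?thesis using FG[OF that, of "F c"] by (metis add_cancel_left_left)
    qed
    ultimately show ?thesis using inj i by fastforce
  qed
  \<comment> \<open>Independence yields the identity only for coefficients in \<open>K\<close>. It
    extends to all \<open>c\<close> by expanding in unit vectors, which lie over
    \<open>K\<close>.\<close>
  have GF: "G (F c) i = c i" if i: "i < m" for c i
  proof -
    have "G (F c) i = G (F (lincomb {..<m} c unitv)) i"
      using i by (intro linmapD(3)[OF lG] linmapD(3)[OF lF]) (auto simp: lincomb_unitv)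
    also have "\<dots> = (\<Sum>k<m. c k * G (F (unitv k)) i)"
      unfolding linmap_lincomb[OF linmap_comp[OF lF lG] finite_lessThan] by (simp add: lincomb_def)
    also have "\<dots> = (\<Sum>k<m. c k * unitv k i)"
      using GFK[OF ovec_unitv[OF K] i] by simp
    also have "\<dots> = c i" using lincomb_unitv[OF i, of c] by (simp add: lincomb_def)
    finally show ?thesis .
  qed
  show "isom K D (\<lambda>i k. bil D g (P i) (P k)) g"
    using lF lG GF FG unfolding mD by (intro isomI[of _ _ F G]) (auto simp: F_def qd_lincomb mD)
qed

definition hyp_gram :: "nat \<Rightarrow> nat \<Rightarrow> 'b::zero_neq_one" where
  "hyp_gram = (\<lambda>i j. if i = 0 \<and> j = 1 then 1 else 0)"

lemma qd_hyp: "qd 2 hyp_gram v = v 0 * v 1"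
  by (simp add: qd_def bil_def hyp_gram_def numeral_2_eq_2)

lemma pol_hyp: "pol 2 hyp_gram u v = u 0 * v 1 + u 1 * v 0"
  by (simp add: pol_def bil_def hyp_gram_def numeral_2_eq_2 mult.commute)

lemma nonsing_hyp: "is_subfield K \<Longrightarrow> nonsing K 2 hyp_gram"
  unfolding nonsing_def
proof (intro allI impI)
  fix v :: "nat \<Rightarrow> 'a" and i :: nat
  assume K: "is_subfield K" and v: "\<forall>u. ovec K 2 u \<longrightarrow> pol 2 hyp_gram v u = 0" and i: "i < 2"
  show "v i = 0"
    using v[rule_format, OF ovec_unitv[OF K], of 0] v[rule_format, OF ovec_unitv[OF K], of 1] i
    by (auto simp: pol_hyp unitv_def less_2_cases_iff)
qed

lemma metab_hyp: assumes "is_subfield K" shows "metab K 2 hyp_gram"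
proof (rule metabI[of "{0::nat}" _ _ "\<lambda>_. unitv 0"])
  show "indep K {0::nat} 2 (\<lambda>_. unitv 0)"
    unfolding indep_def by (auto simp: lincomb_def unitv_def dest: spec[of _ 0])
  show "qd 2 hyp_gram (lincomb {0::nat} c (\<lambda>_. unitv 0)) = 0" for c :: "nat \<Rightarrow> 'a"
    unfolding qd_hyp by (simp add: lincomb_def unitv_def)
qed (auto intro: ovec_unitv[OF assms])

lemma less_2_add_cases: "j < 2 + D \<Longrightarrow> j = 0 \<or> j = 1 \<or> (\<exists>k<D. j = 2 + k)" for j :: nat
  by (cases "j < 2") (auto intro!: exI[of _ "j - 2"])

text \<open>An isotropic vector \<open>x\<close> has a partner \<open>y\<close>, isotropic as well
  and with polar value 1. The plane they span is an orthogonal summand since every vector can be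
  projected to its complement, whose basis supplies \<open>g'\<close>.\<close>

lemma split_hyperbolic_plane:
  assumes K: "is_subfield K" and g: "ogram K D g" and ns: "nonsing K D g"
    and x: "ovec K D x" "\<exists>i<D. x i \<noteq> 0" "qd D g x = 0"
  shows "\<exists>D' g'. D = 2 + D' \<and> ogram K D' g' \<and> nonsing K D' g' \<and>
    isom K D (gsum 2 hyp_gram g') g"
proof -
  obtain y0 where y0: "ovec K D y0" "pol D g x y0 \<noteq> 0"
    using ns x(1,2) unfolding nonsing_def by blast
  define y1 where "y1 = inverse (pol D g x y0) \<star> y0"
  have y1: "ovec K D y1" "pol D g x y1 = 1"
    unfolding y1_def using y0 by (auto intro!: ovec_smul K is_subfieldD(6)[OF K] pol_over[OF K g x(1)])
  \<comment> \<open>Since \<open>pol D g y1 x = 1\<close>, subtracting \<open>a \<star> x\<close>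
    from \<open>y1\<close> lowers its value by \<open>a\<close>; this makes \<open>y\<close>
    isotropic without dividing by 2.\<close>
  define y where "y = y1 - qd D g y1 \<star> x"
  have y: "ovec K D y"
    unfolding y_def by (intro ovec_diff ovec_smul K y1 x qd_over[OF K g])
  have xx: "pol D g x x = 0" using x(3) by (simp add: pol_self)
  have y1x: "pol D g y1 x = 1" using y1(2) by (simp add: pol_sym)
  have xy: "pol D g x y = 1" "pol D g y x = 1" using y1(2) y1x xx by (simp_all add: y_def)
  have qy: "qd D g y = 0"
    unfolding y_def using y1x x(3) by (simp add: qd_diff qd_smul)
  have yy: "pol D g y y = 0" using qy by (simp add: pol_self)
  define C where "C = {v. ovec K D v \<and> pol D g v x = 0 \<and> pol D g v y = 0}"
  \<comment> \<open>Projection to the orthogonal complement of the plane: the component along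
    \<open>x\<close> is read off by pairing with \<open>y\<close>, and conversely.\<close>
  define p where "p v = v - (pol D g v y \<star> x + pol D g v x \<star> y)" for v
  have pC: "p v \<in> C" if "ovec K D v" for v
    unfolding C_def p_def using that x(1) y xx xy yy
    by (auto intro!: ovec_diff ovec_add ovec_smul K pol_over[OF K g])
  obtain n f where f: "\<forall>i<(n::nat). f i \<in> C" "indep K {..<n} D f"
    "\<forall>v\<in>C. \<exists>c. (\<forall>i<n. c i \<in> K) \<and> (\<forall>j<D. v j = lincomb {..<n} c f j)"
    using exists_basis[OF K, of C D] unfolding C_def by blast
  define P where "P = (\<lambda>i::nat. if i = 0 then x else if i = 1 then y else f (i - 2))"
  have lP: "lincomb {..<2 + n} c P = c 0 \<star> x + c 1 \<star> y + lincomb {..<n} (tailv 2 c) f" for c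
    by (rule ext, simp only: lincomb_def sum_lessThan_add)
       (simp add: P_def tailv_def numeral_2_eq_2)
  define g' where "g' = (\<lambda>i k. bil D g (f i) (f k))"
  have fx: "pol D g (lincomb {..<n} c f) x = 0" "pol D g (lincomb {..<n} c f) y = 0"
    for c using f(1) by (auto simp: pol_lincomb_left C_def)
  then have xf: "pol D g x (lincomb {..<n} c f) = 0" "pol D g y (lincomb {..<n} c f) = 0" for c
    by (simp_all add: pol_sym[of D g _ "lincomb {..<n} c f"])
  have P: "ovec K D (P i)" if "i < 2 + n" for i
    using that x(1) y f(1) by (auto simp: P_def C_def)
  have ind: "indep K {..<2 + n} D P"
    unfolding indep_def
  proof (intro allI impI)
    fix c assume c: "\<forall>i\<in>{..<2 + n}. c i \<in> K" "\<forall>j<D. lincomb {..<2 + n} c P j = 0"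
    have "pol D g (lincomb {..<2 + n} c P) z = pol D g 0 z" for z
      using c(2) by (intro pol_cong) auto
    from this[of x, unfolded lP] this[of y, unfolded lP] have c01: "c 0 = 0" "c 1 = 0"
      using xx xy yy fx by simp_all
    then have "\<forall>j<D. lincomb {..<n} (tailv 2 c) f j = 0" using c(2)[unfolded lP] by simp
    moreover have "\<forall>i\<in>{..<n}. tailv 2 c i \<in> K" using c(1) by (simp add: tailv_def)
    ultimately have "\<forall>i<n. tailv 2 c i = 0" using f(2) unfolding indep_def by blast
    then show "\<forall>i\<in>{..<2 + n}. c i = 0"
      using c01 by (auto simp del: add_2_eq_Suc dest!: less_2_add_cases simp: tailv_def)
  qed
  have span: "\<exists>c. (\<forall>i<2 + n. c i \<in> K) \<and> (\<forall>j<D. v j = lincomb {..<2 + n} c P j)"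
    if v: "ovec K D v" for v
  proof -
    obtain c where c: "\<forall>i<n. c i \<in> K" "\<forall>j<D. p v j = lincomb {..<n} c f j"
      using f(3) pC[OF v] by blast
    define d where "d = appv 2 (\<lambda>i. if i = 0 then pol D g v y else pol D g v x) c"
    have "\<forall>i<2 + n. d i \<in> K"
      using c(1) by (auto simp: d_def appv_def intro!: pol_over[OF K g v] x(1) y)
    moreover have "v j = lincomb {..<2 + n} d P j" if "j < D" for j
      using c(2)[rule_format, OF that] unfolding lP by (simp add: d_def p_def algebra_simps)
    ultimately show ?thesis by blast
  qed
  note b = isom_of_basis[OF K P ind span]
  have D: "D = 2 + n" using b(1) by simp
  have "qd (2 + n) (gsum 2 hyp_gram g') c = qd (2 + n) (\<lambda>i k. bil D g (P i) (P k)) c" for c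
  proof -
    let ?l = "lincomb {..<n} (tailv 2 c) f"
    have "qd (2 + n) (\<lambda>i k. bil D g (P i) (P k)) c = qd D g (c 0 \<star> x + c 1 \<star> y + ?l)"
      by (simp only: qd_lincomb[symmetric] lP)
    also have "\<dots> = c 0 * c 1 + qd D g ?l"
      using xf x(3) qy xy by (simp add: qd_add qd_smul)
    also have "\<dots> = qd (2 + n) (gsum 2 hyp_gram g') c"
      unfolding qd_gsum by (simp add: qd_hyp g'_def qd_lincomb)
    finally show ?thesis by simp
  qed
  then have "isom K D (gsum 2 hyp_gram g') (\<lambda>i k. bil D g (P i) (P k))"
    unfolding D by (rule isom_of_qd_eq)
  from isom_trans[OF this b(2)] have iso: "isom K D (gsum 2 hyp_gram g') g" .
  have g': "ogram K n g'"
    using f(1) unfolding ogram_def g'_def C_def by (auto intro!: bil_over[OF K g])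
  have ns2: "nonsing K (2 + n) (gsum 2 hyp_gram g')"
    using isom_nonsing[OF isom_sym[OF iso] ns] D by simp
  have "nonsing K n g'"
    unfolding nonsing_def
  proof (intro allI impI)
    fix v i assume v: "ovec K n v" "\<forall>u. ovec K n u \<longrightarrow> pol n g' v u = 0" and i: "i < n"
    have "\<forall>u. ovec K (2 + n) u \<longrightarrow> pol (2 + n) (gsum 2 hyp_gram g') (appv 2 0 v) u = 0"
      using v(2) unfolding pol_gsum by (simp add: ovec_tailv)
    then have "\<forall>i<2 + n. appv 2 0 v i = 0"
      using ns2 ovec_appv[OF ovec_zero[OF K] v(1), of 2] unfolding nonsing_def by blast
    from this[rule_format, of "2 + i"] show "v i = 0" using i by (simp add: appv_def)
  qed
  then show ?thesis using D g' iso by blast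
qed

text \<open>Lagrangian reduction: the part of the Lagrangian with coordinate 1 equal to 0, i.e.
  orthogonal to the first basis vector, projects to a totally isotropic subspace of
  \<open>g\<close>. Either this condition is a proper one and costs a dimension, while the
  projection stays injective; or it holds throughout, and the projection kills at most a
  line.\<close>

lemma metab_cancel_hyp:
  assumes K: "is_subfield K" and m: "metab K (2 + D) (gsum 2 hyp_gram g)"
  shows "metab K D g"
proof -
  obtain I w where w: "finite (I::nat set)" "2 + D = 2 * card I" "\<forall>i\<in>I. ovec K (2 + D) (w i)"
     "indep K I (2 + D) w"
     "\<forall>c. (\<forall>i\<in>I. c i \<in> K) \<longrightarrow> qd (2 + D) (gsum 2 hyp_gram g) (lincomb I c w) = 0"
    using m unfolding metab_def by blast
  have z0: "\<forall>i\<in>I. c i = 0" if "\<forall>i\<in>I. c i \<in> K" "lincomb I c w 0 = 0" "lincomb I c w 1 = 0"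
    "\<forall>j<D. tailv 2 (lincomb I c w) j = 0" for c
  proof -
    have "\<forall>j<2 + D. lincomb I c w j = 0"
    proof (intro allI impI)
      fix j assume "j < 2 + D"
      then consider "j = 0" | "j = 1" | k where "j = 2 + k" "k < D"
        using less_2_add_cases[of j D] by auto
      then show "lincomb I c w j = 0"
        using that by cases (auto simp: tailv_def)
    qed
    then show ?thesis using w(4) that(1) unfolding indep_def by blast
  qed
  have q0: "lincomb I c w 0 * lincomb I c w 1 + qd D g (tailv 2 (lincomb I c w)) = 0"
    if "\<forall>i\<in>I. c i \<in> K" for c
    using w(5) that unfolding qd_gsum by (simp add: qd_hyp)
  have tl: "\<forall>i\<in>I. ovec K D (tailv 2 (w i))" using w(3) ovec_tailv by blast
  show ?thesis
  proof (cases "\<exists>k\<in>I. w k 1 \<noteq> 0")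
    case True
    then obtain k where k: "k \<in> I" "w k 1 \<noteq> 0" by blast
    let ?J = "I - {k}"
    define z where "z i = w i - (w i 1 / w k 1) \<star> w k" for i
    define ext where "ext c = (\<lambda>i. if i = k then - (\<Sum>i\<in>?J. c i * (w i 1 / w k 1)) else c i)" for c :: "nat \<Rightarrow> 'a"
    have ez: "lincomb ?J c z = lincomb I (ext c) w" for c
    proof -
      have "lincomb I (ext c) w = ext c k \<star> w k + lincomb ?J (ext c) w"
        using lincomb_insert[of ?J k "ext c" w] w(1) k(1) by (simp add: insert_absorb)
      also have "lincomb ?J (ext c) w = lincomb ?J c w"
        unfolding lincomb_def by (intro ext sum.cong) (auto simp: ext_def)
      finally show ?thesis
        by (auto simp: fun_eq_iff lincomb_def z_def ext_def sum_subtractf right_diff_distrib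
            sum_distrib_right mult.assoc)
    qed
    have extK: "\<forall>i\<in>I. ext c i \<in> K" if "\<forall>i\<in>?J. c i \<in> K" for c
      using that w(3) k by (auto simp: ext_def ovec_def intro!: is_subfieldD[OF K] subfield_sum[OF K])
    have z1: "lincomb ?J c z 1 = 0" for c
      using k by (simp add: lincomb_def z_def)
    show ?thesis
    proof (rule metabI[of ?J _ _ "\<lambda>i. tailv 2 (z i)"])
      show "D = 2 * card ?J" using w(1,2) k(1) by simp
      have wK: "w i 1 \<in> K" if "i \<in> I" for i using w(3) that by (auto simp: ovec_def)
      show "ovec K D (tailv 2 (z i))" if "i \<in> ?J" for i
        unfolding z_def tailv_simps using that tl k wK
        by (auto intro!: ovec_diff ovec_smul K is_subfieldD[OF K])
      show "qd D g (lincomb ?J c (\<lambda>i. tailv 2 (z i))) = 0" if c: "\<And>i. i \<in> ?J \<Longrightarrow> c i \<in> K" for c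
        using q0[OF extK, of c] c z1[of c] by (simp add: ez tailv_lincomb[symmetric])
      show "indep K ?J D (\<lambda>i. tailv 2 (z i))"
        unfolding indep_def
      proof (intro allI impI)
        fix c assume c: "\<forall>i\<in>?J. c i \<in> K" "\<forall>j<D. lincomb ?J c (\<lambda>i. tailv 2 (z i)) j = 0"
        have t0: "\<forall>j<D. tailv 2 (lincomb I (ext c) w) j = 0"
          using c(2) by (simp add: tailv_lincomb[symmetric] ez)
        let ?u = "lincomb I (ext c) w"
        have u1: "?u 1 = 0" using z1[of c] by (simp add: ez)
        \<comment> \<open>\<open>?u\<close> is supported on coordinate 0. Evaluating the form on
          \<open>?u + w k\<close> and on \<open>w k\<close>, both in the Lagrangian, isolates the
          polar value \<open>?u 0 * w k 1\<close>, which must vanish.\<close>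
        define d where "d = (ext c)(k := ext c k + 1)"
        have dK: "\<forall>i\<in>I. d i \<in> K"
          using extK[OF c(1)] is_subfieldD(2,3)[OF K] by (auto simp: d_def)
        have "lincomb I d w = ext c k \<star> w k + w k + lincomb ?J (ext c) w"
          unfolding lincomb_def using w(1) k(1)
          by (auto simp: fun_eq_iff d_def sum.remove[of I k] algebra_simps intro!: sum.cong)
        moreover have "?u = ext c k \<star> w k + lincomb ?J (ext c) w"
          using lincomb_insert[of ?J k "ext c" w] w(1) k(1) by (simp add: insert_absorb)
        ultimately have du: "lincomb I d w = ?u + w k" by simp
        have "qd D g (tailv 2 ?u + tailv 2 (w k)) = qd D g (tailv 2 (w k))"
          using t0 by (intro qd_cong) simp
        moreover have "lincomb I (\<lambda>i. if i = k then 1 else 0) w = w k"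
          using w(1) k(1) by (simp add: fun_eq_iff lincomb_def if_distrib[of "\<lambda>x. x * _"] cong: if_cong)
        then have "w k 0 * w k 1 + qd D g (tailv 2 (w k)) = 0"
          using q0[of "\<lambda>i. if i = k then 1 else 0"] is_subfieldD(1,2)[OF K] by simp
        moreover have "(?u 0 + w k 0) * w k 1 + qd D g (tailv 2 ?u + tailv 2 (w k)) = 0"
          using q0[OF dK] u1 unfolding du by simp
        ultimately have "?u 0 * w k 1 = 0" by (simp add: algebra_simps add_eq_0_iff)
        then have "?u 0 = 0" using k(2) by simp
        then have "\<forall>i\<in>I. ext c i = 0" using z0[OF extK[OF c(1)]] u1 t0 by blast
        then show "\<forall>i\<in>?J. c i = 0" by (auto simp: ext_def split: if_splits)
      qed
    qed (use w(1) in auto)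
  next
    case False
    then have w1: "lincomb I c w 1 = 0" for c by (simp add: lincomb_def)
    have q1: "qd D g (lincomb I c (\<lambda>i. tailv 2 (w i))) = 0" if "\<forall>i\<in>I. c i \<in> K" for c
      using q0[OF that] w1[of c] by (simp add: tailv_lincomb)
    \<comment> \<open>Only multiples of the first basis vector are lost in the projection. One index
      is dropped: any one if nothing is lost, otherwise one that occurs in the relation.\<close>
    obtain k where k: "k \<in> I" and ind: "indep K (I - {k}) D (\<lambda>i. tailv 2 (w i))"
    proof (cases "indep K I D (\<lambda>i. tailv 2 (w i))")
      case True
      obtain k where k: "k \<in> I" using w(2) by fastforce
      have "indep K (I - {k}) D (\<lambda>i. tailv 2 (w i))"
        unfolding indep_def
      proof (intro allI impI)
        fix c assume c: "\<forall>i\<in>I - {k}. c i \<in> K" "\<forall>j<D. lincomb (I - {k}) c (\<lambda>i. tailv 2 (w i)) j = 0"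
        define d where "d = c(k := 0)"
        have "\<forall>i\<in>I. d i \<in> K" using c(1) is_subfieldD(1)[OF K] by (simp add: d_def)
        moreover have "lincomb I d (\<lambda>i. tailv 2 (w i)) = lincomb (I - {k}) c (\<lambda>i. tailv 2 (w i))"
          unfolding lincomb_def using w(1) k
          by (auto simp: fun_eq_iff d_def sum.remove[of I k] intro!: sum.cong)
        ultimately have "\<forall>i\<in>I. d i = 0" using True c(2) unfolding indep_def by metis
        then show "\<forall>i\<in>I - {k}. c i = 0" by (auto simp: d_def split: if_splits)
      qed
      then show ?thesis using that k by blast
    next
      case False
      then obtain c k where c: "\<forall>i\<in>I. c i \<in> K" "\<forall>j<D. lincomb I c (\<lambda>i. tailv 2 (w i)) j = 0"
        and k: "k \<in> I" "c k \<noteq> 0"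
        unfolding indep_def by blast
      have a0: "lincomb I c w 0 \<noteq> 0"
        using z0[OF c(1) _ w1] c(2) k by (auto simp: tailv_lincomb)
      have "indep K (I - {k}) D (\<lambda>i. tailv 2 (w i))"
        unfolding indep_def
      proof (intro allI impI)
        fix d assume d: "\<forall>i\<in>I - {k}. d i \<in> K" "\<forall>j<D. lincomb (I - {k}) d (\<lambda>i. tailv 2 (w i)) j = 0"
        define d' where "d' = d(k := 0)"
        have d'K: "\<forall>i\<in>I. d' i \<in> K" using d(1) is_subfieldD(1)[OF K] by (simp add: d'_def)
        have d'e: "lincomb I d' (\<lambda>i. tailv 2 (w i)) = lincomb (I - {k}) d (\<lambda>i. tailv 2 (w i))"
          unfolding lincomb_def using w(1) k
          by (auto simp: fun_eq_iff d'_def sum.remove[of I k] intro!: sum.cong)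
        \<comment> \<open>The combination of the two relations in which coordinate 0 cancels, hence
          trivial by \<open>z0\<close>. At \<open>k\<close>, where \<open>d'\<close> is 0 and
          \<open>c\<close> is not, this shows that the coordinate 0 belonging to \<open>d'\<close>
          vanishes.\<close>
        define e where "e i = lincomb I c w 0 * d' i - lincomb I d' w 0 * c i" for i
        have le: "lincomb I e x j = lincomb I c w 0 * lincomb I d' x j - lincomb I d' w 0 * lincomb I c x j" for x j
          by (simp add: e_def lincomb_def[of I _ x] left_diff_distrib sum_subtractf sum_distrib_left mult.assoc)
        have "ovec K (2 + D) (lincomb I c w)" "ovec K (2 + D) (lincomb I d' w)"
          using w(3) c(1) d'K by (auto intro!: ovec_lincomb[OF K])
        then have "\<forall>i\<in>I. e i \<in> K"
          using c(1) d'K by (auto simp: e_def ovec_def intro!: is_subfieldD[OF K])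
        moreover have "lincomb I e w 0 = 0" by (simp add: le)
        moreover have "\<forall>j<D. tailv 2 (lincomb I e w) j = 0"
          using c(2) d(2) by (simp add: tailv_lincomb le d'e)
        ultimately have e0: "\<forall>i\<in>I. e i = 0" using z0 w1 by blast
        then have "lincomb I d' w 0 * c k = 0" using k by (force simp: e_def d'_def)
        then have "lincomb I d' w 0 = 0" using k by simp
        then have "\<forall>i\<in>I. d' i = 0" using e0 a0 by (simp add: e_def)
        then show "\<forall>i\<in>I - {k}. d i = 0" by (auto simp: d'_def split: if_splits)
      qed
      then show ?thesis using that k(1) by blast
    qed
    show ?thesis
    proof (rule metabI[OF _ _ _ ind])
      show "D = 2 * card (I - {k})" using w(1,2) k by simp
      show "qd D g (lincomb (I - {k}) c (\<lambda>i. tailv 2 (w i))) = 0"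
        if "\<And>i. i \<in> I - {k} \<Longrightarrow> c i \<in> K" for c
      proof -
        define d where "d = c(k := 0)"
        have "\<forall>i\<in>I. d i \<in> K" using that is_subfieldD(1)[OF K] by (simp add: d_def)
        moreover have "lincomb I d (\<lambda>i. tailv 2 (w i)) = lincomb (I - {k}) c (\<lambda>i. tailv 2 (w i))"
          unfolding lincomb_def using w(1) k
          by (auto simp: fun_eq_iff d_def sum.remove[of I k] intro!: sum.cong)
        ultimately show ?thesis using q1 by metis
      qed
    qed (use w(1) tl in auto)
  qed
qed

lemma metab_isotropic:
  assumes "is_subfield K" "metab K D g" "D > 0"
  shows "\<exists>x. ovec K D x \<and> (\<exists>i<D. x i \<noteq> 0) \<and> qd D g x = 0"
proof -
  obtain I w where w: "finite (I::nat set)" "D = 2 * card I" "\<forall>i\<in>I. ovec K D (w i)"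
     "indep K I D w" "\<forall>c. (\<forall>i\<in>I. c i \<in> K) \<longrightarrow> qd D g (lincomb I c w) = 0"
    using assms(2) unfolding metab_def by blast
  obtain k where k: "k \<in> I" using w(2) assms(3) by fastforce
  have "lincomb I (\<lambda>i. if i = k then 1 else 0) w = w k"
    using w(1) k(1) by (simp add: fun_eq_iff lincomb_def if_distrib[of "\<lambda>x. x * _"] cong: if_cong)
  moreover have "\<forall>i\<in>I. (if i = k then 1 else 0) \<in> K" using is_subfieldD(1,2)[OF assms(1)] by simp
  ultimately have "qd D g (w k) = 0"
    using w(5)[rule_format, of "\<lambda>i. if i = k then 1 else 0"] by simp
  moreover have "\<exists>i<D. w k i \<noteq> 0"
    by (rule metab_vectors_nonzero[OF assms(1) w(4) w(1) k])
  ultimately show ?thesis using w(3) k by (intro exI[of _ "w k"]) simp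
qed

text \<open>Witt cancellation of a hyperbolic summand: as long as \<open>h\<close> is not
  zero-dimensional it has an isotropic vector, and the plane split off by it is cancelled both in
  \<open>h\<close> and in the sum.\<close>

lemma metab_cancel:
  assumes K: "is_subfield K"
  shows "ogram K m h \<Longrightarrow> nonsing K m h \<Longrightarrow> metab K m h \<Longrightarrow> metab K (m + n) (gsum m h g) \<Longrightarrow>
    metab K n g"
proof (induction m arbitrary: h rule: less_induct)
  case (less m)
  show ?case
  proof (cases "m = 0")
    case True
    then show ?thesis using less.prems by simp
  next
    case False
    then obtain x where x: "ovec K m x" "\<exists>i<m. x i \<noteq> 0" "qd m h x = 0"
      using metab_isotropic[OF K less.prems(3)] by blast
    obtain m' h' where h': "m = 2 + m'" "ogram K m' h'" "nonsing K m' h'"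
      "isom K m (gsum 2 hyp_gram h') h"
      using split_hyperbolic_plane[OF K less.prems(1,2) x] by blast
    have "metab K m' h'"
      using metab_cancel_hyp[OF K] isom_metab[OF isom_sym[OF h'(4)] less.prems(3)] h'(1) by simp
    moreover have "metab K (2 + (m' + n)) (gsum 2 hyp_gram (gsum m' h' g))"
      using isom_metab[OF isom_gsum[OF K isom_sym[OF h'(4)] isom_of_qd_eq[of n g g]] less.prems(4)]
      by (simp add: gsum_assoc h'(1) add.assoc)
    then have "metab K (m' + n) (gsum m' h' g)" by (rule metab_cancel_hyp[OF K])
    ultimately show ?thesis using less.IH[of m' h'] h' by simp
  qed
qed

fun hyp_sum :: "nat \<Rightarrow> nat \<Rightarrow> nat \<Rightarrow> 'b::zero_neq_one" where
  "hyp_sum 0 = (\<lambda>_ _. 0)"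
| "hyp_sum (Suc k) = gsum 2 hyp_gram (hyp_sum k)"

text \<open>Peels off one plane at a time, as in \<open>metab_cancel\<close>. This links
  \<open>metab\<close> to the explicit hyperbolic forms, which look the same over every
  field.\<close>

lemma metab_isom_hyp_sum:
  assumes K: "is_subfield K"
  shows "ogram K m h \<Longrightarrow> nonsing K m h \<Longrightarrow> metab K m h \<Longrightarrow> \<exists>k. m = 2 * k \<and> isom K m (hyp_sum k) h"
proof (induction m arbitrary: h rule: less_induct)
  case (less m)
  show ?case
  proof (cases "m = 0")
    case True
    then show ?thesis by (intro exI[of _ 0]) (auto simp: qd_def bil_def intro!: isom_of_qd_eq)
  next
    case False
    then obtain x where x: "ovec K m x" "\<exists>i<m. x i \<noteq> 0" "qd m h x = 0"
      using metab_isotropic[OF K less.prems(3)] by blast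
    obtain m' h' where h': "m = 2 + m'" "ogram K m' h'" "nonsing K m' h'"
      "isom K m (gsum 2 hyp_gram h') h"
      using split_hyperbolic_plane[OF K less.prems(1,2) x] by blast
    have "metab K m' h'"
      using metab_cancel_hyp[OF K] isom_metab[OF isom_sym[OF h'(4)] less.prems(3)] h'(1) by simp
    then obtain k where k: "m' = 2 * k" "isom K m' (hyp_sum k) h'"
      using less.IH[of m' h'] h' by auto
    have "isom K (2 + m') (gsum 2 hyp_gram (hyp_sum k)) (gsum 2 hyp_gram h')"
      by (rule isom_gsum[OF K isom_of_qd_eq k(2)]) simp
    then show ?thesis using isom_trans h'(1,4) k(1)
      by (intro exI[of _ "Suc k"]) auto
  qed
qed

section \<open>Polynomials over a subfield and the Cassels-Pfister theorem\<close>

definition polys :: "'b::field set \<Rightarrow> 'b poly set" where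
  "polys K = {p. \<forall>i. coeff p i \<in> K}"

lemma polys_closed:
  assumes K: "is_subfield K"
  shows "0 \<in> polys K" "1 \<in> polys K" "p \<in> polys K \<Longrightarrow> q \<in> polys K \<Longrightarrow> p + q \<in> polys K"
    "p \<in> polys K \<Longrightarrow> q \<in> polys K \<Longrightarrow> p - q \<in> polys K"
    "p \<in> polys K \<Longrightarrow> - p \<in> polys K"
    "p \<in> polys K \<Longrightarrow> q \<in> polys K \<Longrightarrow> p * q \<in> polys K"
    "c \<in> K \<Longrightarrow> monom c n \<in> polys K" "c \<in> K \<Longrightarrow> p \<in> polys K \<Longrightarrow> pCons c p \<in> polys K"
    "c \<in> K \<Longrightarrow> p \<in> polys K \<Longrightarrow> smult c p \<in> polys K"
  by (auto simp: polys_def is_subfieldD[OF K] coeff_mult coeff_pCons one_pCons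
      intro!: subfield_sum[OF K] split: nat.splits)

lemma polys_sum:
  "is_subfield K \<Longrightarrow> (\<And>i. i \<in> I \<Longrightarrow> f i \<in> polys K) \<Longrightarrow> sum f I \<in> polys K"
  by (induction I rule: infinite_finite_induct) (auto simp: polys_closed)

text \<open>Every leading term removed is a monomial whose coefficient is a quotient of elements of
  \<open>K\<close>, so the usual division never leaves \<open>K\<close>.\<close>

lemma polys_div_mod:
  assumes K: "is_subfield K" and h: "h \<in> polys K" "h \<noteq> 0"
  shows "p \<in> polys K \<Longrightarrow> \<exists>a. a \<in> polys K \<and> p - h * a \<in> polys K \<and>
    (p - h * a = 0 \<or> degree (p - h * a) < degree h)"
proof (induction "degree p" arbitrary: p rule: less_induct)
  case less
  show ?case
  proof (cases "p = 0 \<or> degree p < degree h")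
    case True
    then show ?thesis using less.prems polys_closed(1)[OF K] by (intro exI[of _ 0]) auto
  next
    case False
    define m where "m = monom (lead_coeff p / lead_coeff h) (degree p - degree h)"
    have hm: "lead_coeff h \<noteq> 0" "lead_coeff h \<in> K" "lead_coeff p \<in> K" "lead_coeff p \<noteq> 0"
      using h less.prems False by (auto simp: polys_def)
    then have m: "m \<in> polys K" unfolding m_def by (intro polys_closed[OF K] is_subfieldD[OF K])
    then have p': "p - h * m \<in> polys K" using h less.prems by (intro polys_closed[OF K])
    have m0: "m \<noteq> 0" "degree m = degree p - degree h"
      using hm by (auto simp: m_def monom_eq_0_iff degree_monom_eq)
    have dm: "degree (h * m) = degree p" using m0 h False by (simp add: degree_mult_eq)
    have "coeff (h * m) (degree p) = lead_coeff p"
      using coeff_mult_degree_sum[of h m] m0 False hm by (simp add: m_def)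
    then have c: "p - h * m = 0 \<or> degree (p - h * m) < degree p"
      using eq_zero_or_degree_less[of "p - h * m" "degree p"] dm degree_diff_le[of p "degree p" "h * m"]
      by simp
    obtain a where a: "a \<in> polys K" "p - h * m - h * a \<in> polys K"
      "p - h * m - h * a = 0 \<or> degree (p - h * m - h * a) < degree h"
    proof (cases "p - h * m = 0")
      case True
      then show ?thesis using that[of 0] polys_closed(1)[OF K] by simp
    next
      case False
      then show ?thesis using less.hyps[OF _ p'] c that by blast
    qed
    have eq: "p - h * m - h * a = p - h * (m + a)" by (simp add: algebra_simps)
    show ?thesis using a(2,3) polys_closed(3)[OF K m a(1)] unfolding eq by blast
  qed
qed

definition pgram :: "(nat \<Rightarrow> nat \<Rightarrow> 'b::comm_ring_1) \<Rightarrow> nat \<Rightarrow> nat \<Rightarrow> 'b poly" where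
  "pgram g = (\<lambda>i j. [:g i j:])"

definition pvec :: "(nat \<Rightarrow> 'b::comm_ring_1) \<Rightarrow> nat \<Rightarrow> 'b poly" where
  "pvec u = (\<lambda>i. [:u i:])"

lemma poly_bil: "poly (bil D (pgram g) u v) x = bil D g (\<lambda>i. poly (u i) x) (\<lambda>i. poly (v i) x)"
  by (simp add: bil_def pgram_def poly_sum mult.assoc)

lemma poly_qd: "poly (qd D (pgram g) v) x = qd D g (\<lambda>i. poly (v i) x)"
  by (simp add: qd_def poly_bil)

lemma poly_pol: "poly (pol D (pgram g) (pvec u) v) x = pol D g u (\<lambda>i. poly (v i) x)"
  by (simp add: pol_def poly_bil pvec_def)

lemma bil_polys:
  "is_subfield K \<Longrightarrow> ogram K D g \<Longrightarrow> ovec (polys K) D u \<Longrightarrow> ovec (polys K) D v \<Longrightarrow>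
    bil D (pgram g) u v \<in> polys K"
  unfolding bil_def pgram_def
  by (auto simp: ogram_def ovec_def intro!: polys_sum polys_closed)

lemma ovec_pvec: "is_subfield K \<Longrightarrow> ovec K D u \<Longrightarrow> ovec (polys K) D (pvec u)"
  by (auto simp: ovec_def pvec_def intro!: polys_closed)

lemma qd_polys:
  "is_subfield K \<Longrightarrow> ogram K D g \<Longrightarrow> ovec (polys K) D u \<Longrightarrow> qd D (pgram g) u \<in> polys K"
  by (simp add: qd_def bil_polys)

lemma pol_polys:
  "is_subfield K \<Longrightarrow> ogram K D g \<Longrightarrow> ovec (polys K) D u \<Longrightarrow> ovec (polys K) D v \<Longrightarrow>
    pol D (pgram g) u v \<in> polys K"
  by (simp add: pol_def bil_polys polys_closed)

lemma coeff_mult_bounds: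
  fixes p q :: "'b::idom poly"
  assumes "degree p \<le> m" "degree q \<le> n"
  shows "coeff (p * q) (m + n) = coeff p m * coeff q n"
proof (cases "degree p = m \<and> degree q = n")
  case True
  then show ?thesis using coeff_mult_degree_sum[of p q] by auto
next
  case False
  then have "degree p < m \<or> degree q < n" using assms by auto
  then have "coeff p m * coeff q n = 0" by (auto simp: coeff_eq_0)
  moreover have "degree (p * q) < m + n"
    using False assms degree_mult_le[of p q] by linarith
  ultimately show ?thesis by (simp add: coeff_eq_0)
qed

lemma bil_degree:
  fixes g :: "nat \<Rightarrow> nat \<Rightarrow> 'b::idom"
  assumes "\<And>i. i < D \<Longrightarrow> degree (u i) \<le> m" "\<And>i. i < D \<Longrightarrow> degree (v i) \<le> n"
  shows "degree (bil D (pgram g) u v) \<le> m + n"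
    "coeff (bil D (pgram g) u v) (m + n) = bil D g (\<lambda>i. coeff (u i) m) (\<lambda>i. coeff (v i) n)"
proof -
  have "degree ([:c:] * u i * v j) \<le> m + n" if "i < D" "j < D" for i j c
    using degree_mult_le[of "smult c (u i)" "v j"] degree_smult_le[of c "u i"] assms(1)[OF that(1)] assms(2)[OF that(2)]
    by simp
  then show "degree (bil D (pgram g) u v) \<le> m + n"
    unfolding bil_def pgram_def by (intro degree_sum_le) auto
  show "coeff (bil D (pgram g) u v) (m + n) = bil D g (\<lambda>i. coeff (u i) m) (\<lambda>i. coeff (v i) n)"
    unfolding bil_def pgram_def using assms
    by (simp add: coeff_sum coeff_mult_bounds mult.assoc)
qed

lemma pol_degree:
  fixes g :: "nat \<Rightarrow> nat \<Rightarrow> 'b::idom"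
  assumes "\<And>i. i < D \<Longrightarrow> degree (v i) \<le> n"
  shows "degree (pol D (pgram g) (pvec u) v) \<le> n"
  using bil_degree(1)[of D "pvec u" 0 v n g] bil_degree(1)[of D v n "pvec u" 0 g] assms
  unfolding pol_def by (intro degree_add_le) (auto simp: pvec_def)

text \<open>This coefficient is the value of \<open>g\<close> at the vector of top coefficients.
  Anisotropy thus forbids cancellation of leading terms, and the value of a polynomial vector has
  exactly twice its degree.\<close>

lemma aniso_coeff:
  assumes "aniso K D g" and v: "ovec (polys K) D v" "\<And>i. i < D \<Longrightarrow> degree (v i) \<le> e"
    and nz: "\<exists>i<D. coeff (v i) e \<noteq> 0"
  shows "coeff (qd D (pgram g) v) (2 * e) \<noteq> 0"
proof
  assume "coeff (qd D (pgram g) v) (2 * e) = 0"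
  then have "qd D g (\<lambda>i. coeff (v i) e) = 0"
    using bil_degree(2)[of D v e v e g] v(2) by (simp add: qd_def mult_2)
  moreover have "ovec K D (\<lambda>i. coeff (v i) e)" using v(1) by (auto simp: ovec_def polys_def)
  ultimately show False using assms(1) nz unfolding aniso_def by blast
qed

lemma exists_max_degree:
  fixes v :: "nat \<Rightarrow> 'b::zero poly"
  assumes "\<exists>i<D. v i \<noteq> 0"
  obtains k where "k < D" "v k \<noteq> 0" "\<And>i. i < D \<Longrightarrow> degree (v i) \<le> degree (v k)"
proof -
  let ?S = "(\<lambda>i. degree (v i)) ` {i. i < D \<and> v i \<noteq> 0}"
  have S: "finite ?S" "?S \<noteq> {}" using assms by auto
  then have "Max ?S \<in> ?S" by (rule Max_in)
  then obtain k where k: "k < D" "v k \<noteq> 0" "degree (v k) = Max ?S" by auto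
  have "degree (v i) \<le> degree (v k)" if "i < D" for i
  proof (cases "v i = 0")
    case False
    then show ?thesis unfolding k(3) using that S(1) by (intro Max_ge) auto
  qed simp
  then show ?thesis using that[OF k(1,2)] by blast
qed

lemma aniso_poly_nonzero:
  assumes "aniso K D g" "ovec (polys K) D v" "\<exists>i<D. v i \<noteq> 0"
  shows "qd D (pgram g) v \<noteq> 0"
proof -
  obtain k where k: "k < D" "v k \<noteq> 0" "\<And>i. i < D \<Longrightarrow> degree (v i) \<le> degree (v k)"
    using exists_max_degree[OF assms(3)] by blast
  have "coeff (qd D (pgram g) v) (2 * degree (v k)) \<noteq> 0"
    using k by (intro aniso_coeff[OF assms(1,2)]) (auto intro!: exI[of _ k])
  then show ?thesis by auto
qed

lemma aniso_degree_le:
  assumes "aniso K D g" "ovec (polys K) D v" "degree (qd D (pgram g) v) \<le> 2 * d" "i < D"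
  shows "degree (v i) \<le> d"
proof (cases "v i = 0")
  case False
  then obtain k where k: "k < D" "v k \<noteq> 0" "\<And>i. i < D \<Longrightarrow> degree (v i) \<le> degree (v k)"
    using exists_max_degree[of D v] assms(4) by blast
  have "coeff (qd D (pgram g) v) (2 * degree (v k)) \<noteq> 0"
    using k by (intro aniso_coeff[OF assms(1,2)]) (auto intro!: exI[of _ k])
  then have "2 * degree (v k) \<le> 2 * d" using le_degree assms(3) le_trans by blast
  then show ?thesis using k(3)[OF assms(4)] by simp
qed simp

text \<open>The Cassels-Pfister theorem with additional linear constraints.  With \<open>v = h a + r\<close>, the
  reflection along the remainder \<open>r\<close> takes \<open>v / h\<close> to a vector of smaller denominator \<open>h'\<close>;
  the constraints survive since \<open>r\<close> is orthogonal to all \<open>u i\<close>.\<close>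

lemma cassels_pfister_poly:
  assumes K: "is_subfield K" and g: "ogram K D g" and an: "aniso K D g"
    and u: "\<And>i. i \<in> I \<Longrightarrow> ovec K D (u i)" and f: "f \<in> polys K"
  shows "h \<in> polys K \<Longrightarrow> h \<noteq> 0 \<Longrightarrow> ovec (polys K) D v \<Longrightarrow> qd D (pgram g) v = h * h * f \<Longrightarrow>
    (\<And>i. i \<in> I \<Longrightarrow> pol D (pgram g) (pvec (u i)) v = h * l i) \<Longrightarrow>
    \<exists>p. ovec (polys K) D p \<and> qd D (pgram g) p = f \<and> (\<forall>i\<in>I. pol D (pgram g) (pvec (u i)) p = l i)"
proof (induction "degree h" arbitrary: h v rule: less_induct)
  case less
  note h = less.prems(1,2) and v = less.prems(3-5)
  let ?q = "qd D (pgram g)" and ?b = "pol D (pgram g)"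
  have "\<forall>i. \<exists>a. i < D \<longrightarrow> a \<in> polys K \<and> v i - h * a \<in> polys K \<and>
      (v i - h * a = 0 \<or> degree (v i - h * a) < degree h)"
    using polys_div_mod[OF K h] v(1) unfolding ovec_def by blast
  then obtain a where a: "\<And>i. i < D \<Longrightarrow> a i \<in> polys K \<and> v i - h * a i \<in> polys K \<and>
      (v i - h * a i = 0 \<or> degree (v i - h * a i) < degree h)" by metis
  define r where "r = v - h \<star> a"
  have r: "ovec (polys K) D r" and aK: "ovec (polys K) D a"
    using a by (auto simp: ovec_def r_def)
  show ?case
  proof (cases "\<exists>i<D. r i \<noteq> 0")
    case False
    have "?q v = ?q (h \<star> a)" "\<And>w. ?b w v = ?b w (h \<star> a)"
      using False by (intro qd_cong pol_cong; simp add: r_def)+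
    then have "h * h * f = h * h * ?q a" "\<And>w. ?b w v = h * ?b w a"
      using v(2) by (simp_all add: qd_smul)
    then have "?q a = f" "\<forall>i\<in>I. ?b (pvec (u i)) a = l i"
      using h(2) v(3) by auto
    then show ?thesis using aK by blast
  next
    case True
    have rd: "degree (r i) \<le> degree h - 1" if "i < D" for i
      using a[OF that] by (auto simp: r_def)
    have "degree h > 0"
    proof -
      obtain i where "i < D" "r i \<noteq> 0" using True by blast
      then show ?thesis using a[of i] by (auto simp: r_def)
    qed
    define A \<beta> where "A = ?q a" and "\<beta> = ?b v a"
    \<comment> \<open>The cofactor in \<open>qd r = h h'\<close>. Reflecting \<open>v / h\<close>
      along \<open>r\<close> gives a vector with denominator \<open>h h'\<close>; there a factor
      \<open>h\<close> cancels, which leaves \<open>v' / h'\<close>.\<close>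
    define h' where "h' = h * f - \<beta> + h * A"
    define v' where "v' = (A - f) \<star> v + (h * f + h * f - \<beta>) \<star> a"
    have AK: "A \<in> polys K" "\<beta> \<in> polys K"
      unfolding A_def \<beta>_def using K g aK v(1) by (auto intro!: qd_polys pol_polys)
    have qr: "?q r = h * h'"
      unfolding r_def qd_diff using v(2)
      by (simp add: qd_smul h'_def A_def \<beta>_def algebra_simps)
    have "h * h' \<noteq> 0" using aniso_poly_nonzero[OF an r True] qr by simp
    then have h'0: "h' \<noteq> 0" by auto
    have "degree (h * h') \<le> (degree h - 1) + (degree h - 1)"
      unfolding qr[symmetric] qd_def by (intro bil_degree(1) rd)
    then have dh': "degree h' < degree h"
      using h h'0 \<open>degree h > 0\<close> by (simp add: degree_mult_eq)
    have h'K: "h' \<in> polys K" unfolding h'_def by (intro polys_closed[OF K] h f AK)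
    have "v' i \<in> polys K" if "i < D" for i
    proof -
      have va: "v i \<in> polys K" "a i \<in> polys K" using v(1) aK that by (auto simp: ovec_def)
      show ?thesis
        unfolding v'_def plus_fun_apply smul_apply
        by (intro polys_closed(3,4,6)[OF K] va AK f h(1))
    qed
    then have v'K: "ovec (polys K) D v'" by (simp add: ovec_def)
    have "?q v' = (A - f) * (A - f) * (h * h * f) + (h * f + h * f - \<beta>) * (h * f + h * f - \<beta>) * A +
        (A - f) * (h * f + h * f - \<beta>) * \<beta>"
      unfolding v'_def qd_add qd_smul v(2) A_def[symmetric] by (simp add: \<beta>_def mult.assoc)
    also have "\<dots> = h' * h' * f" by (simp add: h'_def algebra_simps)
    finally have qv': "?q v' = h' * h' * f" .
    have bv': "?b (pvec (u i)) v' = h' * l i" if i: "i \<in> I" for i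
    proof -
      let ?ba = "?b (pvec (u i)) a"
      have "h * (l i - ?ba) = ?b (pvec (u i)) r"
        using v(3)[OF i] by (simp add: r_def algebra_simps)
      then have "degree (h * (l i - ?ba)) \<le> degree h - 1"
        using pol_degree[of D r "degree h - 1" g "u i"] rd by simp
      \<comment> \<open>A multiple of \<open>h\<close> of smaller degree than \<open>h\<close> is
        zero; so \<open>r\<close> is orthogonal to \<open>u i\<close>, and the reflection respects
        the constraint.\<close>
      then have "l i - ?ba = 0"
        using h \<open>degree h > 0\<close> by (cases "l i - ?ba = 0") (auto simp: degree_mult_eq)
      then have "?ba = l i" by simp
      then show ?thesis using v(3)[OF i] by (simp add: v'_def h'_def algebra_simps)
    qed
    show ?thesis by (rule less.hyps[OF dh' h'K h'0 v'K qv' bv'])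
  qed
qed

section \<open>Transcendental extensions\<close>

definition transc :: "'b::field set \<Rightarrow> 'b \<Rightarrow> bool" where
  "transc K x \<longleftrightarrow> (\<forall>p\<in>polys K. poly p x = 0 \<longrightarrow> p = 0)"

definition adjoin :: "'b::field set \<Rightarrow> 'b \<Rightarrow> 'b set" where
  "adjoin K x = {poly p x / poly q x |p q. p \<in> polys K \<and> q \<in> polys K \<and> poly q x \<noteq> 0}"

lemma adjoinI:
  "p \<in> polys K \<Longrightarrow> q \<in> polys K \<Longrightarrow> poly q x \<noteq> 0 \<Longrightarrow> y = poly p x / poly q x \<Longrightarrow> y \<in> adjoin K x"
  unfolding adjoin_def by blast

lemma adjoin_subset: assumes "is_subfield K" shows "K \<subseteq> adjoin K x"
proof
  fix y assume "y \<in> K"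
  then show "y \<in> adjoin K x"
    by (intro adjoinI[of "[:y:]" K 1]) (auto intro!: polys_closed[OF assms])
qed

lemma mem_adjoin: assumes "is_subfield K" shows "x \<in> adjoin K x"
  by (rule adjoinI[of "[:0, 1:]" K 1])
    (auto intro!: polys_closed[OF assms] is_subfieldD[OF assms])

lemma is_subfield_adjoin: assumes K: "is_subfield K" shows "is_subfield (adjoin K x)"
  unfolding is_subfield_def
proof (intro conjI ballI)
  show "0 \<in> adjoin K x" "1 \<in> adjoin K x"
    using adjoin_subset[OF K] is_subfieldD(1,2)[OF K] by auto
  fix y assume "y \<in> adjoin K x"
  then obtain p q where y: "p \<in> polys K" "q \<in> polys K" "poly q x \<noteq> 0" "y = poly p x / poly q x"
    unfolding adjoin_def by blast
  show "- y \<in> adjoin K x"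
    using y by (intro adjoinI[of "- p" K q]) (auto intro: polys_closed[OF K])
  show "inverse y \<in> adjoin K x"
  proof (cases "poly p x = 0")
    case True
    then show ?thesis using y \<open>0 \<in> adjoin K x\<close> by simp
  next
    case False
    then show ?thesis using y by (intro adjoinI[of q K p]) auto
  qed
  fix z assume "z \<in> adjoin K x"
  then obtain p' q' where z: "p' \<in> polys K" "q' \<in> polys K" "poly q' x \<noteq> 0" "z = poly p' x / poly q' x"
    unfolding adjoin_def by blast
  show "y + z \<in> adjoin K x"
    using y z by (intro adjoinI[of "p * q' + p' * q" K "q * q'"])
      (auto intro!: polys_closed[OF K] simp: add_frac_eq)
  show "y * z \<in> adjoin K x"
    using y z by (intro adjoinI[of "p * p'" K "q * q'"]) (auto intro!: polys_closed[OF K])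
qed

lemma countable_polys: assumes "countable K" shows "countable (polys K)"
proof -
  have "coeffs ` polys K \<subseteq> lists K"
    by (auto simp: polys_def coeffs_def)
  then have "countable (coeffs ` polys K)"
    using countable_lists[OF assms] countable_subset by blast
  moreover have "inj_on coeffs (polys K)" by (auto simp: inj_on_def coeffs_eq_iff)
  ultimately show ?thesis by (rule countable_image_inj_on)
qed

lemma countable_adjoin: assumes "countable K" shows "countable (adjoin K x)"
proof -
  have "adjoin K x \<subseteq> (\<lambda>(p, q). poly p x / poly q x) ` (polys K \<times> polys K)"
    by (auto simp: adjoin_def)
  moreover have "countable ((\<lambda>(p, q). poly p x / poly q x) ` (polys K \<times> polys K))"
    using countable_polys[OF assms] by (intro countable_image countable_SIGMA)
  ultimately show ?thesis by (rule countable_subset)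
qed

text \<open>A countable \<open>K\<close> has countably many polynomials, and each nonzero one has
  finitely many roots. This is what uncountability of the ambient field is for.\<close>

lemma exists_transc:
  assumes "countable (K :: 'b::field set)" and "uncountable (UNIV :: 'b set)"
  shows "\<exists>x. transc K x"
proof (rule ccontr)
  assume "\<not> (\<exists>x. transc K x)"
  then have "UNIV = (\<Union>p\<in>polys K - {0}. {x. poly p x = 0})" by (auto simp: transc_def)
  moreover have "countable (\<Union>p\<in>polys K - {0}. {x. poly p x = 0})"
  proof (rule countable_UN)
    show "countable (polys K - {0})" using countable_polys[OF assms(1)] by simp
    show "countable {x. poly p x = 0}" if "p \<in> polys K - {0}" for p
      using that poly_roots_finite[of p] by (intro countable_finite) simp
  qed
  ultimately show False using assms(2) by simp
qed

lemma common_denominator: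
  assumes K: "is_subfield K"
  shows "ovec (adjoin K x) D w \<Longrightarrow>
    \<exists>h v. h \<in> polys K \<and> poly h x \<noteq> 0 \<and> ovec (polys K) D v \<and> (\<forall>i<D. poly (v i) x = poly h x * w i)"
proof (induction D)
  case 0
  then show ?case using polys_closed[OF K] by (intro exI[of _ 1]) (auto simp: ovec_def)
next
  case (Suc D)
  obtain h v where h: "h \<in> polys K" "poly h x \<noteq> 0" "ovec (polys K) D v"
    "\<forall>i<D. poly (v i) x = poly h x * w i"
    using Suc by (auto simp: ovec_def)
  obtain p q where y: "p \<in> polys K" "q \<in> polys K" "poly q x \<noteq> 0" "w D = poly p x / poly q x"
    using Suc.prems unfolding adjoin_def ovec_def by blast
  have "ovec (polys K) (Suc D) ((q \<star> v)(D := h * p))"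
    using h y by (auto simp: ovec_def less_Suc_eq intro!: polys_closed[OF K])
  moreover have "\<forall>i<Suc D. poly (((q \<star> v)(D := h * p)) i) x = poly (h * q) x * w i"
    using h y by (auto simp: less_Suc_eq)
  moreover have "h * q \<in> polys K" "poly (h * q) x \<noteq> 0" using h y polys_closed[OF K] by auto
  ultimately show ?case by blast
qed

lemma aniso_adjoin:
  assumes K: "is_subfield K" and g: "ogram K D g" and an: "aniso K D g" and x: "transc K x"
  shows "aniso (adjoin K x) D g"
  unfolding aniso_def
proof (rule allI, rule impI, rule impI)
  fix w assume w: "ovec (adjoin K x) D w" "qd D g w = 0"
  obtain h v where h: "h \<in> polys K" "poly h x \<noteq> 0" "ovec (polys K) D v"
    "\<forall>i<D. poly (v i) x = poly h x * w i"
    using common_denominator[OF K w(1)] by blast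
  have "poly (qd D (pgram g) v) x = qd D g (poly h x \<star> w)"
    unfolding poly_qd using h(4) by (intro qd_cong) simp
  then have "poly (qd D (pgram g) v) x = 0" using w(2) by (simp add: qd_smul)
  then have "qd D (pgram g) v = 0" using x qd_polys[OF K g h(3)] unfolding transc_def by blast
  then have "\<forall>i<D. v i = 0" using aniso_poly_nonzero[OF an h(3)] by blast
  then show "\<forall>i<D. w i = 0" using h(2,4) by auto
qed

text \<open>Evaluation at a transcendental is injective on polynomials over \<open>K\<close>. Once
  denominators are cleared, equations between values at \<open>x\<close> are therefore polynomial
  identities.\<close>

lemma cassels_pfister:
  assumes K: "is_subfield K" and g: "ogram K D g" and an: "aniso K D g" and x: "transc K x"
    and u: "\<And>i. i \<in> I \<Longrightarrow> ovec K D (u i)" and f: "f \<in> polys K" and l: "\<And>i. i \<in> I \<Longrightarrow> l i \<in> polys K"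
    and w: "ovec (adjoin K x) D w" "qd D g w = poly f x"
      "\<And>i. i \<in> I \<Longrightarrow> pol D g (u i) w = poly (l i) x"
  shows "\<exists>p. ovec (polys K) D p \<and> qd D (pgram g) p = f \<and> (\<forall>i\<in>I. pol D (pgram g) (pvec (u i)) p = l i)"
proof -
  obtain h v where h: "h \<in> polys K" "poly h x \<noteq> 0" "ovec (polys K) D v"
    "\<forall>i<D. poly (v i) x = poly h x * w i"
    using common_denominator[OF K w(1)] by blast
  have eq: "p = q" if "p \<in> polys K" "q \<in> polys K" "poly p x = poly q x" for p q
    using x polys_closed(4)[OF K that(1,2)] that(3) unfolding transc_def by fastforce
  have "poly (qd D (pgram g) v) x = qd D g (poly h x \<star> w)"
    unfolding poly_qd using h(4) by (intro qd_cong) simp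
  also have "\<dots> = poly (h * h * f) x" using w(2) by (simp add: qd_smul)
  finally have "qd D (pgram g) v = h * h * f"
    using h f by (intro eq qd_polys[OF K g] polys_closed[OF K])
  moreover have "pol D (pgram g) (pvec (u i)) v = h * l i" if "i \<in> I" for i
  proof -
    have "poly (pol D (pgram g) (pvec (u i)) v) x = pol D g (u i) (poly h x \<star> w)"
      unfolding poly_pol using h(4) by (intro pol_cong) simp_all
    also have "\<dots> = poly (h * l i) x" using w(3)[OF that] by simp
    finally show ?thesis
      using h l that u by (intro eq pol_polys[OF K g] polys_closed[OF K] ovec_pvec[OF K]) auto
  qed
  moreover have "h \<noteq> 0" using h(2) by auto
  ultimately show ?thesis
    using u by (intro cassels_pfister_poly[OF K g an _ f h(1) _ h(3)]) auto
qed

section \<open>Splitting by a generic zero of a form\<close>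

text \<open>For constant data the Cassels-Pfister theorem replaces a rational solution by a
  polynomial one. This has no poles, so it may be evaluated at 0.\<close>

lemma specialize_step:
  assumes K: "is_subfield K" and g: "ogram K D g" and an: "aniso K D g" and x: "transc K x"
    and u: "\<And>i. i \<in> I \<Longrightarrow> ovec K D (u i)" and c: "c \<in> K" and l: "\<And>i. i \<in> I \<Longrightarrow> l i \<in> K"
    and w: "ovec (adjoin K x) D w" "qd D g w = c" "\<And>i. i \<in> I \<Longrightarrow> pol D g (u i) w = l i"
  shows "\<exists>w'. ovec K D w' \<and> qd D g w' = c \<and> (\<forall>i\<in>I. pol D g (u i) w' = l i)"
proof -
  have "\<exists>p. ovec (polys K) D p \<and> qd D (pgram g) p = [:c:] \<and>
      (\<forall>i\<in>I. pol D (pgram g) (pvec (u i)) p = [:l i:])"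
    by (rule cassels_pfister[OF K g an x u _ _ w(1)])
       (use c l w polys_closed[OF K] in auto)
  then obtain p where p: "ovec (polys K) D p" "qd D (pgram g) p = [:c:]"
      "\<forall>i\<in>I. pol D (pgram g) (pvec (u i)) p = [:l i:]" by blast
  define w' where "w' = (\<lambda>i. coeff (p i) 0)"
  have "poly (p i) 0 = w' i" for i by (simp add: w'_def poly_0_coeff_0)
  then have ev: "(\<lambda>i. poly (p i) 0) = w'" by auto
  have "qd D g w' = c" using poly_qd[of D g p 0] p(2) by (simp add: ev)
  moreover have "pol D g (u i) w' = l i" if "i \<in> I" for i
    using poly_pol[of D g "u i" p 0] p(3) that by (simp add: ev)
  moreover have "ovec K D w'" using p(1) by (auto simp: ovec_def w'_def polys_def)
  ultimately show ?thesis by blast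
qed

section \<open>Purely transcendental towers and subforms\<close>

locale transc_tower =
  fixes F :: "nat \<Rightarrow> 'b::field set" and T :: "nat \<Rightarrow> 'b"
  assumes base: "is_subfield (F 0)"
    and step: "F (Suc j) = adjoin (F j) (T j)"
    and tr: "transc (F j) (T j)"
begin

lemma sub: "is_subfield (F j)"
  by (induction j) (auto simp: base step intro: is_subfield_adjoin)

lemma mono_Suc: "F j \<subseteq> F (Suc j)"
  unfolding step by (rule adjoin_subset[OF sub])

lemma mono: "i \<le> j \<Longrightarrow> F i \<subseteq> F j"
  by (rule lift_Suc_mono_le[of F]) (rule mono_Suc)

lemma T_mem: "i < j \<Longrightarrow> T i \<in> F j"
  using mem_adjoin[OF sub, of "T i" i] mono[of "Suc i" j] unfolding step[symmetric] by auto

lemma T_nonzero: "T j \<noteq> 0"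
proof
  assume "T j = 0"
  moreover have "[:0, 1:] \<in> polys (F j)"
    by (auto intro!: polys_closed[OF sub] is_subfieldD[OF sub])
  ultimately show False using tr[of j] unfolding transc_def by force
qed

lemma gram: "ogram (F 0) D g \<Longrightarrow> ogram (F j) D g"
  using ogram_mono mono[of 0 j] by blast

lemma aniso_tower: "ogram (F 0) D g \<Longrightarrow> aniso (F 0) D g \<Longrightarrow> aniso (F j) D g"
proof (induction j)
  case (Suc j)
  then show ?case unfolding step by (intro aniso_adjoin[OF sub gram _ tr])
qed

lemma specialize:
  assumes g: "ogram (F 0) D g" and an: "aniso (F 0) D g"
    and u: "\<And>i. i \<in> I \<Longrightarrow> ovec (F 0) D (u i)" and c: "c \<in> F 0" and l: "\<And>i. i \<in> I \<Longrightarrow> l i \<in> F 0"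
  shows "ovec (F j) D w \<Longrightarrow> qd D g w = c \<Longrightarrow> (\<And>i. i \<in> I \<Longrightarrow> pol D g (u i) w = l i) \<Longrightarrow>
    \<exists>w'. ovec (F 0) D w' \<and> qd D g w' = c \<and> (\<forall>i\<in>I. pol D g (u i) w' = l i)"
proof (induction j arbitrary: w)
  case 0
  then show ?case by blast
next
  case (Suc j)
  have uj: "ovec (F j) D (u i)" if "i \<in> I" for i using u[OF that] ovec_mono mono[of 0 j] by blast
  have "\<exists>w'. ovec (F j) D w' \<and> qd D g w' = c \<and> (\<forall>i\<in>I. pol D g (u i) w' = l i)"
    by (rule specialize_step[OF sub gram[OF g] aniso_tower[OF g an] tr uj _ _ Suc.prems(1)[unfolded step]])
       (use Suc.prems c l mono[of 0 j] in auto)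
  then show ?case using Suc.IH by blast
qed

end

text \<open>The reflection along \<open>u - u'\<close> exchanges these two vectors of equal value;
  \<open>w'\<close> is the image of \<open>w\<close> under it. A vector \<open>a\<close> with the
  same pairing with both is orthogonal to \<open>u - u'\<close>, hence fixed.\<close>

lemma reflection:
  fixes g :: "nat \<Rightarrow> nat \<Rightarrow> 'b::field" and w :: "nat \<Rightarrow> 'b"
  assumes eq: "qd D g u = qd D g u'" and nz: "qd D g (u - u') \<noteq> 0"
  defines "w' \<equiv> w - (pol D g w (u - u') / qd D g (u - u')) \<star> (u - u')"
  shows "qd D g w' = qd D g w" "pol D g u' w' = pol D g u w"
    "pol D g a u = pol D g a u' \<Longrightarrow> pol D g a w' = pol D g a w"
proof -
  let ?z = "u - u'" and ?t = "pol D g w (u - u') / qd D g (u - u')"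
  have "?t * pol D g w ?z = ?t * ?t * qd D g ?z" using nz by simp
  then show "qd D g w' = qd D g w"
    unfolding w'_def qd_diff[of D g w] qd_smul by (simp del: pol_simps(5,6))
  show "pol D g a u = pol D g a u' \<Longrightarrow> pol D g a w' = pol D g a w"
    unfolding w'_def by simp
  have "pol D g u' ?z = - qd D g ?z"
    unfolding qd_diff using eq pol_self[of D g u'] by (simp add: pol_sym)
  then have "?t * pol D g u' ?z = - pol D g w ?z" using nz by simp
  then have "pol D g u' w' = pol D g u' w + pol D g w ?z"
    unfolding w'_def by (simp del: pol_simps(5))
  then show "pol D g u' w' = pol D g u w" by (simp add: pol_sym)
qed

lemma const_poly_sum: "(\<Sum>i\<in>I. [:f i:]) = [:\<Sum>i\<in>I. f i:]"
  by (induction I rule: infinite_finite_induct) auto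

lemma qd_lincomb_similar:
  assumes "finite I" "\<And>i. i \<in> I \<Longrightarrow> qd D g (u i) = c * qd N r (e i)"
    "\<And>i k. i \<in> I \<Longrightarrow> k \<in> I \<Longrightarrow> i \<noteq> k \<Longrightarrow> pol D g (u i) (u k) = c * pol N r (e i) (e k)"
  shows "qd D g (lincomb I x u) = c * qd N r (lincomb I x e)"
  using assms
proof (induction)
  case empty
  show "qd D g (lincomb {} x u) = c * qd N r (lincomb {} x e)" by simp
next
  case (insert k I)
  have pe: "pol D g (u k) (lincomb I x u) = c * pol N r (e k) (lincomb I x e)"
  proof -
    have "pol D g (u k) (lincomb I x u) = (\<Sum>i\<in>I. x i * pol D g (u i) (u k))"
      by (simp add: pol_lincomb_left pol_sym[of D g "u k"])
    also have "\<dots> = (\<Sum>i\<in>I. x i * (c * pol N r (e i) (e k)))"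
      using insert.prems(2) insert.hyps(2) by (intro sum.cong refl) (metis insertCI)
    also have "\<dots> = c * pol N r (e k) (lincomb I x e)"
      by (simp add: pol_lincomb_left pol_sym[of N r "e k"] sum_distrib_left mult_ac)
    finally show ?thesis .
  qed
  have IH: "qd D g (lincomb I x u) = c * qd N r (lincomb I x e)"
    using insert by simp
  show "qd D g (lincomb (insert k I) x u) = c * qd N r (lincomb (insert k I) x e)"
    unfolding lincomb_insert[OF insert.hyps] qd_add qd_smul
    by (simp add: IH pe insert.prems(1) algebra_simps)
qed

text \<open>If \<open>g\<close> is anisotropic and represents \<open>c\<close> times the generic value of \<open>r\<close>, compatibly with a
  vector representing \<open>c r(e\<^sub>0)\<close>, then \<open>c r\<close> is a subform of \<open>g\<close>: the coefficient vectors of the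
  transcendentals are peeled off one at a time.\<close>

context transc_tower
begin

text \<open>Coordinate 0 remains 0: in the generic zero of a form it is occupied by an algebraic
  element, and in \<open>peel\<close> the corresponding vector \<open>u 0\<close> is given from the
  outset.\<close>

definition generic :: "nat \<Rightarrow> nat \<Rightarrow> 'b" where
  "generic j = (\<lambda>i. if 1 \<le> i \<and> i \<le> j then T (i - 1) else 0)"

lemma generic_Suc: "generic (Suc j) = generic j + T j \<star> unitv (Suc j)"
  by (auto simp: generic_def unitv_def fun_eq_iff)

lemma ovec_generic: "ovec (F j) D (generic j)"
  using T_mem[of _ j] is_subfieldD(1)[OF sub] by (auto simp: generic_def ovec_def)

lemma peel:
  assumes g: "ogram (F 0) D g" and an: "aniso (F 0) D g" and r: "ogram (F 0) N r" and c: "c \<in> F 0"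
  shows "j \<le> M \<Longrightarrow> (\<And>i. i \<in> {0} \<union> {Suc j..M} \<Longrightarrow> ovec (F 0) D (u i)) \<Longrightarrow>
    (\<And>i. i \<in> {0} \<union> {Suc j..M} \<Longrightarrow> qd D g (u i) = c * qd N r (unitv i)) \<Longrightarrow>
    (\<And>i k. i \<in> {0} \<union> {Suc j..M} \<Longrightarrow> k \<in> {0} \<union> {Suc j..M} \<Longrightarrow> i \<noteq> k \<Longrightarrow>
      pol D g (u i) (u k) = c * pol N r (unitv i) (unitv k)) \<Longrightarrow>
    ovec (F j) D w \<Longrightarrow> qd D g w = c * qd N r (generic j) \<Longrightarrow>
    (\<And>i. i \<in> {0} \<union> {Suc j..M} \<Longrightarrow> pol D g (u i) w = c * pol N r (unitv i) (generic j)) \<Longrightarrow>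
    \<exists>u. (\<forall>i\<le>M. ovec (F 0) D (u i)) \<and> (\<forall>i\<le>M. qd D g (u i) = c * qd N r (unitv i)) \<and>
      (\<forall>i\<le>M. \<forall>k\<le>M. i \<noteq> k \<longrightarrow> pol D g (u i) (u k) = c * pol N r (unitv i) (unitv k))"
proof (induction j arbitrary: u w)
  case 0
  have "i \<in> {0} \<union> {Suc 0..M}" if "i \<le> M" for i using that by auto
  then show ?case using "0.prems"(2-4) by (intro exI[of _ u]) auto
next
  case (Suc j)
  note j = Suc.prems(1) and u = Suc.prems(2-4) and w = Suc.prems(5-7)
  let ?I = "{0} \<union> {Suc (Suc j)..M}" and ?e = "unitv (Suc j) :: nat \<Rightarrow> 'b"
  let ?Y = "generic j"
  note K = sub[of j]
  have F0: "F 0 \<subseteq> F j" by (rule mono) simp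
  have cj: "c \<in> F j" using c F0 by auto
  have uj: "ovec (F j) D (u i)" if "i \<in> ?I" for i using u(1)[OF that] ovec_mono F0 by blast
  have rj: "ogram (F j) N r" and gj: "ogram (F j) D g" and anj: "aniso (F j) D g"
    using gram r g aniso_tower an by auto
  have eF: "ovec (F k) N (unitv i)" for i k by (rule ovec_unitv[OF sub])
  have YF: "ovec (F j) N ?Y" by (rule ovec_generic)
  \<comment> \<open>The prescribed values at \<open>?Y + T j \<star> ?e\<close>, expanded as
    polynomials in the last transcendental \<open>T j\<close> with coefficients over
    \<open>F j\<close>.\<close>
  let ?f = "[:c * qd N r ?Y, c * pol N r ?e ?Y, c * qd N r ?e:]"
  let ?l = "\<lambda>i. [:c * pol N r (unitv i) ?Y, c * pol N r (unitv i) ?e:]"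
  have cl: "c * qd N r ?Y \<in> F j" "c * pol N r ?e ?Y \<in> F j" "c * qd N r ?e \<in> F j"
    "c * pol N r (unitv i) ?Y \<in> F j" "c * pol N r (unitv i) ?e \<in> F j" for i
    by (intro is_subfieldD(4)[OF K] cj qd_over[OF K rj] pol_over[OF K rj] YF eF)+
  have "\<exists>p. ovec (polys (F j)) D p \<and> qd D (pgram g) p = ?f \<and>
      (\<forall>i\<in>?I. pol D (pgram g) (pvec (u i)) p = ?l i)"
  proof (rule cassels_pfister[OF K gj anj tr[of j] uj _ _ w(1)[unfolded step]])
    show "?f \<in> polys (F j)" "?l i \<in> polys (F j)" for i
      by (intro polys_closed(1,8)[OF K] cl)+
    show "qd D g w = poly ?f (T j)"
      unfolding w(2) generic_Suc qd_add qd_smul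
      by (simp add: algebra_simps pol_sym[of N r ?Y])
    show "pol D g (u i) w = poly (?l i) (T j)" if "i \<in> ?I" for i
      unfolding w(3)[OF that] generic_Suc by (simp add: algebra_simps)
  qed
  then obtain p where p: "ovec (polys (F j)) D p" "qd D (pgram g) p = ?f"
      "\<And>i. i \<in> ?I \<Longrightarrow> pol D (pgram g) (pvec (u i)) p = ?l i" by blast
  \<comment> \<open>The value is quadratic in the variable and \<open>g\<close> is anisotropic, so
    \<open>p\<close> is linear. Its coefficient vectors are \<open>w0\<close>, which takes the place
    of \<open>w\<close> one level down, and \<open>u1\<close>, a candidate for
    \<open>u (Suc j)\<close>.\<close>
  have "degree (qd D (pgram g) p) \<le> 2 * 1" unfolding p(2) by (simp add: degree_pCons_le)
  then have deg: "degree (p i) \<le> 1" if "i < D" for i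
    using aniso_degree_le[OF anj p(1) _ that, of 1] by simp
  define w0 u1 where "w0 = (\<lambda>i. coeff (p i) 0)" and "u1 = (\<lambda>i. coeff (p i) 1)"
  have wF: "ovec (F j) D w0" "ovec (F j) D u1"
    using p(1) by (auto simp: ovec_def polys_def w0_def u1_def)
  define p' where "p' = pvec w0 + [:0, 1:] \<star> pvec u1"
  have "p i = p' i" if "i < D" for i
  proof -
    have "coeff (p i) k = coeff (p' i) k" for k
      using deg[OF that] by (cases k; cases "k - 1")
        (auto simp: p'_def pvec_def w0_def u1_def coeff_pCons coeff_eq_0 split: nat.splits)
    then show ?thesis by (rule poly_eqI)
  qed
  then have pp: "qd D (pgram g) p = qd D (pgram g) p'"
    "pol D (pgram g) v p = pol D (pgram g) v p'" for v by (auto intro: qd_cong pol_cong)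
  have pv: "qd D (pgram g) (pvec v) = [:qd D g v:]" "pol D (pgram g) (pvec v) (pvec v') = [:pol D g v v':]" for v v'
  proof -
    have "bil D (pgram g) (pvec v) (pvec v') = [:bil D g v v':]" for v v'
      unfolding bil_def pgram_def pvec_def by (simp add: const_poly_sum mult_ac)
    then show "qd D (pgram g) (pvec v) = [:qd D g v:]" "pol D (pgram g) (pvec v) (pvec v') = [:pol D g v v':]"
      by (simp_all add: qd_def pol_def)
  qed
  have "qd D (pgram g) p' = [:qd D g w0, pol D g w0 u1, qd D g u1:]"
    unfolding p'_def qd_add qd_smul by (simp add: pv)
  then have q: "qd D g w0 = c * qd N r ?Y" "pol D g w0 u1 = c * pol N r ?e ?Y" "qd D g u1 = c * qd N r ?e"
    using p(2) pp(1) by auto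
  have "pol D (pgram g) (pvec v) p' = [:pol D g v w0, pol D g v u1:]" for v
    unfolding p'_def by (simp add: pv)
  then have b: "pol D g (u i) w0 = c * pol N r (unitv i) ?Y" "pol D g (u i) u1 = c * pol N r (unitv i) ?e"
    if "i \<in> ?I" for i using p(3)[OF that] pp(2) by auto
  \<comment> \<open>\<open>u1\<close> lies only over \<open>F j\<close>. Its value and its pairings
    with the earlier vectors lie in \<open>F 0\<close>, so some \<open>u'\<close> over
    \<open>F 0\<close> shares them.\<close>
  have "\<exists>u'. ovec (F 0) D u' \<and> qd D g u' = c * qd N r ?e \<and>
      (\<forall>i\<in>?I. pol D g (u i) u' = c * pol N r (unitv i) ?e)"
  proof (rule specialize[OF g an u(1) _ _ wF(2) q(3) b(2)])
    show "c * qd N r ?e \<in> F 0" "c * pol N r (unitv i) ?e \<in> F 0" for i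
      by (intro is_subfieldD(4)[OF base] c qd_over[OF base r] pol_over[OF base r] eF)+
  qed
  then obtain u' where u': "ovec (F 0) D u'" "qd D g u' = c * qd N r ?e"
      "\<And>i. i \<in> ?I \<Longrightarrow> pol D g (u i) u' = c * pol N r (unitv i) ?e" by blast
  have u'j: "ovec (F j) D u'" using u'(1) ovec_mono F0 by blast
  \<comment> \<open>Replacing \<open>u1\<close> by \<open>u'\<close> must not spoil the pairing with
    \<open>w0\<close>. The reflection exchanging the two moves \<open>w0\<close> along and preserves
    its pairings with the other \<open>u i\<close>; by anisotropy it is undefined only if
    \<open>u1\<close> and \<open>u'\<close> agree.\<close>
  obtain w1 where w1: "ovec (F j) D w1" "qd D g w1 = qd D g w0" "pol D g u' w1 = pol D g u1 w0"
    "\<And>i. i \<in> ?I \<Longrightarrow> pol D g (u i) w1 = pol D g (u i) w0"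
  proof (cases "qd D g (u1 - u') = 0")
    case True
    then have "\<forall>i<D. (u1 - u') i = 0"
      using anj ovec_diff[OF K wF(2) u'j] unfolding aniso_def by blast
    then have "pol D g u' w0 = pol D g u1 w0" by (intro pol_cong) auto
    then show ?thesis using that[of w0] wF(1) by simp
  next
    case False
    have eq: "qd D g u1 = qd D g u'" using q(3) u'(2) by simp
    note rf = reflection[OF eq False, where w = w0]
    show ?thesis
    proof (rule that[OF _ rf(1,2) rf(3)])
      show "ovec (F j) D (w0 - (pol D g w0 (u1 - u') / qd D g (u1 - u')) \<star> (u1 - u'))"
        by (intro ovec_diff ovec_smul K wF u'j is_subfieldD(8)[OF K] pol_over[OF K gj] qd_over[OF K gj])
    qed (use b u' in simp)
  qed
  let ?u = "u(Suc j := u')"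
  have Icases: "i = Suc j \<or> (i \<in> ?I \<and> i \<noteq> Suc j)" if "i \<in> {0} \<union> {Suc j..M}" for i
    using that by auto
  show ?case
  proof (rule Suc.IH[of ?u w1])
    show "j \<le> M" using j by simp
    fix i assume i: "i \<in> {0} \<union> {Suc j..M}"
    show "ovec (F 0) D (?u i)" using Icases[OF i] u(1) u'(1) by auto
    show "qd D g (?u i) = c * qd N r (unitv i)" using Icases[OF i] u(2) u'(2) by auto
    show "pol D g (?u i) w1 = c * pol N r (unitv i) (generic j)"
      using Icases[OF i] w1(3,4) b(1) q(2) pol_sym[of D g u1 w0] by auto
    fix k assume k: "k \<in> {0} \<union> {Suc j..M}" "i \<noteq> k"
    show "pol D g (?u i) (?u k) = c * pol N r (unitv i) (unitv k)"
    proof (cases "i = Suc j")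
      case True
      then have k': "k \<in> ?I" "k \<noteq> Suc j" using Icases[OF k(1)] k(2) by auto
      have "pol D g u' (u k) = pol D g (u k) u'" "pol N r ?e (unitv k) = pol N r (unitv k) ?e"
        by (rule pol_sym)+
      then show ?thesis using u'(3)[OF k'(1)] True k'(2) by simp
    next
      case False
      then have i': "i \<in> ?I" using Icases[OF i] by simp
      show ?thesis
      proof (cases "k = Suc j")
        case True
        then show ?thesis using u'(3)[OF i'] False by simp
      next
        case k2: False
        then have "k \<in> ?I" using Icases[OF k(1)] by simp
        then show ?thesis using u(3)[OF i' _ k(2)] False k2 by simp
      qed
    qed
  qed (use w1 q in auto)
qed

text \<open>With \<open>v\<close> as \<open>u 0\<close>, \<open>peel\<close> yields
  \<open>Suc M\<close> vectors on which \<open>g\<close> is the multiple of \<open>r\<close> by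
  \<open>qd D g v\<close>. A linear dependence among them would be an isotropic vector of
  \<open>r\<close>.\<close>

lemma generic_value_dim:
  assumes g: "ogram (F 0) D g" and an: "aniso (F 0) D g" and r: "ogram (F 0) (Suc M) r"
    and anr: "aniso (F 0) (Suc M) r" and r0: "qd (Suc M) r (unitv 0) = 1"
    and v: "ovec (F 0) D v" "qd D g v \<noteq> 0"
    and w: "ovec (F M) D w" "qd D g w = qd D g v * qd (Suc M) r (generic M)"
      "pol D g v w = qd D g v * pol (Suc M) r (unitv 0) (generic M)"
  shows "Suc M \<le> D"
proof (rule ccontr)
  assume MD: "\<not> Suc M \<le> D"
  have c: "qd D g v \<in> F 0" by (rule qd_over[OF base g v(1)])
  obtain u where u: "\<forall>i\<le>M. ovec (F 0) D (u i)" "\<forall>i\<le>M. qd D g (u i) = qd D g v * qd (Suc M) r (unitv i)"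
    "\<forall>i\<le>M. \<forall>k\<le>M. i \<noteq> k \<longrightarrow> pol D g (u i) (u k) = qd D g v * pol (Suc M) r (unitv i) (unitv k)"
    using peel[OF g an r c, of M M "\<lambda>_. v" w] v w r0 by auto
  obtain x where x: "\<forall>i\<in>{..<Suc M}. x i \<in> F 0" "\<exists>i\<in>{..<Suc M}. x i \<noteq> 0" "\<forall>j<D. lincomb {..<Suc M} x u j = 0"
    using exists_nontrivial_solution[OF base, of "{..<Suc M}" D u] u(1) MD
    by (auto simp: ovec_def less_Suc_eq_le)
  have "qd D g (lincomb {..<Suc M} x u) = qd D g v * qd (Suc M) r (lincomb {..<Suc M} x unitv)"
    using u(2,3) by (intro qd_lincomb_similar) auto
  moreover have "qd D g (lincomb {..<Suc M} x u) = qd D g 0" using x(3) by (intro qd_cong) simp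
  moreover have "qd (Suc M) r (lincomb {..<Suc M} x unitv) = qd (Suc M) r x"
    by (intro qd_cong lincomb_unitv)
  ultimately have "qd (Suc M) r x = 0" using v(2) by simp
  then show False using anr x(1,2) unfolding aniso_def ovec_def by blast
qed

end

lemma linmap_mono:
  assumes K: "is_subfield K" and L: "is_subfield L" and KL: "K \<subseteq> L" and f: "linmap K D D' f"
  shows "linmap L D D' f"
  unfolding linmap_def
proof (intro conjI allI impI)
  fix u assume u: "ovec L D u"
  have fu: "ovec L D' (f (unitv i))" for i
    using linmapD(4)[OF f ovec_unitv[OF K]] ovec_mono KL by blast
  have "ovec L D' (lincomb {..<D} u (\<lambda>i. f (unitv i)))"
    using u fu by (intro ovec_lincomb[OF L]) (auto simp: ovec_def)
  moreover have "f u j = lincomb {..<D} u (\<lambda>i. f (unitv i)) j" if "j < D'" for j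
  proof -
    have "f u j = f (lincomb {..<D} u unitv) j"
      using that by (intro linmapD(3)[OF f]) (auto simp: lincomb_unitv)
    then show ?thesis by (simp add: linmap_lincomb[OF f])
  qed
  ultimately show "ovec L D' (f u)" by (simp add: ovec_def)
qed (use f in \<open>auto simp: linmap_def\<close>)

lemma isom_mono:
  "is_subfield K \<Longrightarrow> is_subfield L \<Longrightarrow> K \<subseteq> L \<Longrightarrow> isom K D g g' \<Longrightarrow> isom L D g g'"
  unfolding isom_def using linmap_mono by blast

lemma inverse_eq_divide_of_mult: "y * m = n \<Longrightarrow> y \<noteq> 0 \<Longrightarrow> m \<noteq> 0 \<Longrightarrow> inverse y = m / n"
  for y :: "'b::field" by (auto simp: field_simps)

section \<open>Quadratic extensions\<close>

definition quad_ext :: "'b::field set \<Rightarrow> 'b \<Rightarrow> 'b set" where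
  "quad_ext E \<theta> = {a + b * \<theta> |a b. a \<in> E \<and> b \<in> E}"

lemma quad_extI: "a \<in> E \<Longrightarrow> b \<in> E \<Longrightarrow> y = a + b * \<theta> \<Longrightarrow> y \<in> quad_ext E \<theta>"
  unfolding quad_ext_def by blast

lemma quad_ext_subset: "is_subfield E \<Longrightarrow> E \<subseteq> quad_ext E \<theta>"
  using is_subfieldD(1) by (auto intro!: quad_extI[of _ E 0])

lemma countable_quad_ext: assumes "countable E" shows "countable (quad_ext E \<theta>)"
proof -
  have "quad_ext E \<theta> \<subseteq> (\<lambda>(a, b). a + b * \<theta>) ` (E \<times> E)" by (auto simp: quad_ext_def)
  moreover have "countable ((\<lambda>(a, b). a + b * \<theta>) ` (E \<times> E))"
    using assms by (intro countable_image countable_SIGMA)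
  ultimately show ?thesis by (rule countable_subset)
qed

context
  fixes E :: "'b::field set" and \<theta> s t :: 'b
  assumes E: "is_subfield E" and ts: "t \<in> E" "s \<in> E" and \<theta>: "\<theta> \<notin> E" "\<theta> * \<theta> = - (t * \<theta> + s)"
begin

lemma quad_ext_zero: assumes "a \<in> E" "b \<in> E" "a + b * \<theta> = 0" shows "a = 0" "b = 0"
proof -
  show "b = 0"
  proof (rule ccontr)
    assume "b \<noteq> 0"
    then have "\<theta> = - a / b" using assms(3) by (simp add: field_simps add_eq_0_iff)
    then show False using \<theta>(1) assms is_subfieldD[OF E] by metis
  qed
  then show "a = 0" using assms(3) by simp
qed

lemma is_subfield_quad_ext: "is_subfield (quad_ext E \<theta>)"
  unfolding is_subfield_def
proof (intro conjI ballI)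
  show 01: "0 \<in> quad_ext E \<theta>" "1 \<in> quad_ext E \<theta>"
    using quad_ext_subset[OF E] is_subfieldD(1,2)[OF E] by auto
  fix y assume "y \<in> quad_ext E \<theta>"
  then obtain a b where y: "a \<in> E" "b \<in> E" "y = a + b * \<theta>" unfolding quad_ext_def by blast
  show "- y \<in> quad_ext E \<theta>"
    using y by (intro quad_extI[of "- a" E "- b"]) (auto intro: is_subfieldD[OF E])
  show "inverse y \<in> quad_ext E \<theta>"
  proof (cases "y = 0")
    case True
    then show ?thesis using 01 by simp
  next
    case False
    \<comment> \<open>The norm of \<open>y\<close>. The conjugate of \<open>\<theta>\<close> is
      \<open>- t - \<theta>\<close>, so the conjugate of \<open>y\<close> is
      \<open>(a - b * t) + (- b) * \<theta>\<close>.\<close>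
    let ?n = "a * a - a * b * t + b * b * s"
    have n: "(a + b * \<theta>) * ((a - b * t) + (- b) * \<theta>) = ?n"
    proof -
      have "(a + b * \<theta>) * ((a - b * t) + (- b) * \<theta>) = a * (a - b * t) - b * b * t * \<theta> - b * b * (\<theta> * \<theta>)"
        by (simp add: algebra_simps)
      then show ?thesis unfolding \<theta>(2) by (simp add: algebra_simps)
    qed
    let ?m = "(a - b * t) + (- b) * \<theta>"
    have mE: "a - b * t \<in> E" "- b \<in> E" by (intro is_subfieldD[OF E] y(1,2) ts)+
    have "?m \<noteq> 0"
    proof
      assume "?m = 0"
      then have "a - b * t = 0" "- b = 0" using quad_ext_zero[OF mE] by blast+
      then show False using False y by simp
    qed
    then have "inverse y = ?m / ?n"
      by (rule inverse_eq_divide_of_mult[OF n[folded y(3)] False])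
    then have "inverse y = (a - b * t) / ?n + (- b / ?n) * \<theta>"
      by (simp only: add_divide_distrib times_divide_eq_left)
    then show ?thesis
      by (rule quad_extI[rotated 2]) (intro is_subfieldD[OF E] y ts)+
  qed
  fix z assume "z \<in> quad_ext E \<theta>"
  then obtain a' b' where z: "a' \<in> E" "b' \<in> E" "z = a' + b' * \<theta>" unfolding quad_ext_def by blast
  show "y + z \<in> quad_ext E \<theta>"
    using y z by (intro quad_extI[of "a + a'" E "b + b'"])
      (auto intro: is_subfieldD[OF E] simp: algebra_simps)
  have "y * z = a * a' + (a * b' + b * a') * \<theta> + b * b' * (\<theta> * \<theta>)"
    unfolding y z by (simp add: algebra_simps)
  then have "y * z = (a * a' - b * b' * s) + (a * b' + b * a' - b * b' * t) * \<theta>"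
    unfolding \<theta>(2) by (simp add: algebra_simps)
  then show "y * z \<in> quad_ext E \<theta>"
    by (rule quad_extI[rotated 2]) (intro is_subfieldD[OF E] y z ts)+
qed

text \<open>An isotropic vector \<open>a + \<theta> v\<close> amounts to \<open>qd a = s qd v\<close> and \<open>pol v a = t qd v\<close>; for an
  anisotropic form, a Lagrangian over the extension maps bijectively to the second components.\<close>

lemma metab_quad_ext:
  assumes g: "ogram E D g" and an: "aniso E D g" and m: "metab (quad_ext E \<theta>) D g" and v: "ovec E D v"
  shows "\<exists>w. ovec E D w \<and> qd D g w = qd D g v * s \<and> pol D g v w = qd D g v * t"
proof -
  let ?L = "quad_ext E \<theta>"
  obtain I w where w: "finite (I::nat set)" "D = 2 * card I" "\<forall>i\<in>I. ovec ?L D (w i)"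
     "indep ?L I D w" "\<forall>c. (\<forall>i\<in>I. c i \<in> ?L) \<longrightarrow> qd D g (lincomb I c w) = 0"
    using m unfolding metab_def by blast
  have "\<forall>i\<in>I. \<forall>j. \<exists>a b. j < D \<longrightarrow> a \<in> E \<and> b \<in> E \<and> w i j = a + b * \<theta>"
    using w(3) unfolding ovec_def quad_ext_def by blast
  then obtain a b where ab: "\<And>i j. i \<in> I \<Longrightarrow> j < D \<Longrightarrow> a i j \<in> E \<and> b i j \<in> E \<and> w i j = a i j + b i j * \<theta>"
    by metis
  \<comment> \<open>The second components of \<open>w i\<close> and of
    \<open>\<theta> \<star> w i\<close>, because \<open>\<theta> * (a + b * \<theta>) = - s * b + (a
    - t * b) * \<theta>\<close>. Together with \<open>v\<close> these are \<open>D + 1\<close>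
    vectors of length \<open>D\<close> over \<open>E\<close>, hence linearly dependent.\<close>
  let ?x = "case_sum b (\<lambda>i. a i - t \<star> b i)"
  let ?S = "insert None (Some ` (I <+> I))" and ?y = "case_option v ?x"
  have fin: "finite (Some ` (I <+> I))" using w(1) by simp
  have card: "card ?S > D" using w(1,2) by (simp add: card_image card_Plus)
  have xE: "ovec E D (?x k)" if "k \<in> I <+> I" for k
    using that
  proof (rule PlusE)
    fix i assume "i \<in> I" "k = Inl i"
    then show ?thesis using ab by (auto simp: ovec_def)
  next
    fix i assume "i \<in> I" "k = Inr i"
    then show ?thesis using ab by (auto simp: ovec_def intro!: is_subfieldD(4,7)[OF E] ts)
  qed
  obtain \<kappa> where \<kappa>: "\<forall>k\<in>?S. \<kappa> k \<in> E" "\<exists>k\<in>?S. \<kappa> k \<noteq> 0" "\<forall>j<D. lincomb ?S \<kappa> ?y j = 0"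
  proof -
    have "\<exists>\<kappa>. (\<forall>k\<in>?S. \<kappa> k \<in> E) \<and> (\<exists>k\<in>?S. \<kappa> k \<noteq> 0) \<and> (\<forall>j<D. lincomb ?S \<kappa> ?y j = 0)"
    proof (rule exists_nontrivial_solution[OF E _ card])
      fix k j assume "k \<in> ?S" "j < D"
      then consider "k = None" | k' where "k = Some k'" "k' \<in> I <+> I" by blast
      then show "?y k j \<in> E"
        using v xE \<open>j < D\<close> by cases (simp_all add: ovec_def)
    qed (use fin in simp)
    then show ?thesis using that by blast
  qed
  define p q where "p i = \<kappa> (Some (Inl i))" and "q i = \<kappa> (Some (Inr i))" for i
  have pq: "p i \<in> E" "q i \<in> E" if "i \<in> I" for i using \<kappa>(1) that by (auto simp: p_def q_def)
  define A B where "A = (\<lambda>j. \<Sum>i\<in>I. p i * a i j - s * q i * b i j)"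
    and "B = (\<lambda>j. \<Sum>i\<in>I. p i * b i j + q i * (a i j - t * b i j))"
  have B: "\<kappa> None * v j + B j = 0" if "j < D" for j
  proof -
    have "lincomb ?S \<kappa> ?y j = \<kappa> None * v j + (\<Sum>k\<in>I <+> I. \<kappa> (Some k) * ?x k j)"
      unfolding lincomb_def using fin by (simp add: sum.reindex)
    also have "(\<Sum>k\<in>I <+> I. \<kappa> (Some k) * ?x k j) = B j"
      using w(1) by (simp add: sum.Plus B_def p_def q_def sum.distrib)
    finally show ?thesis using \<kappa>(3) that by simp
  qed
  have AE: "ovec E D A" and BE: "ovec E D B"
    unfolding A_def B_def ovec_def using ab pq ts by (auto intro!: subfield_sum[OF E] is_subfieldD[OF E])
  define c where "c i = p i + q i * \<theta>" for i
  have cL: "\<forall>i\<in>I. c i \<in> ?L" using pq by (auto simp: c_def intro: quad_extI)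
  have W: "lincomb I c w j = (A + \<theta> \<star> B) j" if j: "j < D" for j
  proof -
    have "c i * w i j = (p i * a i j - s * q i * b i j) + \<theta> * (p i * b i j + q i * (a i j - t * b i j))"
      if "i \<in> I" for i
    proof -
      have "c i * w i j = p i * a i j + \<theta> * (p i * b i j + q i * a i j) + q i * b i j * (\<theta> * \<theta>)"
        using ab[OF that j] by (simp add: c_def algebra_simps)
      then show ?thesis unfolding \<theta>(2) by (simp add: algebra_simps)
    qed
    then have "lincomb I c w j = (\<Sum>i\<in>I. (p i * a i j - s * q i * b i j) +
        \<theta> * (p i * b i j + q i * (a i j - t * b i j)))"
      unfolding lincomb_def by (rule sum.cong[OF refl])
    also have "\<dots> = A j + (\<Sum>i\<in>I. \<theta> * (p i * b i j + q i * (a i j - t * b i j)))"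
      unfolding A_def by (rule sum.distrib)
    also have "\<dots> = A j + \<theta> * B j"
      unfolding B_def by (simp only: sum_distrib_left[symmetric])
    finally show ?thesis by simp
  qed
  have "qd D g (lincomb I c w) = 0" using w(5) cL by blast
  moreover have "qd D g (lincomb I c w) = qd D g (A + \<theta> \<star> B)" by (rule qd_cong) (rule W)
  ultimately have "qd D g (A + \<theta> \<star> B) = 0" by simp
  then have "(qd D g A - s * qd D g B) + (pol D g A B - t * qd D g B) * \<theta> = 0"
    unfolding qd_add qd_smul \<theta>(2) by (simp add: algebra_simps)
  then have 0: "qd D g A = s * qd D g B" "pol D g A B = t * qd D g B"
    using quad_ext_zero[of "qd D g A - s * qd D g B" "pol D g A B - t * qd D g B"]
      qd_over[OF E g] pol_over[OF E g] AE BE ts is_subfieldD[OF E] by auto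
  \<comment> \<open>Without \<open>v\<close> the relation would say \<open>B = 0\<close>. Then
    \<open>A\<close> is isotropic, hence zero, and so is the combination
    \<open>A + \<theta> \<star> B\<close> of the Lagrangian basis, whose coefficients are not all
    0.\<close>
  have k0: "\<kappa> None \<noteq> 0"
  proof
    assume k0: "\<kappa> None = 0"
    then have "\<forall>j<D. B j = 0" using B by simp
    moreover from this have "qd D g B = qd D g 0" by (intro qd_cong) simp
    then have "\<forall>j<D. A j = 0" using an AE 0(1) unfolding aniso_def by simp
    ultimately have "\<forall>j<D. lincomb I c w j = 0" using W by simp
    then have c0: "\<forall>i\<in>I. c i = 0" using w(4) cL unfolding indep_def by blast
    have "p i = 0" "q i = 0" if "i \<in> I" for i
      using quad_ext_zero[OF pq[OF that]] c0 that by (auto simp: c_def)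
    then have "\<forall>k\<in>?S. \<kappa> k = 0" using k0 by (auto simp: p_def q_def)
    then show False using \<kappa>(2) by blast
  qed
  define k where "k = - inverse (\<kappa> None)"
  have kE: "k \<in> E" using \<kappa>(1) by (auto simp: k_def intro!: is_subfieldD[OF E])
  have vB: "v j = (k \<star> B) j" if "j < D" for j
  proof -
    have "B j = - (\<kappa> None * v j)" using B[OF that] by (simp add: add_eq_0_iff)
    then show ?thesis using k0 by (simp add: k_def)
  qed
  have v: "qd D g v = k * k * qd D g B" "pol D g v u = k * pol D g B u" for u
  proof -
    have "qd D g v = qd D g (k \<star> B)" by (rule qd_cong) (rule vB)
    moreover have "pol D g v u = pol D g (k \<star> B) u" by (rule pol_cong[OF vB refl])
    ultimately show "qd D g v = k * k * qd D g B" "pol D g v u = k * pol D g B u"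
      by (simp_all add: qd_smul)
  qed
  show ?thesis
    using kE AE by (intro exI[of _ "k \<star> A"] conjI ovec_smul[OF E])
      (simp_all add: v qd_smul 0 pol_sym[of D g B A])
qed

end

section \<open>Function fields of quadrics\<close>

lemma metab_zero_dim: "metab K 0 g"
  by (rule metabI[of "{}::nat set" _ _ "\<lambda>_ _. 0"]) (auto simp: indep_def qd_def bil_def)

lemma exists_transc_tower:
  assumes "is_subfield (K :: 'b::field set)" "countable K" "uncountable (UNIV :: 'b set)"
  shows "\<exists>F T. F 0 = K \<and> transc_tower F T \<and> (\<forall>j. countable (F j))"
proof -
  define next_el :: "'b set \<Rightarrow> 'b" where "next_el E = (SOME x. transc E x)" for E
  define F where "F = rec_nat K (\<lambda>_ E. adjoin E (next_el E))"
  have F: "F 0 = K" "F (Suc j) = adjoin (F j) (next_el (F j))" for j by (simp_all add: F_def)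
  have c: "countable (F j)" for j
    by (induction j) (auto simp: F assms countable_adjoin)
  have "transc (F j) (next_el (F j))" for j
    unfolding next_el_def by (rule someI_ex) (rule exists_transc[OF c assms(3)])
  then have "transc_tower F (\<lambda>j. next_el (F j))"
    using F assms(1) by unfold_locales auto
  then show ?thesis using F(1) c by blast
qed

definition isotropic :: "'b::field set \<Rightarrow> nat \<Rightarrow> (nat \<Rightarrow> nat \<Rightarrow> 'b) \<Rightarrow> bool" where
  "isotropic K D g \<longleftrightarrow> (\<exists>x. ovec K D x \<and> (\<exists>i<D. x i \<noteq> 0) \<and> qd D g x = 0)"

lemma aniso_iff: "aniso K D g \<longleftrightarrow> \<not> isotropic K D g"
  unfolding aniso_def isotropic_def by blast

text \<open>The field \<open>L\<close> is the function field of the quadric \<open>r = 0\<close>.\<close>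

lemma generic_splitting:
  assumes K: "is_subfield (K :: 'b::field set)" "countable K" and unc: "uncountable (UNIV :: 'b set)"
    and quad: "\<And>t s :: 'b. \<exists>x. x * x = - (t * x + s)"
    and r: "ogram K N r" and anr: "aniso K N r" and r0: "qd N r (unitv 0) = 1" and N: "N \<ge> 2"
  shows "\<exists>L. is_subfield L \<and> countable L \<and> K \<subseteq> L \<and> isotropic L N r \<and>
    (\<forall>D g. ogram K D g \<longrightarrow> nonsing K D g \<longrightarrow> D < N \<or> (D = N \<and> isotropic K D g) \<longrightarrow>
       metab L D g \<longrightarrow> metab K D g)"
proof -
  obtain M where M: "N = Suc M" using N by (cases N) auto
  obtain F T where F: "F 0 = K" "transc_tower F T" "\<And>j. countable (F j)"
    using exists_transc_tower[OF K unc] by blast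
  interpret transc_tower F T by (rule F(2))
  let ?E = "F M" and ?Y = "generic M"
  have E: "is_subfield ?E" by (rule sub)
  have KE: "K \<subseteq> ?E" using mono[of 0 M] F(1) by simp
  have rE: "ogram ?E N r" using r KE by (rule ogram_mono)
  define s t where "s = qd N r ?Y" and "t = pol N r (unitv 0) ?Y"
  have st: "t \<in> ?E" "s \<in> ?E"
    unfolding s_def t_def
    by (intro qd_over[OF E rE] pol_over[OF E rE] ovec_generic ovec_unitv[OF E])+
  obtain \<theta> where \<theta>: "\<theta> * \<theta> = - (t * \<theta> + s)" using quad by blast
  \<comment> \<open>The generic zero of \<open>r\<close>: independent transcendentals in the
    coordinates from 1 on and \<open>\<theta>\<close> in coordinate 0. As \<open>r\<close> takes the
    value 1 at \<open>unitv 0\<close>, the equation of \<open>\<theta>\<close> says precisely that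
    \<open>r\<close> vanishes at \<open>z\<close>.\<close>
  define z where "z = \<theta> \<star> unitv 0 + ?Y"
  have z: "qd N r z = 0"
    unfolding z_def qd_add qd_smul pol_simps r0 s_def[symmetric] t_def[symmetric] \<theta>
    by (simp add: algebra_simps)
  have z1: "z 1 \<noteq> 0"
    using T_nonzero N M by (simp add: z_def unitv_def generic_def)
  then have nz: "\<exists>i<N. z i \<noteq> 0" using N by (intro exI[of _ 1]) simp
  \<comment> \<open>Otherwise \<open>r\<close> would become isotropic over a purely transcendental
    extension, contrary to \<open>aniso_tower\<close>.\<close>
  have "\<theta> \<notin> ?E"
  proof
    assume "\<theta> \<in> ?E"
    then have "ovec ?E N z" unfolding z_def
      by (intro ovec_add ovec_smul E ovec_unitv ovec_generic)
    then have "isotropic ?E N r" unfolding isotropic_def using z nz by blast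
    then show False using aniso_tower[of N r M] r anr F(1) by (simp add: aniso_iff)
  qed
  note Q = E st this \<theta>
  let ?L = "quad_ext ?E \<theta>"
  have L: "is_subfield ?L" by (rule is_subfield_quad_ext[OF Q])
  have KL: "K \<subseteq> ?L" using KE quad_ext_subset[OF E] by blast
  have "\<theta> \<in> ?L" by (rule quad_extI[of 0 _ 1]) (auto intro: is_subfieldD[OF E])
  moreover have "ovec ?L N ?Y" by (rule ovec_mono[OF ovec_generic quad_ext_subset[OF E]])
  ultimately have "ovec ?L N z"
    unfolding z_def by (rule ovec_add[OF L ovec_smul[OF L _ ovec_unitv[OF L]]])
  then have iso: "isotropic ?L N r" unfolding isotropic_def using z nz by blast
  \<comment> \<open>An isotropic \<open>g\<close> loses a hyperbolic plane, after which the
    dimension is below \<open>N\<close>. For an anisotropic \<open>g\<close> of positive dimension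
    the generic value of \<open>r\<close> forces \<open>N \<le> D\<close>, and the alternative
    \<open>D = N\<close> is reserved for isotropic forms.\<close>
  have small: "ogram K D g \<Longrightarrow> nonsing K D g \<Longrightarrow> D < N \<or> (D = N \<and> isotropic K D g) \<Longrightarrow>
     metab ?L D g \<Longrightarrow> metab K D g" for D g
  proof (induction D arbitrary: g rule: less_induct)
    case (less D)
    show ?case
    proof (cases "isotropic K D g")
      case True
      then obtain D' g' where D': "D = 2 + D'" "ogram K D' g'" "nonsing K D' g'"
        "isom K D (gsum 2 hyp_gram g') g"
        using split_hyperbolic_plane[OF K(1) less.prems(1,2)] unfolding isotropic_def by blast
      have "metab ?L (2 + D') (gsum 2 hyp_gram g')"
        using isom_metab[OF isom_sym[OF isom_mono[OF K(1) L KL D'(4)]] less.prems(4)] D'(1) by simp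
      then have "metab ?L D' g'" by (rule metab_cancel_hyp[OF L])
      then have "metab K D' g'" using less.IH[of D' g'] D' less.prems(3) by auto
      moreover have "metab K 2 hyp_gram" by (rule metab_hyp[OF K(1)])
      ultimately have "metab K (2 + D') (gsum 2 hyp_gram g')" by (intro metab_gsum[OF K(1)])
      then show ?thesis using isom_metab[OF D'(4)] D'(1) by simp
    next
      case False
      then have an: "aniso K D g" by (simp add: aniso_iff)
      show ?thesis
      proof (cases "D = 0")
        case True
        then show ?thesis by (simp add: metab_zero_dim)
      next
        case D: False
        \<comment> \<open>Any vector with nonzero value serves; this value is the scalar by which
          the copy of \<open>r\<close> inside \<open>g\<close> would be multiplied.\<close>
        have v: "ovec K D (unitv 0)" by (rule ovec_unitv[OF K(1)])
        have v0: "qd D g (unitv 0) \<noteq> 0"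
          using an v D unfolding aniso_def by (auto simp: unitv_def dest!: spec[of _ "unitv 0"])
        have vE: "ovec ?E D (unitv 0)" by (rule ovec_unitv[OF E])
        have gE: "ogram ?E D g" using less.prems(1) KE by (rule ogram_mono)
        have anE: "aniso ?E D g" using aniso_tower[of D g M] less.prems(1) an F(1) by simp
        obtain w where w: "ovec ?E D w" "qd D g w = qd D g (unitv 0) * s"
          "pol D g (unitv 0) w = qd D g (unitv 0) * t"
          using metab_quad_ext[OF Q gE anE less.prems(4) vE] by blast
        have "Suc M \<le> D"
          by (rule generic_value_dim[where g = g and r = r and v = "unitv 0" and w = w])
            (use less.prems(1) an r anr r0 v v0 w F(1) M s_def t_def in auto)
        then show ?thesis using less.prems(3) False M by simp
      qed
    qed
  qed
  show ?thesis using L countable_quad_ext[OF F(3)] KL iso small by blast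
qed

section \<open>Pfister forms\<close>

lemma linmap_pair:
  assumes "linmap K m k f" "linmap K m n h"
  shows "linmap K m (k + n) (\<lambda>v. appv k (f v) (h v))"
  unfolding linmap_def
proof (intro conjI allI impI)
  fix u v :: "nat \<Rightarrow> 'a" and i assume *: "\<forall>i<m. u i = v i" "i < k + n"
  then show "appv k (f u) (h u) i = appv k (f v) (h v) i"
    using linmapD(3)[OF assms(1), of u v i] linmapD(3)[OF assms(2), of u v "i - k"]
    by (auto simp: appv_def)
qed (auto simp: linmapD(1,2)[OF assms(1)] linmapD(1,2)[OF assms(2)] appv_linear
      intro!: ovec_appv linmapD(4)[OF assms(1)] linmapD(4)[OF assms(2)])

lemma linmap_head: "linmap K (m + n) m (\<lambda>v. v)"
  by (auto simp: linmap_def intro: ovec_less)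

lemma linmap_tail: "linmap K (m + n) n (tailv m)"
  unfolding linmap_def by (auto simp: ovec_tailv) (simp add: tailv_def)

text \<open>Similarities without bijectivity: 0 is then a factor too, by the zero map, and
  \<open>round_form\<close> can speak of all values, including those of isotropic vectors.\<close>

definition sim_factor :: "'b::field set \<Rightarrow> nat \<Rightarrow> (nat \<Rightarrow> nat \<Rightarrow> 'b) \<Rightarrow> 'b \<Rightarrow> bool" where
  "sim_factor K D g c \<longleftrightarrow> (\<exists>f. linmap K D D f \<and> (\<forall>v. qd D g (f v) = c * qd D g v))"

lemma sim_factor_mult:
  assumes "sim_factor K D g c" "sim_factor K D g d" shows "sim_factor K D g (c * d)"
proof -
  obtain f h where f: "linmap K D D f" "\<And>v. qd D g (f v) = c * qd D g v"
    and h: "linmap K D D h" "\<And>v. qd D g (h v) = d * qd D g v"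
    using assms unfolding sim_factor_def by blast
  show ?thesis unfolding sim_factor_def
    using linmap_comp[OF h(1) f(1)] by (intro exI[of _ "\<lambda>v. f (h v)"]) (simp add: f h mult.assoc)
qed

lemma sim_factor_divide:
  assumes K: "is_subfield K" and cd: "sim_factor K D g c" "sim_factor K D g d" "d \<in> K"
  shows "sim_factor K D g (c / d)"
proof (cases "d = 0")
  case True
  \<comment> \<open>Here \<open>c / d\<close> is 0 by the convention for division, and the zero map
    has this factor.\<close>
  have "linmap K D D (\<lambda>v. 0 \<star> id v)" by (rule linmap_smul[OF K is_subfieldD(1)[OF K] linmap_id])
  then show ?thesis unfolding sim_factor_def using True by (intro exI[of _ "\<lambda>v. 0 \<star> id v"]) auto
next
  case False
  have "linmap K D D (\<lambda>v. inverse d \<star> id v)"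
    by (rule linmap_smul[OF K is_subfieldD(6)[OF K cd(3)] linmap_id])
  then have "sim_factor K D g (inverse d * inverse d)"
    unfolding sim_factor_def by (intro exI[of _ "\<lambda>v. inverse d \<star> id v"]) (simp add: qd_smul)
  then have "sim_factor K D g (c * d * (inverse d * inverse d))"
    by (rule sim_factor_mult[OF sim_factor_mult[OF cd(1,2)]])
  moreover have "c * d * (inverse d * inverse d) = c / d" using False by (simp add: field_simps)
  ultimately show ?thesis by simp
qed

definition norm_gram :: "'b::zero_neq_one \<Rightarrow> nat \<Rightarrow> nat \<Rightarrow> 'b" where
  "norm_gram \<alpha> = (\<lambda>i j. if i = 0 \<and> j \<le> 1 then 1 else if i = 1 \<and> j = 1 then \<alpha> else 0)"

lemma qd_norm: "qd 2 (norm_gram \<alpha>) v = v 0 * v 0 + v 0 * v 1 + \<alpha> * v 1 * v 1"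
  by (simp add: qd_def bil_def norm_gram_def numeral_2_eq_2)

lemma pol_norm: "pol 2 (norm_gram \<alpha>) u v = 2 * u 0 * v 0 + u 0 * v 1 + u 1 * v 0 + 2 * \<alpha> * u 1 * v 1"
  by (simp add: pol_def bil_def norm_gram_def numeral_2_eq_2 algebra_simps)

abbreviation pf_dim :: "nat \<Rightarrow> nat" where "pf_dim m \<equiv> 2 ^ Suc m"

fun pf_gram :: "'b::field list \<Rightarrow> 'b \<Rightarrow> nat \<Rightarrow> nat \<Rightarrow> 'b" where
  "pf_gram [] \<alpha> = norm_gram \<alpha>"
| "pf_gram (\<beta> # \<beta>s) \<alpha> =
     gsum (pf_dim (length \<beta>s)) (pf_gram \<beta>s \<alpha>) (gscale \<beta> (pf_gram \<beta>s \<alpha>))"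

definition round_form :: "'b::field set \<Rightarrow> nat \<Rightarrow> (nat \<Rightarrow> nat \<Rightarrow> 'b) \<Rightarrow> bool" where
  "round_form K D g \<longleftrightarrow> (\<forall>x. ovec K D x \<longrightarrow> sim_factor K D g (qd D g x))"

lemma round_norm:
  assumes K: "is_subfield K" and \<alpha>: "\<alpha> \<in> K" shows "round_form K 2 (norm_gram \<alpha>)"
  unfolding round_form_def
proof (intro allI impI)
  fix x assume x: "ovec K 2 x"
  \<comment> \<open>Multiplication by \<open>x 0 + x 1 z\<close> in the quadratic algebra with
    \<open>z^2 = z - \<alpha>\<close>, whose norm form is the given one.\<close>
  define f where "f v = (\<lambda>i::nat. if i = 0 then x 0 * v 0 - \<alpha> * x 1 * v 1
      else if i = 1 then x 0 * v 1 + x 1 * v 0 + x 1 * v 1 else 0)" for v :: "nat \<Rightarrow> 'a"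
  have x01: "x 0 \<in> K" "x 1 \<in> K" using x by (auto simp: ovec_def)
  have "linmap K 2 2 f"
    unfolding linmap_def
  proof (intro conjI allI impI)
    fix u assume "ovec K 2 u"
    then have "u 0 \<in> K" "u 1 \<in> K" by (auto simp: ovec_def)
    then show "ovec K 2 (f u)"
      unfolding f_def ovec_def using x01 \<alpha> by (auto intro!: is_subfieldD(3,4,7)[OF K])
  qed (auto simp: f_def fun_eq_iff algebra_simps)
  moreover have "qd 2 (norm_gram \<alpha>) (f v) = qd 2 (norm_gram \<alpha>) x * qd 2 (norm_gram \<alpha>) v" for v
    unfolding qd_norm f_def by (simp add: algebra_simps)
  ultimately show "sim_factor K 2 (norm_gram \<alpha>) (qd 2 (norm_gram \<alpha>) x)"
    unfolding sim_factor_def by blast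
qed

text \<open>For \<open>p\<close> and \<open>q\<close> nonzero and \<open>e = \<beta> q / p\<close>,
  the identity \<open>g (x - e y) + e g (x + y) = (1 + e) (g x + e g y)\<close> shows that
  \<open>1 + e\<close> is a similarity factor of \<open><1, e> g\<close>. The factors
  \<open>p\<close> and \<open>q / p\<close> of \<open>g\<close> turn this into the factor
  \<open>p + \<beta> q\<close> of \<open><1, \<beta>> g\<close>.\<close>

lemma round_double:
  assumes K: "is_subfield K" and g: "ogram K n g" and rd: "round_form K n g" and \<beta>: "\<beta> \<in> K"
  shows "round_form K (n + n) (gsum n g (gscale \<beta> g))"
  unfolding round_form_def
proof (intro allI impI)
  fix x assume x: "ovec K (n + n) x"
  let ?r = "gsum n g (gscale \<beta> g)"
  define p q where "p = qd n g x" and "q = qd n g (tailv n x)"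
  have pq: "p \<in> K" "q \<in> K"
    unfolding p_def q_def by (intro qd_over[OF K g] ovec_less[OF x] ovec_tailv[OF x])+
  have spq: "sim_factor K n g p" "sim_factor K n g q"
    using rd ovec_less[OF x] ovec_tailv[OF x] unfolding round_form_def p_def q_def by blast+
  have c: "qd (n + n) ?r x = p + \<beta> * q" unfolding qd_gsum qd_gscale by (simp add: p_def q_def)
  obtain A where A: "linmap K n n A" "\<And>v. qd n g (A v) = p * qd n g v"
    using spq(1) unfolding sim_factor_def by blast
  obtain B where B: "linmap K n n B" "\<And>v. qd n g (B v) = q * qd n g v"
    using spq(2) unfolding sim_factor_def by blast
  note hd = linmap_head[of K n n] and tl = linmap_tail[of K n n]
  show "sim_factor K (n + n) ?r (qd (n + n) ?r x)"
  proof (cases "p = 0 \<or> q = 0")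
    case True
    show ?thesis
    proof (cases "q = 0")
      case q: True
      let ?f = "\<lambda>v. appv n (A v) (A (tailv n v))"
      have "linmap K (n + n) (n + n) ?f"
        by (rule linmap_pair[OF linmap_comp[OF hd A(1)] linmap_comp[OF tl A(1)]])
      moreover have "qd (n + n) ?r (?f v) = (p + \<beta> * q) * qd (n + n) ?r v" for v
        unfolding qd_gsum qd_gscale by (simp add: A q algebra_simps)
      ultimately show ?thesis unfolding sim_factor_def c by blast
    next
      case False
      then have p: "p = 0" using True by simp
      let ?f = "\<lambda>v. appv n (\<beta> \<star> B (tailv n v)) (B v)"
      have "linmap K (n + n) (n + n) ?f"
        by (rule linmap_pair[OF linmap_smul[OF K \<beta> linmap_comp[OF tl B(1)]] linmap_comp[OF hd B(1)]])
      moreover have "qd (n + n) ?r (?f v) = (p + \<beta> * q) * qd (n + n) ?r v" for v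
        unfolding qd_gsum qd_gscale by (simp add: B p qd_smul algebra_simps)
      ultimately show ?thesis unfolding sim_factor_def c by blast
    qed
  next
    case False
    define d where "d = q / p"
    have d: "d \<in> K" "d \<noteq> 0" using False pq by (auto simp: d_def intro: is_subfieldD[OF K])
    have "sim_factor K n g d" unfolding d_def by (intro sim_factor_divide[OF K] spq pq)
    then obtain C where C: "linmap K n n C" "\<And>v. qd n g (C v) = d * qd n g v"
      unfolding sim_factor_def by blast
    have "sim_factor K n g (p / q)" by (intro sim_factor_divide[OF K] spq pq)
    then obtain E where E: "linmap K n n E" "\<And>v. qd n g (E v) = p / q * qd n g v"
      unfolding sim_factor_def by blast
    have E': "d * qd n g (E v) = qd n g v" for v using False by (simp add: E d_def)
    let ?E = "\<lambda>v. E (tailv n v)"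
    \<comment> \<open>\<open>E\<close> replaces \<open>\<beta> g\<close> by
      \<open>\<beta> d g\<close> on the second half. Then the identity for
      \<open><1, \<beta> d>\<close> is applied, \<open>C\<close> restores the coefficient
      \<open>\<beta>\<close>, and \<open>A\<close> multiplies by \<open>p\<close>.\<close>
    let ?f = "\<lambda>v. appv n (A (v + (- (\<beta> * d)) \<star> ?E v)) (A (C (v + ?E v)))"
    have lE: "linmap K (n + n) n ?E" by (rule linmap_comp[OF tl E(1)])
    have "linmap K (n + n) (n + n) ?f"
    proof (rule linmap_pair)
      show "linmap K (n + n) n (\<lambda>v. A (v + (- (\<beta> * d)) \<star> ?E v))"
        by (intro linmap_comp[OF _ A(1)] linmap_add[OF K hd] linmap_smul[OF K _ lE] is_subfieldD[OF K] \<beta> d)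
      show "linmap K (n + n) n (\<lambda>v. A (C (v + ?E v)))"
        by (intro linmap_comp[OF _ A(1)] linmap_comp[OF _ C(1)] linmap_add[OF K hd lE])
    qed
    moreover have "qd (n + n) ?r (?f v) = (p + \<beta> * q) * qd (n + n) ?r v" for v
    proof -
      let ?P = "qd n g v" and ?Q = "qd n g (?E v)" and ?b = "pol n g v (?E v)"
      have "qd (n + n) ?r (?f v) =
          p * (?P + \<beta> * d * (\<beta> * d) * ?Q - \<beta> * d * ?b) + \<beta> * (p * (d * (?P + ?Q + ?b)))"
        unfolding qd_gsum qd_gscale by (simp add: A C qd_add qd_smul)
      also have "\<dots> = (p + \<beta> * (p * d)) * (?P + \<beta> * (d * ?Q))" by (simp add: algebra_simps)
      also have "p * d = q" using False by (simp add: d_def)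
      finally show ?thesis unfolding qd_gsum qd_gscale by (simp add: E')
    qed
    ultimately show ?thesis unfolding sim_factor_def c by blast
  qed
qed

lemma pf_dim_Suc: "pf_dim (Suc m) = pf_dim m + pf_dim m"
  by simp

lemma ogram_pf:
  assumes K: "is_subfield K" and "\<alpha> \<in> K"
  shows "set \<beta>s \<subseteq> K \<Longrightarrow> ogram K (pf_dim (length \<beta>s)) (pf_gram \<beta>s \<alpha>)"
proof (induction \<beta>s)
  case Nil
  then show ?case using assms by (auto simp: ogram_def norm_gram_def intro: is_subfieldD)
next
  case (Cons \<beta> \<beta>s)
  then show ?case
    unfolding pf_gram.simps length_Cons pf_dim_Suc by (intro ogram_gsum ogram_gscale K) auto
qed

lemma round_pf:
  assumes K: "is_subfield K" and "\<alpha> \<in> K"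
  shows "set \<beta>s \<subseteq> K \<Longrightarrow> round_form K (pf_dim (length \<beta>s)) (pf_gram \<beta>s \<alpha>)"
proof (induction \<beta>s)
  case Nil
  then show ?case using round_norm[OF assms] by simp
next
  case (Cons \<beta> \<beta>s)
  then show ?case
    unfolding pf_gram.simps length_Cons pf_dim_Suc
    by (intro round_double[OF K] ogram_pf[OF assms]) auto
qed

lemma metab_gscale: "metab K D g \<Longrightarrow> metab K D (gscale c g)"
  unfolding metab_def qd_gscale by (metis mult_zero_right)

text \<open>If the smaller form \<open>?g\<close> is anisotropic, an isotropic vector of the larger
  one gives \<open>\<beta> * (q / p) = - 1\<close>. By roundness \<open>q / p\<close> is a
  similarity factor of \<open>?g\<close>, so \<open>?g\<close> maps anti-isometrically to
  \<open>gscale \<beta> ?g\<close>, and the graph is a Lagrangian.\<close>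

lemma isotropic_pf_metab:
  assumes K: "is_subfield K" and \<alpha>: "\<alpha> \<in> K"
  shows "set \<beta>s \<subseteq> K - {0} \<Longrightarrow> isotropic K (pf_dim (length \<beta>s)) (pf_gram \<beta>s \<alpha>) \<Longrightarrow>
    metab K (pf_dim (length \<beta>s)) (pf_gram \<beta>s \<alpha>)"
proof (induction \<beta>s)
  case Nil
  then obtain x k where x: "ovec K 2 x" "k < 2" "x k \<noteq> 0" "qd 2 (norm_gram \<alpha>) x = 0"
    unfolding isotropic_def by auto
  have "metab K 2 (norm_gram \<alpha>)"
  proof (rule metabI[of "{0::nat}" _ _ "\<lambda>_. x"])
    have l: "lincomb {0::nat} c (\<lambda>_. x) = c 0 \<star> x" for c by (auto simp: lincomb_def)
    show "indep K {0::nat} 2 (\<lambda>_. x)"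
      unfolding indep_def l using x(2,3) by auto
    show "qd 2 (norm_gram \<alpha>) (lincomb {0::nat} c (\<lambda>_. x)) = 0" for c
      unfolding l qd_smul using x(4) by simp
  qed (use x(1) in auto)
  then show ?case by simp
next
  case (Cons \<beta> \<beta>s)
  let ?n = "pf_dim (length \<beta>s)" and ?g = "pf_gram \<beta>s \<alpha>"
  let ?r = "gsum ?n ?g (gscale \<beta> ?g)"
  have \<beta>: "\<beta> \<in> K" "\<beta> \<noteq> 0" "set \<beta>s \<subseteq> K" using Cons.prems by auto
  have IH: "metab K (?n + ?n) ?r" if "isotropic K ?n ?g"
    using Cons.IH that Cons.prems(1) by (intro metab_gsum[OF K] metab_gscale) auto
  obtain x k where x: "ovec K (?n + ?n) x" "k < ?n + ?n" "x k \<noteq> 0" "qd (?n + ?n) ?r x = 0"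
    using Cons.prems(2) unfolding pf_gram.simps length_Cons pf_dim_Suc isotropic_def by blast
  define p q where "p = qd ?n ?g x" and "q = qd ?n ?g (tailv ?n x)"
  have xs: "ovec K ?n x" "ovec K ?n (tailv ?n x)" using ovec_less[OF x(1)] ovec_tailv[OF x(1)] .
  have pq: "p + \<beta> * q = 0" using x(4) unfolding qd_gsum qd_gscale by (simp add: p_def q_def)
  have "metab K (?n + ?n) ?r"
  proof (cases "isotropic K ?n ?g")
    case True
    then show ?thesis by (rule IH)
  next
    case False
    then have an: "aniso K ?n ?g" by (simp add: aniso_iff)
    have "p \<noteq> 0"
    proof
      assume p: "p = 0"
      then have "q = 0" using pq \<beta> by simp
      then have "\<forall>i<?n. x i = 0" "\<forall>i<?n. tailv ?n x i = 0"
        using an xs p unfolding aniso_def p_def q_def by blast+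
      then show False using x(2,3) by (cases "k < ?n") (auto simp: tailv_def not_less le_iff_add)
    qed
    have pK: "p \<in> K" unfolding p_def by (rule qd_over[OF K ogram_pf[OF K \<alpha> \<beta>(3)] xs(1)])
    have "sim_factor K ?n ?g p" "sim_factor K ?n ?g q"
      using round_pf[OF K \<alpha> \<beta>(3)] xs unfolding round_form_def p_def q_def by blast+
    then have "sim_factor K ?n ?g (q / p)" by (intro sim_factor_divide[OF K] pK)
    then obtain f where f: "linmap K ?n ?n f" "\<And>v. qd ?n ?g (f v) = q / p * qd ?n ?g v"
      unfolding sim_factor_def by blast
    have "\<beta> * (q / p) = - 1" using pq \<open>p \<noteq> 0\<close> by (simp add: field_simps add_eq_0_iff)
    then have "qd ?n (gscale \<beta> ?g) (f v) = - qd ?n ?g v" for v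
      unfolding qd_gscale f(2) by (simp only: mult.assoc[symmetric]) simp
    then show ?thesis by (intro metab_graph[OF K f(1)])
  qed
  then show ?case by simp
qed

text \<open>Up to sign, \<open>1 - 4 * \<alpha>\<close> is the determinant of the polar form; in
  characteristic 2 it equals 1.\<close>

lemma nonsing_norm:
  assumes K: "is_subfield K" and "1 - 4 * \<alpha> \<noteq> 0" shows "nonsing K 2 (norm_gram \<alpha>)"
  unfolding nonsing_def
proof (intro allI impI)
  fix v i assume v: "\<forall>u. ovec K 2 u \<longrightarrow> pol 2 (norm_gram \<alpha>) v u = 0" and i: "i < (2::nat)"
  have e: "2 * v 0 + v 1 = 0" "v 0 + 2 * \<alpha> * v 1 = 0"
    using v[rule_format, OF ovec_unitv[OF K], of 0] v[rule_format, OF ovec_unitv[OF K], of 1]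
    by (simp_all add: pol_norm unitv_def)
  have "(1 - 4 * \<alpha>) * v 1 = (2 * v 0 + v 1) - 2 * (v 0 + 2 * \<alpha> * v 1)" by (simp add: algebra_simps)
  also have "\<dots> = 0" unfolding e by simp
  finally have "v 1 = 0" using assms(2) by (simp only: mult_eq_0_iff) simp
  moreover from this have "v 0 = 0" using e by simp
  ultimately show "v i = 0" using i by (auto simp: less_2_cases_iff)
qed

lemma nonsing_pf:
  assumes K: "is_subfield K" and "1 - 4 * \<alpha> \<noteq> 0"
  shows "0 \<notin> set \<beta>s \<Longrightarrow> nonsing K (pf_dim (length \<beta>s)) (pf_gram \<beta>s \<alpha>)"
proof (induction \<beta>s)
  case Nil
  then show ?case using nonsing_norm[OF assms] by simp
next
  case (Cons \<beta> \<beta>s)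
  then show ?case
    unfolding pf_gram.simps length_Cons pf_dim_Suc by (intro nonsing_gsum nonsing_gscale K) auto
qed

lemma pf_unit: "qd (pf_dim (length \<beta>s)) (pf_gram \<beta>s \<alpha>) (unitv 0) = 1"
proof (induction \<beta>s)
  case Nil
  show ?case by (simp add: qd_norm unitv_def)
next
  case (Cons \<beta> \<beta>s)
  have "tailv (pf_dim (length \<beta>s)) (unitv 0) = (0 :: nat \<Rightarrow> 'a)"
    by (auto simp: tailv_def unitv_def)
  then show ?case using Cons
    unfolding pf_gram.simps length_Cons pf_dim_Suc qd_gsum by simp
qed

lemma one_less_pf_dim: "Suc 0 < pf_dim m"
  by (induction m) auto

text \<open>For \<open>a = 0\<close> the second basis vector is isotropic, which gives hyperbolic
  Pfister forms with any prescribed number of slots.\<close>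

lemma pf_second: "qd (pf_dim (length \<beta>s)) (pf_gram \<beta>s a) (unitv 1) = a" for \<beta>s :: "'a::field list"
proof (induction \<beta>s)
  case Nil
  show ?case by (simp add: qd_norm unitv_def)
next
  case (Cons \<beta> \<beta>s)
  have "tailv (pf_dim (length \<beta>s)) (unitv 1) = (0 :: nat \<Rightarrow> 'a)"
  proof
    fix j
    have "pf_dim (length \<beta>s) + j \<noteq> 1" using one_less_pf_dim[of "length \<beta>s"] by linarith
    then show "tailv (pf_dim (length \<beta>s)) (unitv 1) j = (0 :: nat \<Rightarrow> 'a) j"
      by (simp add: tailv_def unitv_def)
  qed
  then show ?case using Cons
    unfolding pf_gram.simps length_Cons pf_dim_Suc qd_gsum by simp
qed

section \<open>The Hauptsatz\<close>

lemma isotropic_mono: assumes "isotropic K D g" "K \<subseteq> L" shows "isotropic L D g"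
proof -
  obtain x where "ovec K D x" "\<exists>i<D. x i \<noteq> 0" "qd D g x = 0"
    using assms(1) unfolding isotropic_def by blast
  then show ?thesis unfolding isotropic_def using ovec_mono[OF _ assms(2)] by blast
qed

lemma metab_hyp_sum: "is_subfield K \<Longrightarrow> metab K (2 * k) (hyp_sum k)"
proof (induction k)
  case 0
  then show ?case by (simp add: metab_zero_dim)
next
  case (Suc k)
  have "metab K 2 hyp_gram" by (rule metab_hyp[OF Suc.prems])
  then have "metab K (2 + 2 * k) (gsum 2 hyp_gram (hyp_sum k))"
    using Suc by (intro metab_gsum) auto
  then show ?case by simp
qed

text \<open>The detour through \<open>hyp_sum\<close> replaces the given Lagrangian by one that is
  visibly independent over \<open>L\<close> as well.\<close>

lemma metab_extend:
  assumes "is_subfield K" "is_subfield L" "K \<subseteq> L" "ogram K D g" "nonsing K D g" "metab K D g"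
  shows "metab L D g"
proof -
  obtain k where k: "D = 2 * k" "isom K D (hyp_sum k) g"
    using metab_isom_hyp_sum[OF assms(1,4-6)] by blast
  then show ?thesis
    using isom_metab[OF isom_mono[OF assms(1-3) k(2)]] metab_hyp_sum[OF assms(2), of k] by simp
qed

text \<open>Orthogonal sums of scalar multiples of Pfister forms, given by triples \<open>(c, \<beta>s, \<alpha>)\<close>.\<close>

fun pfs_gram :: "nat \<Rightarrow> ('b::field \<times> 'b list \<times> 'b) list \<Rightarrow> nat \<Rightarrow> nat \<Rightarrow> 'b" where
  "pfs_gram m [] = (\<lambda>_ _. 0)"
| "pfs_gram m ((c, \<beta>s, \<alpha>) # xs) = gsum (pf_dim m) (gscale c (pf_gram \<beta>s \<alpha>)) (pfs_gram m xs)"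

fun pfs_dim :: "nat \<Rightarrow> ('b::field \<times> 'b list \<times> 'b) list \<Rightarrow> nat" where
  "pfs_dim m [] = 0"
| "pfs_dim m (x # xs) = pf_dim m + pfs_dim m xs"

text \<open>\<open>m\<close> counts the bilinear slots, so that the Pfister form itself is
  \<open>(m + 1)\<close>-fold. The last condition is nonsingularity of \<open>[1, \<alpha>]\<close>,
  by \<open>nonsing_norm_iff\<close>.\<close>

definition pf_slots :: "'b::field set \<Rightarrow> nat \<Rightarrow> 'b \<times> 'b list \<times> 'b \<Rightarrow> bool" where
  "pf_slots K m = (\<lambda>(c, \<beta>s, \<alpha>). c \<in> K \<and> c \<noteq> 0 \<and> set \<beta>s \<subseteq> K - {0} \<and> length \<beta>s = m \<and> \<alpha> \<in> K \<and>
     1 - 4 * \<alpha> \<noteq> 0)"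

lemma pfs_gram_props:
  assumes K: "is_subfield K"
  shows "\<forall>x\<in>set xs. pf_slots K m x \<Longrightarrow>
    ogram K (pfs_dim m xs) (pfs_gram m xs) \<and> nonsing K (pfs_dim m xs) (pfs_gram m xs)"
proof (induction xs)
  case Nil
  then show ?case by (simp add: ogram_def nonsing_def)
next
  case (Cons x xs)
  obtain c \<beta>s \<alpha> where x: "x = (c, \<beta>s, \<alpha>)" by (cases x)
  then have c: "c \<in> K" "c \<noteq> 0" "set \<beta>s \<subseteq> K" "0 \<notin> set \<beta>s" "m = length \<beta>s" "\<alpha> \<in> K" "1 - 4 * \<alpha> \<noteq> 0"
    using Cons.prems by (auto simp: pf_slots_def)
  have "ogram K (pf_dim m) (pf_gram \<beta>s \<alpha>)" "nonsing K (pf_dim m) (pf_gram \<beta>s \<alpha>)"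
    unfolding c(5) by (rule ogram_pf[OF K c(6,3)], rule nonsing_pf[OF K c(7,4)])
  then show ?case using Cons c(1,2)
    unfolding x pfs_gram.simps pfs_dim.simps
    by (intro conjI ogram_gsum ogram_gscale nonsing_gsum nonsing_gscale K) auto
qed

text \<open>Over a field where the first summand is hyperbolic it can be cancelled, and the
  induction hypothesis applies to the rest; \<open>generic_splitting\<close> brings the result back
  to \<open>K\<close>. Since the base field grows, nonsingularity of \<open>g\<close> is demanded
  over all larger subfields. At the bound \<open>D = pf_dim m\<close> isotropy of \<open>g\<close>
  is essential: the multiple of a summand could otherwise be \<open>g\<close> itself.\<close>

lemma hauptsatz:
  assumes unc: "uncountable (UNIV :: 'b::field set)"
    and quad: "\<And>t s :: 'b. \<exists>x. x * x = - (t * x + s)"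
    and D: "D \<le> pf_dim m"
  shows "is_subfield (K :: 'b set) \<Longrightarrow> countable K \<Longrightarrow> \<forall>x\<in>set xs. pf_slots K m x \<Longrightarrow> ogram K D g \<Longrightarrow>
    (\<And>L. is_subfield L \<Longrightarrow> K \<subseteq> L \<Longrightarrow> nonsing L D g) \<Longrightarrow> isotropic K D g \<Longrightarrow>
    metab K (pfs_dim m xs + D) (gsum (pfs_dim m xs) (pfs_gram m xs) g) \<Longrightarrow> metab K D g"
proof (induction xs arbitrary: K)
  case Nil
  then show ?case by simp
next
  case (Cons x xs)
  note K = Cons.prems(1) and g = Cons.prems(4) and ns = Cons.prems(5)
  let ?N = "pf_dim m"
  obtain c \<beta>s \<alpha> where x: "x = (c, \<beta>s, \<alpha>)" by (cases x)
  then have c: "c \<in> K" "c \<noteq> 0" "set \<beta>s \<subseteq> K - {0}" "m = length \<beta>s" "\<alpha> \<in> K" "1 - 4 * \<alpha> \<noteq> 0"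
    using Cons.prems(3) by (auto simp: pf_slots_def)
  have nsK: "nonsing K D g" using ns[OF K] by simp
  let ?r = "pf_gram \<beta>s \<alpha>"
  have r: "ogram K ?N ?r" unfolding c(4) using ogram_pf[OF K c(5)] c(3) by auto
  \<comment> \<open>An isotropic \<open>?r\<close> is hyperbolic over \<open>K\<close> already, so
    \<open>L = K\<close>; otherwise its function field is taken. In both cases hyperbolicity of
    \<open>g\<close> descends from \<open>L\<close> to \<open>K\<close>.\<close>
  obtain L where L: "is_subfield L" "countable L" "K \<subseteq> L" "isotropic L ?N ?r"
    "metab L D g \<Longrightarrow> metab K D g"
  proof (cases "isotropic K ?N ?r")
    case True
    then show ?thesis using that[of K] K Cons.prems(2) by blast
  next
    case False
    have "(2::nat) \<le> ?N" by simp
    moreover have "qd ?N ?r (unitv 0) = 1" unfolding c(4) by (rule pf_unit)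
    ultimately show ?thesis
      using generic_splitting[OF K Cons.prems(2) unc quad r _ _ _] False g nsK Cons.prems(6) D that
      unfolding aniso_iff by (metis le_neq_implies_less)
  qed
  have slots: "\<forall>y\<in>set xs. pf_slots L m y"
    using Cons.prems(3) L(3) by (fastforce simp: pf_slots_def)
  have mr: "metab L ?N ?r"
    unfolding c(4) by (rule isotropic_pf_metab[OF L(1)]) (use c L in auto)
  have gK: "ogram K (pfs_dim m (x # xs)) (pfs_gram m (x # xs))"
    "nonsing K (pfs_dim m (x # xs)) (pfs_gram m (x # xs))"
    using pfs_gram_props[OF K Cons.prems(3)] by blast+
  have "metab L (pfs_dim m (x # xs) + D) (gsum (pfs_dim m (x # xs)) (pfs_gram m (x # xs)) g)"
    by (rule metab_extend[OF K L(1,3) ogram_gsum[OF K gK(1) g] nonsing_gsum[OF K gK(2) nsK] Cons.prems(7)])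
  then have tot: "metab L (?N + (pfs_dim m xs + D)) (gsum ?N (gscale c ?r) (gsum (pfs_dim m xs) (pfs_gram m xs) g))"
    by (simp only: x pfs_gram.simps pfs_dim.simps gsum_assoc add.assoc)
  have "ogram L ?N (gscale c ?r)"
    using c(1) L(3) r by (intro ogram_gscale L(1)) (auto intro: ogram_mono)
  moreover have "nonsing L ?N (gscale c ?r)"
    unfolding c(4) by (rule nonsing_gscale[OF c(2) nonsing_pf[OF L(1) c(6)]]) (use c(3) in auto)
  ultimately have "metab L (pfs_dim m xs + D) (gsum (pfs_dim m xs) (pfs_gram m xs) g)"
    using metab_cancel[OF L(1) _ _ metab_gscale[OF mr] tot] by blast
  moreover have "isotropic L D g" by (rule isotropic_mono[OF Cons.prems(6) L(3)])
  moreover have "nonsing L' D g" if "is_subfield L'" "L \<subseteq> L'" for L'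
    using ns[OF that(1)] that(2) L(3) by blast
  ultimately have "metab L D g"
    using Cons.IH[OF L(1,2) slots ogram_mono[OF g L(3)]] by blast
  then show ?case by (rule L(5))
qed

section \<open>Descent to a countable subfield\<close>

lemma is_subfield_prime: "is_subfield (range (\<lambda>(a, b). of_int a / of_int b :: 'b::field))"
  unfolding is_subfield_def
proof (intro conjI ballI)
  let ?P = "range (\<lambda>(a, b). of_int a / of_int b :: 'b)"
  have I: "of_int a / of_int b \<in> ?P" for a b by (rule range_eqI[of _ _ "(a, b)"]) simp
  show "0 \<in> ?P" "1 \<in> ?P" using I[of 0 1] I[of 1 1] by simp_all
  fix x assume "x \<in> ?P"
  then obtain a b where x: "x = of_int a / of_int b" by auto
  show "- x \<in> ?P" using I[of "- a" b] by (simp add: x)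
  show "inverse x \<in> ?P" using I[of b a] by (simp add: x)
  fix y assume "y \<in> ?P"
  then obtain c d where y: "y = of_int c / of_int d" by auto
  show "x * y \<in> ?P" using I[of "a * c" "b * d"] by (simp add: x y)
  show "x + y \<in> ?P"
  proof (cases "of_int b = (0 :: 'b) \<or> of_int d = (0 :: 'b)")
    case True
    \<comment> \<open>In positive characteristic a denominator may vanish in the field; by the
      convention for division the fraction is then 0.\<close>
    then have "x = 0 \<or> y = 0" by (auto simp: x y)
    then show ?thesis using \<open>x \<in> ?P\<close> \<open>y \<in> ?P\<close> by (elim disjE) simp_all
  next
    case False
    then show ?thesis using I[of "a * d + c * b" "b * d"] by (simp add: x y add_frac_eq)
  qed
qed

lemma poly_mem: "is_subfield R \<Longrightarrow> p \<in> polys R \<Longrightarrow> x \<in> R \<Longrightarrow> poly p x \<in> R"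
  by (induction p) (auto simp: polys_def coeff_pCons is_subfieldD split: nat.splits dest: spec[of _ "Suc _"])

text \<open>Starts from the prime field and adjoins one element at a time. The bound
  \<open>R\<close> will be the image of the original field: elements of \<open>K\<close> then have
  preimages, and a Lagrangian over \<open>K\<close> can be pulled back.\<close>

lemma exists_countable_subfield:
  assumes R: "is_subfield (R :: 'b::field set)" and C: "finite C" "C \<subseteq> R"
  shows "\<exists>K. is_subfield K \<and> countable K \<and> C \<subseteq> K \<and> K \<subseteq> R"
  using C
proof (induction)
  case empty
  have "(of_nat k :: 'b) \<in> R" for k by (induction k) (auto simp: is_subfieldD[OF R])
  then have "(of_int a :: 'b) \<in> R" for a
    by (cases a) (auto simp del: of_nat_Suc intro: is_subfieldD[OF R])
  then have "range (\<lambda>(a, b). of_int a / of_int b :: 'b) \<subseteq> R" by (auto intro: is_subfieldD[OF R])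
  then show ?case using is_subfield_prime by (intro exI conjI) auto
next
  case (insert x C)
  then obtain K where K: "is_subfield K" "countable K" "C \<subseteq> K" "K \<subseteq> R" by auto
  have "adjoin K x \<subseteq> R"
  proof
    fix y assume "y \<in> adjoin K x"
    then obtain p q where y: "p \<in> polys K" "q \<in> polys K" "y = poly p x / poly q x"
      unfolding adjoin_def by blast
    then have "p \<in> polys R" "q \<in> polys R" using K(4) by (auto simp: polys_def)
    then show "y \<in> R" unfolding y(3) using insert.prems by (intro is_subfieldD(8)[OF R] poly_mem[OF R]) auto
  qed
  then show ?case
    using is_subfield_adjoin[OF K(1)] countable_adjoin[OF K(2)] adjoin_subset[OF K(1), of x] mem_adjoin[OF K(1), of x] K(3)
    by (intro exI[of _ "adjoin K x"]) auto
qed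

section \<open>Transport of forms along a field embedding\<close>

locale embedding =
  fixes \<iota> :: "'a::field \<Rightarrow> 'b::field"
  assumes add: "\<iota> (x + y) = \<iota> x + \<iota> y" and mult: "\<iota> (x * y) = \<iota> x * \<iota> y" and one: "\<iota> 1 = 1"
begin

lemma zero: "\<iota> 0 = 0"
proof -
  have "\<iota> 0 + \<iota> 0 = \<iota> 0 + 0" using add[of 0 0] by simp
  then show ?thesis by (simp only: add_left_cancel)
qed

lemma minus: "\<iota> (- x) = - \<iota> x"
  using add[of x "- x"] by (simp add: zero eq_neg_iff_add_eq_0 add.commute)

lemma eq_0_iff: "\<iota> x = 0 \<longleftrightarrow> x = 0"
proof
  assume "\<iota> x = 0"
  then show "x = 0" using mult[of x "inverse x"] one by (cases "x = 0") auto
qed (simp add: zero)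

lemma diff: "\<iota> (x - y) = \<iota> x - \<iota> y" using add[of x "- y"] by (simp add: minus)

lemma inverse: "\<iota> (inverse x) = inverse (\<iota> x)"
  using mult[of x "inverse x"] one by (cases "x = 0") (auto simp: zero field_simps eq_0_iff)

lemma sum: "\<iota> (sum f I) = (\<Sum>i\<in>I. \<iota> (f i))"
  by (induction I rule: infinite_finite_induct) (auto simp: zero add)

lemma is_subfield_range: "is_subfield (range \<iota>)"
  unfolding is_subfield_def
  by (auto simp: zero[symmetric] one[symmetric] add[symmetric] mult[symmetric] minus[symmetric] inverse[symmetric])

definition gmap :: "(nat \<Rightarrow> nat \<Rightarrow> 'a) \<Rightarrow> nat \<Rightarrow> nat \<Rightarrow> 'b" where
  "gmap g = (\<lambda>i j. \<iota> (g i j))"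

lemma qd_gmap: "qd D (gmap g) (\<lambda>i. \<iota> (v i)) = \<iota> (qd D g v)"
  by (simp add: qd_def bil_def gmap_def sum mult)

lemma lincomb_map: "lincomb I (\<lambda>i. \<iota> (c i)) (\<lambda>i j. \<iota> (w i j)) = (\<lambda>j. \<iota> (lincomb I c w j))"
  by (simp add: lincomb_def sum mult)

lemma gmap_gsum: "gmap (gsum m g h) = gsum m (gmap g) (gmap h)"
  by (auto simp: gmap_def gsum_def zero fun_eq_iff)

lemma gmap_gscale: "gmap (gscale c g) = gscale (\<iota> c) (gmap g)"
  by (auto simp: gmap_def gscale_def mult fun_eq_iff)

lemma gmap_pf: "gmap (pf_gram \<beta>s \<alpha>) = pf_gram (map \<iota> \<beta>s) (\<iota> \<alpha>)"
proof (induction \<beta>s)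
  case Nil
  show ?case by (auto simp: gmap_def norm_gram_def one zero fun_eq_iff)
next
  case (Cons \<beta> \<beta>s)
  then show ?case by (simp add: gmap_gsum gmap_gscale)
qed

definition slots_map :: "'a \<times> 'a list \<times> 'a \<Rightarrow> 'b \<times> 'b list \<times> 'b" where
  "slots_map = (\<lambda>(c, \<beta>s, \<alpha>). (\<iota> c, map \<iota> \<beta>s, \<iota> \<alpha>))"

lemma gmap_pfs: "gmap (pfs_gram m xs) = pfs_gram m (map slots_map xs)"
proof (induction xs)
  case Nil
  show ?case by (simp add: gmap_def zero)
next
  case (Cons x xs)
  obtain c \<beta>s \<alpha> where "x = (c, \<beta>s, \<alpha>)" by (cases x)
  then show ?case using Cons by (simp add: gmap_gsum gmap_gscale gmap_pf slots_map_def)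
qed

lemma pfs_dim_map: "pfs_dim m (map slots_map xs) = pfs_dim m xs"
  by (induction xs) auto

fun slots_set :: "'a \<times> 'a list \<times> 'a \<Rightarrow> 'b set" where
  "slots_set (c, \<beta>s, \<alpha>) = {\<iota> c, \<iota> \<alpha>} \<union> \<iota> ` set \<beta>s"

lemma pf_slots_map:
  assumes "pf_slots UNIV m x" "slots_set x \<subseteq> K" shows "pf_slots K m (slots_map x)"
proof -
  obtain c \<beta>s \<alpha> where x: "x = (c, \<beta>s, \<alpha>)" by (cases x)
  \<comment> \<open>The numeral is unfolded into a sum of ones, which is what the axioms of the
    embedding speak about.\<close>
  have "\<iota> (1 - (1 + 1 + 1 + 1) * \<alpha>) = 1 - (1 + 1 + 1 + 1) * \<iota> \<alpha>"
    by (simp only: diff mult add one)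
  then have "\<iota> (1 - 4 * \<alpha>) = 1 - 4 * \<iota> \<alpha>" by simp
  then show ?thesis using assms eq_0_iff[of "1 - 4 * \<alpha>"]
    by (auto simp: x pf_slots_def slots_map_def eq_0_iff)
qed

text \<open>\<open>K\<close> is generated by \<open>C\<close> and the finitely many entries of a
  Lagrangian. As it stays inside the range of \<open>\<iota>\<close>, coefficients from
  \<open>K\<close> have preimages, and independence is inherited from the original field.\<close>

lemma metab_descend:
  assumes m: "metab UNIV D g" and C: "finite C" "C \<subseteq> range \<iota>"
  shows "\<exists>K. is_subfield K \<and> countable K \<and> C \<subseteq> K \<and> K \<subseteq> range \<iota> \<and> metab K D (gmap g)"
proof -
  obtain I w where w: "finite (I::nat set)" "D = 2 * card I" "indep UNIV I D w"
     "\<forall>c. qd D g (lincomb I c w) = 0"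
    using m unfolding metab_def by auto
  let ?W = "(\<lambda>(i, j). \<iota> (w i j)) ` (I \<times> {..<D})"
  have fin: "finite (C \<union> ?W)" "C \<union> ?W \<subseteq> range \<iota>" using C w(1) by auto
  obtain K where K: "is_subfield K" "countable K" "C \<union> ?W \<subseteq> K" "K \<subseteq> range \<iota>"
    using exists_countable_subfield[OF is_subfield_range fin] by blast
  have pull: "\<exists>d. \<forall>i\<in>I. c i = \<iota> (d i)" if "\<forall>i\<in>I. c i \<in> K" for c :: "nat \<Rightarrow> 'b"
    by (rule bchoice) (use that K(4) in blast)
  have lc: "lincomb I c (\<lambda>i j. \<iota> (w i j)) = (\<lambda>j. \<iota> (lincomb I d w j))" if "\<forall>i\<in>I. c i = \<iota> (d i)" for c d
    unfolding lincomb_map[symmetric] using that by (simp add: lincomb_def)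
  have "metab K D (gmap g)"
  proof (rule metabI[of I _ _ "\<lambda>i j. \<iota> (w i j)"])
    show "ovec K D (\<lambda>j. \<iota> (w i j))" if "i \<in> I" for i
      using K(3) that by (auto simp: ovec_def)
    show "indep K I D (\<lambda>i j. \<iota> (w i j))"
      unfolding indep_def
    proof (intro allI impI)
      fix c assume c: "\<forall>i\<in>I. c i \<in> K" "\<forall>j<D. lincomb I c (\<lambda>i j. \<iota> (w i j)) j = 0"
      obtain d where d: "\<forall>i\<in>I. c i = \<iota> (d i)" using pull[OF c(1)] by blast
      have "\<forall>j<D. lincomb I d w j = 0" using c(2) unfolding lc[OF d] by (simp add: eq_0_iff)
      then have "\<forall>i\<in>I. d i = 0" using w(3) unfolding indep_def by simp
      then show "\<forall>i\<in>I. c i = 0" using d by (simp add: zero)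
    qed
    fix c assume "\<And>i. i \<in> I \<Longrightarrow> c i \<in> K"
    then obtain d where d: "\<forall>i\<in>I. c i = \<iota> (d i)" using pull by blast
    show "qd D (gmap g) (lincomb I c (\<lambda>i j. \<iota> (w i j))) = 0"
      unfolding lc[OF d] qd_gmap using w(4) by (simp add: zero)
  qed (use w in auto)
  then show ?thesis using K by blast
qed

lemma metab_pull_back:
  assumes m: "metab (range \<iota>) D (gmap g)" shows "metab UNIV D g"
proof -
  obtain I w where w: "finite (I::nat set)" "D = 2 * card I" "\<forall>i\<in>I. ovec (range \<iota>) D (w i)"
     "indep (range \<iota>) I D w" "\<forall>c. (\<forall>i\<in>I. c i \<in> range \<iota>) \<longrightarrow> qd D (gmap g) (lincomb I c w) = 0"
    using m unfolding metab_def by blast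
  have "\<forall>i. \<forall>j. \<exists>a. i \<in> I \<longrightarrow> j < D \<longrightarrow> w i j = \<iota> a"
    using w(3) unfolding ovec_def by blast
  then obtain z where z: "\<And>i j. i \<in> I \<Longrightarrow> j < D \<Longrightarrow> w i j = \<iota> (z i j)" by metis
  have lc: "lincomb I (\<lambda>i. \<iota> (c i)) w j = \<iota> (lincomb I c z j)" if "j < D" for c j
    using z that by (simp add: lincomb_def sum mult)
  show ?thesis
  proof (rule metabI[of I _ _ z])
    show "indep UNIV I D z"
      unfolding indep_def
    proof (intro allI impI)
      fix c assume "\<forall>j<D. lincomb I c z j = 0"
      then have 0: "\<forall>j<D. lincomb I (\<lambda>i. \<iota> (c i)) w j = 0"
        using lc zero by simp
      have r: "\<forall>i\<in>I. \<iota> (c i) \<in> range \<iota>" by blast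
      have "\<forall>i\<in>I. \<iota> (c i) = 0"
        by (rule w(4)[unfolded indep_def, THEN spec, THEN mp, OF r, THEN mp, OF 0])
      then show "\<forall>i\<in>I. c i = 0" by (simp add: eq_0_iff)
    qed
    fix c :: "nat \<Rightarrow> 'a"
    have "\<iota> (qd D g (lincomb I c z)) = qd D (gmap g) (lincomb I (\<lambda>i. \<iota> (c i)) w)"
      unfolding qd_gmap[symmetric] by (rule qd_cong) (simp add: lc)
    also have "\<dots> = 0" by (rule w(5)[THEN spec, THEN mp]) blast
    finally show "qd D g (lincomb I c z) = 0" by (simp add: eq_0_iff)
  qed (use w in \<open>auto simp: ovec_def\<close>)
qed

end

lemma uncountable_fls: "uncountable (UNIV :: 'a::zero_neq_one fls set)"
proof
  assume c: "countable (UNIV :: 'a fls set)"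
  define h :: "nat set \<Rightarrow> 'a fls" where "h A = fps_to_fls (Abs_fps (\<lambda>n. if n \<in> A then 1 else 0))" for A
  have "inj h"
  proof (rule injI)
    fix A B assume "h A = h B"
    then have eq: "Abs_fps (\<lambda>n. if n \<in> A then 1 else 0 :: 'a) = Abs_fps (\<lambda>n. if n \<in> B then 1 else 0)"
      unfolding h_def by (rule fps_to_fls_eq_imp_fps_eq)
    have "n \<in> A \<longleftrightarrow> n \<in> B" for n
      using arg_cong[OF eq, of "\<lambda>f. fps_nth f n"] by (cases "n \<in> A"; cases "n \<in> B") simp_all
    then show "A = B" by blast
  qed
  then have "countable (UNIV :: nat set set)"
    by (rule countable_image_inj_on[OF countable_subset[OF subset_UNIV c]])
  then have "range (from_nat_into (UNIV :: nat set set)) = Pow UNIV"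
    using range_from_nat_into[of "UNIV :: nat set set"] by simp
  then show False using Cantors_theorem by blast
qed

text \<open>The ambient field is the algebraic closure of the field of Laurent series over the given
  field. It is uncountable even if the given field is finite, and it contains a root of every
  quadratic equation.\<close>

interpretation fls_closure: embedding "\<lambda>x::'a::field. to_ac (fls_const x)"
  by unfold_locales (simp_all add: fls_plus_const[symmetric] del: fls_const_mult_const add: fls_const_mult_const[symmetric])

lemma uncountable_fls_closure: "uncountable (UNIV :: 'a::field fls alg_closure set)"
proof
  assume "countable (UNIV :: 'a fls alg_closure set)"
  then have "countable (range (to_ac :: 'a fls \<Rightarrow> _))" using countable_subset subset_UNIV by blast
  then show False using countable_image_inj_on[OF _ inj_to_ac] uncountable_fls by blast
qed

lemma exists_quadratic_root: "\<exists>x. x * x = - (t * x + s)" for t s :: "'b::alg_closed_field"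
proof -
  obtain x where "poly [:s, t, 1:] x = 0"
    using alg_closed_imp_poly_has_root[of "[:s, t, 1:]"] by auto
  then have "x * x = - (t * x + s)" by (simp add: algebra_simps eq_neg_iff_add_eq_0)
  then show ?thesis by blast
qed

text \<open>Only the finitely many entries of the data matter, so the countable case suffices: any field
  embeds into an uncountable algebraically closed one.\<close>

lemma pfister_hauptsatz:
  fixes xs :: "('a::field \<times> 'a list \<times> 'a) list"
  assumes xs: "\<forall>x\<in>set xs. pf_slots UNIV (Suc m) x"
    and y: "pf_slots UNIV m (1, \<beta>s, \<alpha>)" "pf_slots UNIV m (- 1, \<beta>s', \<alpha>')"
  defines "ys \<equiv> [(1, \<beta>s, \<alpha>), (- 1, \<beta>s', \<alpha>')]"
  assumes met: "metab UNIV (pfs_dim (Suc m) xs + pfs_dim m ys)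
    (gsum (pfs_dim (Suc m) xs) (pfs_gram (Suc m) xs) (pfs_gram m ys))"
  shows "metab UNIV (pfs_dim m ys) (pfs_gram m ys)"
proof -
  let ?\<iota> = "\<lambda>x::'a. to_ac (fls_const x)"
  let ?D = "pfs_dim m ys" and ?g = "pfs_gram m (map fls_closure.slots_map ys)"
  let ?xs = "map fls_closure.slots_map xs"
  define C where "C = (\<Union>x\<in>set xs \<union> set ys. fls_closure.slots_set x)"
  have "finite (fls_closure.slots_set x)" "fls_closure.slots_set x \<subseteq> range ?\<iota>" for x :: "'a \<times> 'a list \<times> 'a"
    by (cases x; auto)+
  then have C: "finite C" "C \<subseteq> range ?\<iota>" unfolding C_def by auto
  obtain K where K: "is_subfield K" "countable K" "C \<subseteq> K" "K \<subseteq> range ?\<iota>"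
    "metab K (pfs_dim (Suc m) xs + ?D) (fls_closure.gmap (gsum (pfs_dim (Suc m) xs) (pfs_gram (Suc m) xs) (pfs_gram m ys)))"
    using fls_closure.metab_descend[OF met C] by blast
  have met': "metab K (pfs_dim (Suc m) ?xs + ?D) (gsum (pfs_dim (Suc m) ?xs) (pfs_gram (Suc m) ?xs) ?g)"
    using K(5) by (simp only: fls_closure.gmap_gsum fls_closure.gmap_pfs fls_closure.pfs_dim_map)
  have xs': "\<forall>x\<in>set ?xs. pf_slots K (Suc m) x"
    using xs K(3) by (auto simp: C_def intro!: fls_closure.pf_slots_map)
  have ysU: "\<forall>x\<in>set ys. pf_slots UNIV m x" using y by (auto simp: ys_def)
  have ysK: "\<forall>x\<in>set (map fls_closure.slots_map ys). pf_slots L m x" if "K \<subseteq> L" for L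
    using ysU K(3) that by (auto simp: C_def intro!: fls_closure.pf_slots_map)
  note gp = pfs_gram_props[OF _ ysK, unfolded fls_closure.pfs_dim_map]
  have D: "?D = pf_dim (Suc m)" by (simp add: ys_def)
  have m: "length \<beta>s = m" "length \<beta>s' = m" using y by (auto simp: pf_slots_def)
  \<comment> \<open>The sum of the vectors at which the two Pfister forms take the value 1: it is
    isotropic for their difference. The dimension of that difference is exactly the bound allowed by
    \<open>hauptsatz\<close>.\<close>
  define p where "p = unitv 0 + (unitv (pf_dim m) :: nat \<Rightarrow> 'a fls alg_closure)"
  have "isotropic K ?D ?g"
    unfolding isotropic_def
  proof (intro exI[of _ p] conjI)
    show "ovec K ?D p" unfolding p_def by (intro ovec_add ovec_unitv K)
    show "\<exists>i<?D. p i \<noteq> 0" unfolding D by (intro exI[of _ 0]) (simp add: p_def unitv_def)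
    let ?r = "\<lambda>\<beta>s \<alpha>. pf_gram (map ?\<iota> \<beta>s) (?\<iota> \<alpha>)"
    have g: "?g = gsum (pf_dim m) (gscale 1 (?r \<beta>s \<alpha>)) (gsum (pf_dim m) (gscale (- 1) (?r \<beta>s' \<alpha>')) (\<lambda>_ _. 0))"
      by (simp add: ys_def fls_closure.slots_map_def)
    have d: "?D = pf_dim m + (pf_dim m + 0)" by (simp add: ys_def)
    have "qd (pf_dim m) (?r \<beta>s \<alpha>) p = qd (pf_dim m) (?r \<beta>s \<alpha>) (unitv 0)"
      "qd (pf_dim m) (?r \<beta>s' \<alpha>') (tailv (pf_dim m) p) = qd (pf_dim m) (?r \<beta>s' \<alpha>') (unitv 0)"
      by (intro qd_cong; auto simp: p_def unitv_def tailv_def)+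
    then show "qd ?D ?g p = 0"
      unfolding g d qd_gsum qd_gscale
      using pf_unit[of "map ?\<iota> \<beta>s"] pf_unit[of "map ?\<iota> \<beta>s'"] by (simp add: m qd_def bil_def[of 0])
  qed
  then have "metab K ?D ?g"
    using hauptsatz[OF uncountable_fls_closure exists_quadratic_root _ K(1,2) xs' _ _ _ met'] gp K(1) D
    by auto
  then have "metab (range ?\<iota>) ?D ?g"
    using metab_extend[OF K(1) fls_closure.is_subfield_range K(4)] gp[OF K(1)] by blast
  then have "metab (range ?\<iota>) ?D (fls_closure.gmap (pfs_gram m ys))"
    by (simp only: fls_closure.gmap_pfs)
  then show ?thesis by (rule fls_closure.metab_pull_back)
qed

section \<open>Quadratic forms and their Gram matrices\<close>

no_notation fps_nth (infixl \<open>$\<close> 75)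

definition mkq :: "nat \<Rightarrow> (nat \<Rightarrow> nat \<Rightarrow> 'a::field) \<Rightarrow> 'a qform" where
  "mkq D g = QForm D (\<lambda>v\<in>carrier_vec D. qd D g (($) v))"

lemma qdim_mkq [simp]: "qdim (mkq D g) = D"
  by (simp add: mkq_def)

lemma qval_mkq: "v \<in> carrier_vec D \<Longrightarrow> qval (mkq D g) v = qd D g (($) v)"
  by (simp add: mkq_def)

lemma qform_eqI:
  assumes "is_qform q" "qdim q = D" "\<And>v. v \<in> carrier_vec D \<Longrightarrow> qval q v = qd D g (($) v)"
  shows "q = mkq D g"
proof -
  have "qval q = (\<lambda>v\<in>carrier_vec D. qd D g (($) v))"
    using assms by (intro extensionalityI[of _ "carrier_vec D"]) (auto simp: is_qform_def)
  then show ?thesis using assms(2) by (cases q) (simp add: mkq_def)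
qed

lemma polar_mkq:
  assumes "u \<in> carrier_vec D" "v \<in> carrier_vec D"
  shows "polar (mkq D g) u v = pol D g (($) u) (($) v)"
proof -
  have "qd D g (($) (u + v)) = qd D g (($) u + ($) v)"
    using assms by (intro qd_cong) auto
  then show ?thesis using assms by (simp add: polar_def qval_mkq qd_add)
qed

lemma is_qform_mkq: "is_qform (mkq D g)"
  unfolding is_qform_def qdim_mkq
proof (intro conjI allI ballI)
  show "qval (mkq D g) \<in> extensional (carrier_vec D)" by (simp add: mkq_def)
  fix c and v :: "'a vec" assume v: "v \<in> carrier_vec D"
  have "qd D g (($) (c \<cdot>\<^sub>v v)) = qd D g (c \<star> ($) v)" using v by (intro qd_cong) auto
  then show "qval (mkq D g) (c \<cdot>\<^sub>v v) = c\<^sup>2 * qval (mkq D g) v"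
    using v by (simp add: qval_mkq qd_smul power2_eq_square)
next
  fix u v w :: "'a vec" assume *: "u \<in> carrier_vec D" "v \<in> carrier_vec D" "w \<in> carrier_vec D"
  have "pol D g (($) (u + v)) (($) w) = pol D g (($) u + ($) v) (($) w)"
    using * by (intro pol_cong) auto
  then show "polar (mkq D g) (u + v) w = polar (mkq D g) u w + polar (mkq D g) v w"
    using * by (simp add: polar_mkq)
next
  fix c and u v :: "'a vec" assume *: "u \<in> carrier_vec D" "v \<in> carrier_vec D"
  have "pol D g (($) (c \<cdot>\<^sub>v u)) (($) v) = pol D g (c \<star> ($) u) (($) v)"
    using * by (intro pol_cong) auto
  then show "polar (mkq D g) (c \<cdot>\<^sub>v u) v = c * polar (mkq D g) u v"
    using * by (simp add: polar_mkq)
qed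

text \<open>Takes the upper triangular matrix with the values on the diagonal and the polar values
  above it, which is available in characteristic 2 as well. The value at \<open>v\<close> is built
  up along the truncations \<open>t k\<close> of \<open>v\<close>.\<close>

lemma qform_eq_mkq:
  assumes q: "is_qform q"
  obtains g where "q = mkq (qdim q) g"
proof -
  define n where "n = qdim q"
  define e :: "nat \<Rightarrow> 'a vec" where "e i = unit_vec n i" for i
  have e: "e i \<in> carrier_vec n" for i by (simp add: e_def)
  define g where "g i j = (if i = j then qval q (e i) else if i < j then polar q (e i) (e j) else 0)" for i j
  have sq: "qval q (c \<cdot>\<^sub>v v) = c * c * qval q v" if "v \<in> carrier_vec n" for c v
    using q that by (simp add: is_qform_def n_def power2_eq_square)
  have pa: "polar q (u + v) w = polar q u w + polar q v w"
    if "u \<in> carrier_vec n" "v \<in> carrier_vec n" "w \<in> carrier_vec n" for u v w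
    using q that by (simp add: is_qform_def n_def)
  have ps: "polar q (c \<cdot>\<^sub>v u) v = c * polar q u v"
    if "u \<in> carrier_vec n" "v \<in> carrier_vec n" for c u v
    using q that by (simp add: is_qform_def n_def)
  have psym: "polar q u v = polar q v u" if "u \<in> carrier_vec n" "v \<in> carrier_vec n" for u v
    using that by (simp add: polar_def comm_add_vec[of u n v])
  have "qval q v = qd n g (($) v)" if v: "v \<in> carrier_vec n" for v
  proof -
    define t where "t k = vec n (\<lambda>i. if i < k then v $ i else 0)" for k
    have t: "t k \<in> carrier_vec n" for k by (simp add: t_def)
    have t0: "t 0 = 0 \<cdot>\<^sub>v 0\<^sub>v n" by (intro eq_vecI) (auto simp: t_def)
    have tS: "t (Suc k) = t k + v $ k \<cdot>\<^sub>v e k" if "k < n" for k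
      using that v by (intro eq_vecI) (auto simp: t_def e_def less_Suc_eq)
    have pt: "polar q (t k) w = (\<Sum>i<k. v $ i * polar q (e i) w)" if "k \<le> n" "w \<in> carrier_vec n" for k w
      using that(1)
    proof (induction k)
      case 0
      then show ?case unfolding t0 using that by (simp add: ps)
    next
      case (Suc k)
      then show ?case using that t e by (simp add: tS pa ps)
    qed
    have "qval q (t k) = qd k g (($) v)" if "k \<le> n" for k
      using that
    proof (induction k)
      case 0
      then show ?case unfolding t0 by (simp add: sq qd_def bil_def)
    next
      case (Suc k)
      have gkk: "g k k = qval q (e k)" by (simp add: g_def)
      have "qval q (t (Suc k)) = qval q (t k) + qval q (v $ k \<cdot>\<^sub>v e k) + polar q (t k) (v $ k \<cdot>\<^sub>v e k)"
        using Suc.prems by (simp add: tS polar_def)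
      also have "polar q (t k) (v $ k \<cdot>\<^sub>v e k) = v $ k * polar q (t k) (e k)"
        using psym[OF t, of "v $ k \<cdot>\<^sub>v e k" k] psym[OF t e, of k k] e t by (simp add: ps)
      also have "polar q (t k) (e k) = (\<Sum>i<k. v $ i * polar q (e i) (e k))"
        using Suc.prems e by (intro pt) auto
      also have "(\<Sum>i<k. v $ i * polar q (e i) (e k)) = (\<Sum>i<k. g i k * v $ i)"
        by (intro sum.cong) (auto simp: g_def)
      finally have "qval q (t (Suc k)) = qd k g (($) v) + g k k * v $ k * v $ k + (\<Sum>i<k. g i k * v $ i * v $ k)"
        using Suc sq[OF e, of "v $ k" k] gkk by (simp add: sum_distrib_left mult_ac)
      moreover have "(\<Sum>j<k. g k j * v $ k * v $ j) = 0"
        by (intro sum.neutral) (auto simp: g_def)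
      ultimately show ?case by (simp add: qd_def bil_def sum.distrib algebra_simps)
    qed
    from this[of n] have "qval q (t n) = qd n g (($) v)" by simp
    moreover have "t n = v" using v by (intro eq_vecI) (auto simp: t_def)
    ultimately show ?thesis by simp
  qed
  then have "q = mkq n g" by (intro qform_eqI q) (simp_all add: n_def)
  then show ?thesis by (intro that[of g]) (simp add: n_def)
qed

lemma binary_form_mkq: "binary_form 1 \<alpha> = mkq 2 (norm_gram \<alpha>)"
  unfolding binary_form_def mkq_def by (simp add: qd_norm power2_eq_square mult.assoc)

lemma hyperbolic_plane_mkq: "binary_form 0 0 = mkq 2 hyp_gram"
  unfolding binary_form_def mkq_def by (simp add: qd_hyp)

lemma qscale_mkq: "qscale c (mkq D g) = mkq D (gscale c g)"
  unfolding qscale_def by (auto simp: mkq_def qd_gscale fun_eq_iff restrict_def)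

lemma orth_sum_mkq: "orth_sum (mkq D g) (mkq D' g') = mkq (D + D') (gsum D g g')"
proof -
  have "qval (mkq D g) (vec_first v D) + qval (mkq D' g') (vec_last v D') = qd (D + D') (gsum D g g') (($) v)"
    if v: "v \<in> carrier_vec (D + D')" for v
  proof -
    have "qd D g (($) (vec_first v D)) = qd D g (($) v)"
      using v by (intro qd_cong) (simp add: vec_first_def)
    moreover have "qd D' g' (($) (vec_last v D')) = qd D' g' (tailv D (($) v))"
      using v by (intro qd_cong) (auto simp: vec_last_def tailv_def)
    ultimately show ?thesis by (simp add: qval_mkq qd_gsum)
  qed
  then show ?thesis unfolding orth_sum_def by (simp add: mkq_def cong: restrict_cong)
qed

lemma zero_form_mkq: "zero_form = mkq 0 g"
  unfolding zero_form_def mkq_def by (simp add: qd_def bil_def)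

lemma hyperbolic_mkq: "hyperbolic k = mkq (2 * k) (hyp_sum k)"
proof (induction k)
  case 0
  show ?case by (simp add: zero_form_mkq[of "hyp_sum 0"])
next
  case (Suc k)
  then show ?case by (simp add: hyperbolic_plane_mkq orth_sum_mkq)
qed

lemma nonsingular_mkq: "nonsingular (mkq D g) \<longleftrightarrow> nonsing UNIV D g"
proof
  assume ns: "nonsingular (mkq D g)"
  show "nonsing UNIV D g"
    unfolding nonsing_def
  proof (intro allI impI)
    fix v :: "nat \<Rightarrow> 'a" and i assume v: "\<forall>u. ovec UNIV D u \<longrightarrow> pol D g v u = 0" and i: "i < D"
    have "polar (mkq D g) (vec D v) w = 0" if "w \<in> carrier_vec D" for w
    proof -
      have "polar (mkq D g) (vec D v) w = pol D g v (($) w)"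
        using that by (subst polar_mkq) (auto intro!: pol_cong)
      then show ?thesis using v by (simp add: ovec_def)
    qed
    then have "vec D v = 0\<^sub>v D" using ns by (auto simp: nonsingular_def)
    then have "vec D v $ i = 0\<^sub>v D $ i" by simp
    then show "v i = 0" using i by simp
  qed
next
  assume ns: "nonsing UNIV D g"
  show "nonsingular (mkq D g)"
    unfolding nonsingular_def qdim_mkq
  proof (intro ballI impI)
    fix v assume v: "v \<in> carrier_vec D" "\<forall>w\<in>carrier_vec D. polar (mkq D g) v w = 0"
    have "pol D g (($) v) u = 0" for u
    proof -
      have "pol D g (($) v) u = pol D g (($) v) (($) (vec D u))" by (intro pol_cong) auto
      also have "\<dots> = polar (mkq D g) v (vec D u)" using v(1) by (simp add: polar_mkq)
      finally show ?thesis using v(2) by simp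
    qed
    then have "\<forall>i<D. v $ i = 0" using ns by (simp add: nonsing_def ovec_def)
    then show "v = 0\<^sub>v D" using v(1) by (intro eq_vecI) auto
  qed
qed

definition mat_app :: "nat \<Rightarrow> 'a::field mat \<Rightarrow> (nat \<Rightarrow> 'a) \<Rightarrow> nat \<Rightarrow> 'a" where
  "mat_app D P u = lincomb {..<D} u (\<lambda>j i. P $$ (i, j))"

lemma linmap_mat_app: "linmap UNIV D D' (mat_app D P)"
  unfolding mat_app_def by (rule linmap_coords[OF is_subfield_UNIV]) (simp add: ovec_def)

lemma mat_app_mult: "P \<in> carrier_mat D D \<Longrightarrow> i < D \<Longrightarrow> mat_app D P u i = (P *\<^sub>v vec D u) $ i"
  by (simp add: mat_app_def lincomb_def scalar_prod_def mult.commute atLeast0LessThan)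

lemma vec_mat_app: "P \<in> carrier_mat D D \<Longrightarrow> vec D (mat_app D P u) = P *\<^sub>v vec D u"
  by (intro eq_vecI) (auto simp: mat_app_mult)

lemma isometric_mkq: "isometric (mkq D g) (mkq D' g') \<longleftrightarrow> D = D' \<and> isom UNIV D g g'"
proof
  assume "isometric (mkq D g) (mkq D' g')"
  then obtain P where D: "D = D'" and P: "P \<in> carrier_mat D D" "invertible_mat P"
    "\<forall>v\<in>carrier_vec D. qval (mkq D g') (P *\<^sub>v v) = qval (mkq D g) v"
    by (auto simp: isometric_def)
  obtain B where B0: "P * B = 1\<^sub>m D" "B * P = 1\<^sub>m (dim_row B)"
    using P(1,2) by (auto simp: invertible_mat_def inverts_mat_def)
  have "dim_col B = D" using B0(1) by (metis index_mult_mat(3) index_one_mat(3))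
  moreover have dr: "dim_row B = D" using B0(2) P(1) by (metis carrier_matD(2) index_mult_mat(3) index_one_mat(3))
  ultimately have B: "B \<in> carrier_mat D D" "B * P = 1\<^sub>m D" using B0(2) by auto
  have inv: "mat_app D M1 (mat_app D M2 v) i = v i"
    if "M1 \<in> carrier_mat D D" "M2 \<in> carrier_mat D D" "M1 * M2 = 1\<^sub>m D" "i < D" for M1 M2 v i
  proof -
    have "mat_app D M1 (mat_app D M2 v) i = (M1 *\<^sub>v (M2 *\<^sub>v vec D v)) $ i"
      using that by (simp add: mat_app_mult vec_mat_app)
    also have "M1 *\<^sub>v (M2 *\<^sub>v vec D v) = (M1 * M2) *\<^sub>v vec D v"
      using that by (intro assoc_mult_mat_vec[symmetric]) auto
    finally show ?thesis using that by simp
  qed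
  have "isom UNIV D g g'"
  proof (rule isomI[OF linmap_mat_app[of D D P] linmap_mat_app[of D D B]])
    fix v :: "nat \<Rightarrow> 'a"
    have "qd D g' (mat_app D P v) = qd D g' (($) (P *\<^sub>v vec D v))"
      by (intro qd_cong) (simp add: mat_app_mult[OF P(1)])
    also have "\<dots> = qval (mkq D g') (P *\<^sub>v vec D v)" using P(1) by (simp add: qval_mkq)
    also have "\<dots> = qd D g (($) (vec D v))" using P(3) by (simp add: qval_mkq)
    also have "\<dots> = qd D g v" by (intro qd_cong) simp
    finally show "qd D g' (mat_app D P v) = qd D g v" .
  qed (use inv P(1) B B0 in auto)
  then show "D = D' \<and> isom UNIV D g g'" using D by simp
next
  assume *: "D = D' \<and> isom UNIV D g g'"
  then obtain f h where f: "linmap UNIV D D f" "linmap UNIV D D h" "\<And>v i. i < D \<Longrightarrow> h (f v) i = v i"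
    "\<And>v i. i < D \<Longrightarrow> f (h v) i = v i" "\<And>v. qd D g' (f v) = qd D g v"
    using isomE[OF conjunct2[OF *]] by blast
  define M where "M k = mat D D (\<lambda>(i, j). k (unitv j) i)" for k :: "(nat \<Rightarrow> 'a) \<Rightarrow> nat \<Rightarrow> 'a"
  have M: "M k \<in> carrier_mat D D" for k by (simp add: M_def)
  have ex: "k u i = (\<Sum>j<D. k (unitv j) i * u j)" if k: "linmap UNIV D D k" and i: "i < D" for k u i
  proof -
    have "k u i = k (lincomb {..<D} u unitv) i"
      using i by (intro linmapD(3)[OF k]) (auto simp: lincomb_unitv)
    then show ?thesis unfolding linmap_lincomb[OF k finite_lessThan]
      by (simp add: lincomb_def mult.commute)
  qed
  have prod: "M a * M b = 1\<^sub>m D"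
    if a: "linmap UNIV D D a" and ab: "\<And>v i. i < D \<Longrightarrow> a (b v) i = v i" for a b
  proof (rule eq_matI)
    fix i j assume ij: "i < dim_row (1\<^sub>m D)" "j < dim_col (1\<^sub>m D)"
    then have "(M a * M b) $$ (i, j) = (\<Sum>k<D. a (unitv k) i * b (unitv j) k)"
      by (simp add: M_def scalar_prod_def atLeast0LessThan)
    also have "\<dots> = a (b (unitv j)) i" using ex[OF a, of i "b (unitv j)"] ij by simp
    also have "\<dots> = 1\<^sub>m D $$ (i, j)" using ab ij by (simp add: unitv_def)
    finally show "(M a * M b) $$ (i, j) = 1\<^sub>m D $$ (i, j)" .
  qed (simp_all add: M_def)
  have "M h * M f = 1\<^sub>m D" "M f * M h = 1\<^sub>m D"
    using prod[OF f(2), of f] prod[OF f(1), of h] f(3,4) by blast+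
  then have "invertible_mat (M f)"
    unfolding invertible_mat_def inverts_mat_def using M[of f] M[of h] by auto
  moreover have "qval (mkq D g') (M f *\<^sub>v v) = qval (mkq D g) v" if v: "v \<in> carrier_vec D" for v
  proof -
    have "(M f *\<^sub>v v) $ i = f (($) v) i" if "i < D" for i
      using that v ex[OF f(1) that, of "($) v"] by (simp add: M_def scalar_prod_def atLeast0LessThan)
    then have "qd D g' (($) (M f *\<^sub>v v)) = qd D g' (f (($) v))" by (intro qd_cong) simp
    then show ?thesis using v M[of f] f(5) by (simp add: qval_mkq)
  qed
  ultimately show "isometric (mkq D g) (mkq D' g')"
    unfolding isometric_def using * M[of f] by auto
qed

section \<open>Tensor products with bilinear Pfister forms\<close>

text \<open>The subproducts of the list, in the order in which the Kronecker product puts them on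
  the diagonal of the bilinear Pfister form. The same list later enumerates the subgroup generated
  by the image of \<open>S\<close>.\<close>

fun prods :: "'a::comm_ring_1 list \<Rightarrow> 'a list" where
  "prods [] = [1]"
| "prods (b # bs) = prods bs @ map ((*) b) (prods bs)"

lemma length_prods [simp]: "length (prods bs) = 2 ^ length bs"
  by (induction bs) auto

lemma prods_nonzero: "0 \<notin> set bs \<Longrightarrow> 0 \<notin> set (prods bs)" for bs :: "'a::idom list"
  by (induction bs) auto

lemma bil_pfister_diag: "bil_pfister bs = diag_form (prods bs)"
proof (induction bs)
  case (Cons b bs)
  let ?N = "2 ^ length bs :: nat" and ?p = "prods bs"
  have N: "dim_row (diag_form ?p) = ?N" "dim_col (diag_form ?p) = ?N"
    by (simp_all add: diag_form_def mat_diag_def)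
  show ?case
  proof (rule eq_matI)
    fix i j assume "i < dim_row (diag_form (prods (b # bs)))" "j < dim_col (diag_form (prods (b # bs)))"
    then have ij: "i < ?N + ?N" "j < ?N + ?N" by (simp_all add: diag_form_def mat_diag_def)
    have d2: "i div ?N < 2" "j div ?N < 2" using ij by (simp_all add: less_mult_imp_div_less mult_2)
    have m: "i mod ?N < ?N" "j mod ?N < ?N" by simp_all
    have "bil_pfister (b # bs) $$ (i, j) =
        diag_form [1, b] $$ (i div ?N, j div ?N) * diag_form ?p $$ (i mod ?N, j mod ?N)"
      unfolding bil_pfister.simps Cons.IH bil_tensor_def N using ij
      by (simp add: diag_form_def mat_diag_def mult_2)
    also have "\<dots> = (if i = j then [1, b] ! (i div ?N) * ?p ! (i mod ?N) else 0)"
      using d2 m by (auto simp: diag_form_def mat_diag_def) (metis div_mult_mod_eq)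
    also have "\<dots> = diag_form (prods (b # bs)) $$ (i, j)"
    proof (cases "i < ?N")
      case True
      then show ?thesis using ij by (auto simp: diag_form_def mat_diag_def nth_append)
    next
      case False
      then have "i div ?N = 1" "i mod ?N = i - ?N"
        using ij by (simp_all add: div_nat_eqI mod_if not_less le_mod_geq)
      then show ?thesis using ij False by (auto simp: diag_form_def mat_diag_def nth_append)
    qed
    finally show "bil_pfister (b # bs) $$ (i, j) = diag_form (prods (b # bs)) $$ (i, j)" .
  qed (simp_all add: Cons.IH bil_tensor_def diag_form_def mat_diag_def)
qed simp

fun tensor_gram :: "'a::field list \<Rightarrow> nat \<Rightarrow> (nat \<Rightarrow> nat \<Rightarrow> 'a) \<Rightarrow> nat \<Rightarrow> nat \<Rightarrow> 'a" where
  "tensor_gram [] D g = g"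
| "tensor_gram (b # bs) D g =
     gsum (2 ^ length bs * D) (tensor_gram bs D g) (gscale b (tensor_gram bs D g))"

lemma qd_tensor_gram:
  "qd (2 ^ length bs * D) (tensor_gram bs D g) v =
     (\<Sum>i<2 ^ length bs. prods bs ! i * qd D g (\<lambda>k. v (i * D + k)))"
proof (induction bs arbitrary: v)
  case (Cons b bs)
  let ?N = "2 ^ length bs :: nat"
  have d: "2 ^ length (b # bs) * D = ?N * D + ?N * D" and N: "2 ^ length (b # bs) = ?N + ?N" by simp_all
  have "qd (2 ^ length (b # bs) * D) (tensor_gram (b # bs) D g) v =
      (\<Sum>i<?N. prods bs ! i * qd D g (\<lambda>k. v (i * D + k))) +
      b * (\<Sum>i<?N. prods bs ! i * qd D g (\<lambda>k. v (?N * D + (i * D + k))))"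
    unfolding d tensor_gram.simps qd_gsum qd_gscale Cons.IH by (simp add: tailv_def)
  also have "\<dots> = (\<Sum>i<2 ^ length (b # bs). prods (b # bs) ! i * qd D g (\<lambda>k. v (i * D + k)))"
    unfolding N sum_lessThan_add
    by (simp add: nth_append sum_distrib_left algebra_simps)
  finally show ?case .
qed simp

lemma qtensor_pfister:
  "qtensor (bil_pfister bs) (mkq D g) = mkq (2 ^ length bs * D) (tensor_gram bs D g)"
proof -
  let ?B = "bil_pfister bs" and ?N = "2 ^ length bs :: nat"
  have N: "dim_row ?B = ?N" by (simp add: bil_pfister_diag diag_form_def mat_diag_def)
  have B: "?B $$ (i, j) = (if i = j then prods bs ! i else 0)" if "i < ?N" "j < ?N" for i j
    using that by (auto simp: bil_pfister_diag diag_form_def mat_diag_def)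
  have "(\<Sum>i<?N. ?B $$ (i, i) * qval (mkq D g) (vec_block D v i)) +
      (\<Sum>j<?N. \<Sum>i<j. ?B $$ (i, j) * polar (mkq D g) (vec_block D v i) (vec_block D v j)) =
      qd (?N * D) (tensor_gram bs D g) (($) v)" for v
  proof -
    have "(\<Sum>j<?N. \<Sum>i<j. ?B $$ (i, j) * polar (mkq D g) (vec_block D v i) (vec_block D v j)) = 0"
      by (intro sum.neutral ballI) (auto simp: B)
    moreover have "qval (mkq D g) (vec_block D v i) = qd D g (\<lambda>k. v $ (i * D + k))" for i
      by (subst qval_mkq) (auto simp: vec_block_def intro!: qd_cong)
    ultimately show ?thesis unfolding qd_tensor_gram by (simp add: B)
  qed
  then show ?thesis unfolding qtensor_def N qdim_mkq by (simp add: mkq_def)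
qed

lemma tensor_gram_pf: "tensor_gram bs (pf_dim (length cs)) (pf_gram cs \<alpha>) = pf_gram (bs @ cs) \<alpha>"
  by (induction bs) (simp_all add: power_add mult_ac)

lemma qtensor_pf:
  "qtensor (bil_pfister bs) (mkq (pf_dim (length cs)) (pf_gram cs \<alpha>)) =
     mkq (pf_dim (length (bs @ cs))) (pf_gram (bs @ cs) \<alpha>)"
  unfolding qtensor_pfister tensor_gram_pf by (simp add: power_add mult_ac)

lemma qtensor_binary:
  "qtensor (bil_pfister bs) (binary_form 1 \<alpha>) = mkq (pf_dim (length bs)) (pf_gram bs \<alpha>)"
  using qtensor_pf[of bs "[]" \<alpha>] by (simp add: binary_form_mkq)

lemma bil_pfister_single: "bil_pfister [\<beta>] = diag_form [1, \<beta>]"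
  by (simp only: bil_pfister_diag) simp

lemma nonsing_norm_iff: "nonsing UNIV 2 (norm_gram \<alpha>) \<longleftrightarrow> 1 - 4 * \<alpha> \<noteq> 0"
proof
  assume ns: "nonsing UNIV 2 (norm_gram \<alpha>)"
  show "1 - 4 * \<alpha> \<noteq> 0"
  proof
    assume a: "1 - 4 * \<alpha> = 0"
    define v where "v = (\<lambda>i::nat. if i = 0 then - 2 * \<alpha> else 1)"
    have "pol 2 (norm_gram \<alpha>) v u = 0" for u
    proof -
      have "pol 2 (norm_gram \<alpha>) v u = (1 - 4 * \<alpha>) * u 0" by (simp add: pol_norm v_def algebra_simps)
      then show ?thesis using a by simp
    qed
    then have "\<forall>i<2. v i = 0" using ns by (simp add: nonsing_def ovec_def)
    then have "v 1 = 0" by simp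
    then show False by (simp add: v_def)
  qed
qed (rule nonsing_norm[OF is_subfield_UNIV])

lemma quad_pfister_iff:
  "quad_pfister (Suc m) q \<longleftrightarrow> is_qform q \<and>
     (\<exists>\<beta>s \<alpha>. pf_slots UNIV m (1, \<beta>s, \<alpha>) \<and> isometric q (mkq (pf_dim m) (pf_gram \<beta>s \<alpha>)))"
  unfolding quad_pfister_def qtensor_binary
  by (auto simp: pf_slots_def binary_form_mkq nonsingular_mkq nonsing_norm_iff; blast)

section \<open>Witt equivalence\<close>

text \<open>Witt equivalence as hyperbolicity of the difference, with no stabilising planes to keep
  track of. The agreement with the original relation is \<open>witt_rel_mkq\<close>.\<close>

definition weq :: "nat \<Rightarrow> (nat \<Rightarrow> nat \<Rightarrow> 'a::field) \<Rightarrow> nat \<Rightarrow> (nat \<Rightarrow> nat \<Rightarrow> 'a) \<Rightarrow> bool" where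
  "weq D g D' g' \<longleftrightarrow> metab UNIV (D + D') (gsum D g (gscale (- 1) g'))"

lemma ogram_UNIV: "ogram UNIV D g"
  by (simp add: ogram_def)

lemma isom_refl: "isom K D g g"
  by (rule isom_of_qd_eq) simp

lemma gscale_gsum: "gscale c (gsum m g h) = gsum m (gscale c g) (gscale c h)"
  for c :: "'b::comm_ring_1"
  by (auto simp: gscale_def gsum_def fun_eq_iff)

lemma gscale_gscale: "gscale c (gscale d g) = gscale (c * d) g" for c :: "'b::comm_ring_1"
  by (simp add: gscale_def mult.assoc)

lemma gscale_1 [simp]: "gscale 1 g = g" for g :: "nat \<Rightarrow> nat \<Rightarrow> 'b::comm_ring_1"
  by (simp add: gscale_def)

lemma metab_cancel_mid:
  assumes h: "nonsing UNIV n h" "metab UNIV n h"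
    and m: "metab UNIV (m + (n + k)) (gsum m g (gsum n h r))"
  shows "metab UNIV (m + k) (gsum m g r)"
proof -
  have "isom UNIV ((m + n) + k) (gsum (m + n) (gsum m g h) r) (gsum (n + m) (gsum n h g) r)"
    using isom_gsum[OF is_subfield_UNIV isom_swap[of UNIV m n g h] isom_refl[of UNIV k r]] by (simp add: add.commute)
  moreover have "metab UNIV ((m + n) + k) (gsum (m + n) (gsum m g h) r)"
    using m by (simp add: gsum_assoc add.assoc)
  ultimately have "metab UNIV ((m + n) + k) (gsum (n + m) (gsum n h g) r)" by (rule isom_metab)
  then have "metab UNIV (n + (m + k)) (gsum n h (gsum m g r))"
    by (simp add: gsum_assoc add_ac)
  then show ?thesis by (rule metab_cancel[OF is_subfield_UNIV ogram_UNIV h])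
qed

lemma metab_swap_mid:
  assumes "metab UNIV (a + (b + (c + d))) (gsum a g (gsum b h (gsum c k l)))"
  shows "metab UNIV (a + (c + (b + d))) (gsum a g (gsum c k (gsum b h l)))"
proof -
  have "isom UNIV ((b + c) + d) (gsum (b + c) (gsum b h k) l) (gsum (c + b) (gsum c k h) l)"
    using isom_gsum[OF is_subfield_UNIV isom_swap[of UNIV b c h k] isom_refl[of UNIV d l]] by (simp add: add.commute)
  then have "isom UNIV (b + (c + d)) (gsum b h (gsum c k l)) (gsum c k (gsum b h l))"
    by (simp add: gsum_assoc add_ac)
  then have "isom UNIV (a + (b + (c + d))) (gsum a g (gsum b h (gsum c k l))) (gsum a g (gsum c k (gsum b h l)))"
    by (rule isom_gsum[OF is_subfield_UNIV isom_refl])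
  from isom_metab[OF this assms] show ?thesis by (simp add: add_ac)
qed

lemma metab_neg': "metab UNIV (D + D) (gsum D (gscale (- 1) g) g)" for g :: "nat \<Rightarrow> nat \<Rightarrow> 'a::field"
  by (rule metab_graph[OF is_subfield_UNIV linmap_id]) (simp add: qd_gscale)

lemma weq_isom: assumes "isom UNIV D g g'" shows "weq D g D g'"
proof -
  obtain f where f: "linmap UNIV D D f" "\<And>v. qd D g' (f v) = qd D g v"
    using assms unfolding isom_def by blast
  show ?thesis unfolding weq_def
    by (rule metab_graph[OF is_subfield_UNIV f(1)]) (simp add: qd_gscale f(2))
qed

lemma weq_refl: "weq D g D g"
  by (rule weq_isom[OF isom_refl])

lemma weq_sym: assumes "weq D g D' g'" shows "weq D' g' D g"
proof -
  have "metab UNIV (D + D') (gsum D (gscale (- 1) g) g')"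
    using metab_gscale[OF assms[unfolded weq_def], of "- 1"] by (simp add: gscale_gsum gscale_gscale)
  from isom_metab[OF isom_swap this] show ?thesis
    unfolding weq_def by (simp add: add.commute)
qed

lemma weq_trans:
  assumes 1: "weq D g D' g'" and 2: "weq D' g' D'' g''" and ns: "nonsing UNIV D' g'"
  shows "weq D g D'' g''"
proof -
  have "metab UNIV ((D + D') + (D' + D''))
      (gsum (D + D') (gsum D g (gscale (- 1) g')) (gsum D' g' (gscale (- 1) g'')))"
    using metab_gsum[OF is_subfield_UNIV 1[unfolded weq_def] 2[unfolded weq_def]] .
  then have "metab UNIV (D + ((D' + D') + D''))
      (gsum D g (gsum (D' + D') (gsum D' (gscale (- 1) g') g') (gscale (- 1) g'')))"
    by (simp add: gsum_assoc add.assoc)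
  moreover have "nonsing UNIV (D' + D') (gsum D' (gscale (- 1) g') g')"
    using ns by (intro nonsing_gsum nonsing_gscale is_subfield_UNIV) auto
  ultimately show ?thesis
    unfolding weq_def using metab_cancel_mid[OF _ metab_neg'] by blast
qed

lemma weq_gsum:
  assumes 1: "weq D g D' g'" and 2: "weq E h E' h'"
  shows "weq (D + E) (gsum D g h) (D' + E') (gsum D' g' h')"
proof -
  have "metab UNIV ((D + D') + (E + E'))
      (gsum (D + D') (gsum D g (gscale (- 1) g')) (gsum E h (gscale (- 1) h')))"
    using metab_gsum[OF is_subfield_UNIV 1[unfolded weq_def] 2[unfolded weq_def]] .
  then have "metab UNIV (D + (D' + (E + E'))) (gsum D g (gsum D' (gscale (- 1) g') (gsum E h (gscale (- 1) h'))))"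
    by (simp add: gsum_assoc add.assoc)
  from metab_swap_mid[OF this] show ?thesis
    by (simp add: weq_def gscale_gsum gsum_assoc add.assoc)
qed

lemma metab_iff_weq_0: "metab UNIV D g \<longleftrightarrow> weq D g 0 h"
proof -
  have "isom UNIV (D + 0) g (gsum D g (gscale (- 1) h))"
    using qd_gsum[of D 0 g "gscale (- 1) h"] by (intro isom_of_qd_eq) (simp add: qd_def[of 0] bil_def[of 0])
  then show ?thesis unfolding weq_def using isom_metab[of UNIV "D + 0"] isom_sym[of UNIV "D + 0"] by auto
qed

lemma nonsing_hyp_sum: "nonsing UNIV (2 * k) (hyp_sum k :: nat \<Rightarrow> nat \<Rightarrow> 'a::field)"
proof (induction k)
  case (Suc k)
  have "nonsing UNIV (2 + 2 * k) (gsum 2 hyp_gram (hyp_sum k) :: nat \<Rightarrow> nat \<Rightarrow> 'a)"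
    by (rule nonsing_gsum[OF is_subfield_UNIV nonsing_hyp[OF is_subfield_UNIV] Suc])
  then show ?case by simp
qed (simp add: nonsing_def)

lemma even_nonsingular_mkq: "mkq D g \<in> even_nonsingular \<longleftrightarrow> even D \<and> nonsing UNIV D g"
  by (auto simp: even_nonsingular_def is_qform_mkq nonsingular_mkq)

lemma even_nonsingular_cases:
  assumes "q \<in> even_nonsingular"
  obtains D g where "q = mkq D g" "even D" "nonsing UNIV D g"
proof -
  have "is_qform q" using assms by (simp add: even_nonsingular_def)
  then obtain g where "q = mkq (qdim q) g" using qform_eq_mkq by blast
  then show ?thesis using that[of "qdim q" g] assms even_nonsingular_mkq by metis
qed

text \<open>Forwards, adding planes does not change the class for \<open>weq\<close>. Backwards, the
  sum of \<open>g\<close>, \<open>- g'\<close> and \<open>g'\<close> is bracketed in two ways: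
  \<open>g\<close> plus the hyperbolic form of \<open>- g'\<close> and \<open>g'\<close>, or the
  hyperbolic form of \<open>g\<close> and \<open>- g'\<close> plus \<open>g'\<close>.\<close>

lemma witt_rel_mkq:
  "(mkq D g, mkq D' g') \<in> witt_rel \<longleftrightarrow>
     even D \<and> nonsing UNIV D g \<and> even D' \<and> nonsing UNIV D' g' \<and> weq D g D' g'"
  (is "?L \<longleftrightarrow> ?R")
proof
  assume ?L
  then obtain k l where 1: "even D" "nonsing UNIV D g" "even D'" "nonsing UNIV D' g'"
    "D + 2 * k = D' + 2 * l"
    "isom UNIV (D + 2 * k) (gsum D g (hyp_sum k)) (gsum D' g' (hyp_sum l))"
    by (auto simp: witt_rel_def even_nonsingular_mkq hyperbolic_mkq orth_sum_mkq isometric_mkq)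
  have h: "weq (2 * k) (hyp_sum k :: nat \<Rightarrow> nat \<Rightarrow> 'a) 0 (\<lambda>_ _. 0)" for k
    using metab_hyp_sum[OF is_subfield_UNIV, of k] metab_iff_weq_0 by blast
  have g0: "weq D g (D + 2 * k) (gsum D g (hyp_sum k))" for D k and g :: "nat \<Rightarrow> nat \<Rightarrow> 'a"
  proof -
    have "weq (D + 0) (gsum D g (\<lambda>_ _. 0)) (D + 2 * k) (gsum D g (hyp_sum k))"
      by (rule weq_gsum[OF weq_refl weq_sym[OF h]])
    moreover have "qd (D + 0) (gsum D g (\<lambda>_ _. 0)) v = qd D g v" for v
      unfolding qd_gsum by (simp add: qd_def[of 0] bil_def[of 0])
    then have "isom UNIV (D + 0) (gsum D g (\<lambda>_ _. 0)) g" by (intro isom_of_qd_eq) simp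
    ultimately show ?thesis
      unfolding weq_def using isom_metab[OF isom_gsum[OF is_subfield_UNIV _ isom_refl]] by fastforce
  qed
  have "weq D g (D' + 2 * l) (gsum D' g' (hyp_sum l))"
    using weq_trans[OF g0[of D g k]] weq_isom[OF 1(6)] nonsing_gsum[OF is_subfield_UNIV 1(2) nonsing_hyp_sum, of k] 1(5) by metis
  then have "weq D g D' g'"
    using weq_trans[OF _ weq_sym[OF g0[of D' g' l]]] nonsing_gsum[OF is_subfield_UNIV 1(4) nonsing_hyp_sum, of l] by blast
  then show ?R using 1 by blast
next
  assume R: ?R
  let ?n = "gscale (- 1) g'"
  have n: "nonsing UNIV D' ?n" using R by (intro nonsing_gscale) auto
  obtain k where k: "D + D' = 2 * k" "isom UNIV (D + D') (hyp_sum k) (gsum D g ?n)"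
    using metab_isom_hyp_sum[OF is_subfield_UNIV ogram_UNIV nonsing_gsum[OF is_subfield_UNIV _ n]] R unfolding weq_def by blast
  obtain l where l: "D' + D' = 2 * l" "isom UNIV (D' + D') (hyp_sum l) (gsum D' ?n g')"
    using metab_isom_hyp_sum[OF is_subfield_UNIV ogram_UNIV nonsing_gsum[OF is_subfield_UNIV n] metab_neg'] R by blast
  have lD: "D' = l" using l(1) by simp
  have a: "isom UNIV (D + 2 * l) (gsum D g (hyp_sum l)) (gsum D g (gsum D' ?n g'))"
    using isom_gsum[OF is_subfield_UNIV isom_refl l(2)] l(1) by simp
  have b: "isom UNIV (D + D' + D') (gsum (D + D') (gsum D g ?n) g') (gsum (D + D') (hyp_sum k) g')"
    by (rule isom_gsum[OF is_subfield_UNIV isom_sym[OF k(2)] isom_refl])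
  have c: "isom UNIV (D + D' + D') (gsum (D + D') (hyp_sum k) g') (gsum D' g' (hyp_sum k))"
    by (rule isom_swap)
  have "isom UNIV (D + 2 * l) (gsum D g (hyp_sum l)) (gsum D' g' (hyp_sum k))"
    using isom_trans[OF a] isom_trans[OF b c] l(1) by (simp add: gsum_assoc add.assoc)
  moreover have "D + 2 * l = D' + 2 * k" using k(1) l(1) by simp
  ultimately have "isometric (orth_sum (mkq D g) (hyperbolic l)) (orth_sum (mkq D' g') (hyperbolic k))"
    by (simp only: hyperbolic_mkq orth_sum_mkq isometric_mkq simp_thms)
  then show ?L using R even_nonsingular_mkq unfolding witt_rel_def by blast
qed

definition even_nonsing :: "nat \<Rightarrow> (nat \<Rightarrow> nat \<Rightarrow> 'a::field) \<Rightarrow> bool" where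
  "even_nonsing D g \<longleftrightarrow> even D \<and> nonsing UNIV D g"

lemma witt_rel_cases:
  assumes "(q, r) \<in> witt_rel"
  obtains D g D' g' where "q = mkq D g" "r = mkq D' g'" "even_nonsing D g" "even_nonsing D' g'" "weq D g D' g'"
proof -
  have "q \<in> even_nonsingular" "r \<in> even_nonsingular" using assms by (auto simp: witt_rel_def)
  then obtain D g D' g' where "q = mkq D g" "r = mkq D' g'" by (metis even_nonsingular_cases)
  then show ?thesis using that assms by (simp add: witt_rel_mkq even_nonsing_def)
qed

lemma equiv_witt_rel: "equiv even_nonsingular (witt_rel :: ('a::field qform \<times> 'a qform) set)"
proof (rule equivI)
  show "(witt_rel :: ('a qform \<times> 'a qform) set) \<subseteq> even_nonsingular \<times> even_nonsingular"
    by (auto simp: witt_rel_def)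
  show "refl_on even_nonsingular (witt_rel :: ('a qform \<times> 'a qform) set)"
  proof (rule refl_onI)
    fix q :: "'a qform" assume "q \<in> even_nonsingular"
    then show "(q, q) \<in> witt_rel"
      by (elim even_nonsingular_cases) (simp add: witt_rel_mkq weq_refl)
  qed
  show "sym (witt_rel :: ('a qform \<times> 'a qform) set)"
  proof (rule symI)
    fix q r :: "'a qform" assume "(q, r) \<in> witt_rel"
    then show "(r, q) \<in> witt_rel"
      by (elim witt_rel_cases) (simp add: witt_rel_mkq even_nonsing_def weq_sym)
  qed
  show "trans (witt_rel :: ('a qform \<times> 'a qform) set)"
  proof (rule transI)
    fix q r t :: "'a qform" assume a: "(q, r) \<in> witt_rel" "(r, t) \<in> witt_rel"
    obtain D g D' g' where 1: "q = mkq D g" "r = mkq D' g'" using a(1) by (rule witt_rel_cases)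
    obtain E h E' h' where 2: "r = mkq E h" "t = mkq E' h'" using a(2) by (rule witt_rel_cases)
    show "(q, t) \<in> witt_rel"
      using a unfolding 1(1) 2(2) using 1(2) by (auto simp: witt_rel_mkq intro: weq_trans)
  qed
qed

section \<open>The Witt group\<close>

definition wc :: "nat \<Rightarrow> (nat \<Rightarrow> nat \<Rightarrow> 'a::field) \<Rightarrow> 'a qform set" where
  "wc D g = witt_class (mkq D g)"

lemma even_nonsing_gsum: "even_nonsing D g \<Longrightarrow> even_nonsing E h \<Longrightarrow> even_nonsing (D + E) (gsum D g h)"
  by (simp add: even_nonsing_def nonsing_gsum is_subfield_UNIV)

lemma even_nonsing_gscale: "c \<noteq> 0 \<Longrightarrow> even_nonsing D g \<Longrightarrow> even_nonsing D (gscale c g)"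
  by (simp add: even_nonsing_def nonsing_gscale)

lemma wc_eq_iff: "even_nonsing D g \<Longrightarrow> even_nonsing D' g' \<Longrightarrow> wc D g = wc D' g' \<longleftrightarrow> weq D g D' g'"
  unfolding wc_def witt_class_def
  using eq_equiv_class_iff[OF equiv_witt_rel, of "mkq D g" "mkq D' g'"]
  by (simp add: even_nonsingular_mkq witt_rel_mkq even_nonsing_def)

lemma carrier_witt_group_cases:
  assumes "x \<in> carrier witt_group" obtains D g where "x = wc D g" "even_nonsing D g"
  using assms by (auto simp: witt_group_def wc_def witt_class_def even_nonsing_def elim!: quotientE even_nonsingular_cases)

lemma wc_carrier: "even_nonsing D g \<Longrightarrow> wc D g \<in> carrier witt_group"
  by (simp add: witt_group_def wc_def witt_class_def even_nonsing_def quotientI even_nonsingular_mkq)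

lemma wc_mult:
  assumes "even_nonsing D g" "even_nonsing E h"
  shows "wc D g \<otimes>\<^bsub>witt_group\<^esub> wc E h = wc (D + E) (gsum D g h)"
proof -
  have "congruent2 witt_rel witt_rel (\<lambda>q (r :: 'a qform). witt_class (orth_sum q r))"
  proof (rule congruent2I')
    fix q q' r r' :: "'a qform" assume a: "(q, q') \<in> witt_rel" "(r, r') \<in> witt_rel"
    obtain D g D' g' where 1: "q = mkq D g" "q' = mkq D' g'" "even_nonsing D g" "even_nonsing D' g'" "weq D g D' g'"
      using a(1) by (rule witt_rel_cases)
    obtain E h E' h' where 2: "r = mkq E h" "r' = mkq E' h'" "even_nonsing E h" "even_nonsing E' h'" "weq E h E' h'"
      using a(2) by (rule witt_rel_cases)
    have "wc (D + E) (gsum D g h) = wc (D' + E') (gsum D' g' h')"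
      using 1 2 by (simp add: wc_eq_iff even_nonsing_gsum weq_gsum)
    then show "witt_class (orth_sum q r) = witt_class (orth_sum q' r')"
      by (simp add: 1 2 orth_sum_mkq wc_def)
  qed
  then have "(\<Union>q\<in>witt_rel `` {mkq D g}. \<Union>r\<in>witt_rel `` {mkq E h}. witt_class (orth_sum q r)) =
      witt_class (orth_sum (mkq D g) (mkq E h))"
    using assms by (intro UN_equiv_class2[OF equiv_witt_rel equiv_witt_rel])
      (auto simp: even_nonsingular_mkq even_nonsing_def)
  then show ?thesis by (simp add: witt_group_def wc_def witt_class_def orth_sum_mkq)
qed

lemma wc_one: "wc 0 g = \<one>\<^bsub>witt_group\<^esub>"
  by (simp add: witt_group_def wc_def zero_form_mkq[of g])

lemma even_nonsing_zero: "even_nonsing 0 g"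
  by (simp add: even_nonsing_def nonsing_def)

lemma wc_eq_one_iff: "even_nonsing D g \<Longrightarrow> wc D g = \<one>\<^bsub>witt_group\<^esub> \<longleftrightarrow> metab UNIV D g"
  using wc_eq_iff[OF _ even_nonsing_zero, of D g "\<lambda>_ _. 0"] metab_iff_weq_0 wc_one by metis

lemma wc_isom: "even_nonsing D g \<Longrightarrow> isom UNIV D g g' \<Longrightarrow> wc D g = wc D g'"
  using isom_nonsing by (subst wc_eq_iff) (auto simp: even_nonsing_def weq_isom)

lemma wc_single: assumes "even_nonsing D g" shows "wc D (gsum D g h) = wc D g"
proof -
  have "qd D g v = qd D (gsum D g h) v" for v
    using qd_gsum[of D 0 g h v] by (simp add: qd_def[of 0] bil_def[of 0])
  then show ?thesis using wc_isom[OF assms isom_of_qd_eq] by metis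
qed

lemma comm_group_witt_group: "comm_group (witt_group :: 'a::field qform set monoid)"
proof (rule comm_groupI)
  let ?W = "witt_group :: 'a qform set monoid"
  show "\<one>\<^bsub>?W\<^esub> \<in> carrier ?W" using wc_carrier[OF even_nonsing_zero] wc_one by metis
  fix x assume "x \<in> carrier ?W"
  then obtain D g where x: "x = wc D g" "even_nonsing D g" by (rule carrier_witt_group_cases)
  have "\<one>\<^bsub>?W\<^esub> \<otimes>\<^bsub>?W\<^esub> x = wc 0 (\<lambda>_ _. 0) \<otimes>\<^bsub>?W\<^esub> wc D g" by (simp add: x wc_one)
  then show "\<one>\<^bsub>?W\<^esub> \<otimes>\<^bsub>?W\<^esub> x = x" by (simp add: x wc_mult even_nonsing_zero)
  have "wc D (gscale (- 1) g) \<otimes>\<^bsub>?W\<^esub> x = \<one>\<^bsub>?W\<^esub>"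
    using x by (simp add: wc_mult even_nonsing_gscale wc_eq_one_iff even_nonsing_gsum metab_neg')
  then show "\<exists>y\<in>carrier ?W. y \<otimes>\<^bsub>?W\<^esub> x = \<one>\<^bsub>?W\<^esub>"
    by (rule bexI) (simp add: wc_carrier even_nonsing_gscale x(2))
  fix y assume "y \<in> carrier ?W"
  then obtain E h where y: "y = wc E h" "even_nonsing E h" by (rule carrier_witt_group_cases)
  show "x \<otimes>\<^bsub>?W\<^esub> y \<in> carrier ?W" by (simp add: x y wc_mult wc_carrier even_nonsing_gsum)
  show "x \<otimes>\<^bsub>?W\<^esub> y = y \<otimes>\<^bsub>?W\<^esub> x"
    using wc_isom[OF even_nonsing_gsum[OF x(2) y(2)] isom_swap] x y by (simp add: wc_mult add.commute)
  fix z assume "z \<in> carrier ?W"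
  then obtain F k where z: "z = wc F k" "even_nonsing F k" by (rule carrier_witt_group_cases)
  show "x \<otimes>\<^bsub>?W\<^esub> y \<otimes>\<^bsub>?W\<^esub> z = x \<otimes>\<^bsub>?W\<^esub> (y \<otimes>\<^bsub>?W\<^esub> z)"
    using x y z by (simp add: wc_mult even_nonsing_gsum gsum_assoc add.assoc)
qed

lemma wc_inv: assumes "even_nonsing D g" shows "inv\<^bsub>witt_group\<^esub> wc D g = wc D (gscale (- 1) g)"
proof -
  interpret comm_group witt_group by (rule comm_group_witt_group)
  show ?thesis
    using assms by (intro inv_equality) (simp_all add: wc_mult even_nonsing_gscale wc_eq_one_iff even_nonsing_gsum metab_neg' wc_carrier)
qed

section \<open>The powers of the fundamental ideal\<close>

lemma even_nonsing_pf:
  assumes "pf_slots UNIV m (c, \<beta>s, \<alpha>)"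
  shows "even_nonsing (pf_dim m) (pf_gram \<beta>s \<alpha>)" "even_nonsing (pf_dim m) (gscale c (pf_gram \<beta>s \<alpha>))"
proof -
  have "length \<beta>s = m" "0 \<notin> set \<beta>s" "1 - 4 * \<alpha> \<noteq> 0" "c \<noteq> 0"
    using assms by (auto simp: pf_slots_def)
  then show "even_nonsing (pf_dim m) (pf_gram \<beta>s \<alpha>)" using nonsing_pf[OF is_subfield_UNIV, of \<alpha> \<beta>s] by (auto simp: even_nonsing_def)
  then show "even_nonsing (pf_dim m) (gscale c (pf_gram \<beta>s \<alpha>))" using \<open>c \<noteq> 0\<close> by (rule even_nonsing_gscale[rotated])
qed

lemma even_nonsing_pfs: "\<forall>x\<in>set xs. pf_slots UNIV m x \<Longrightarrow> even_nonsing (pfs_dim m xs) (pfs_gram m xs)"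
  using pfs_gram_props[OF is_subfield_UNIV] by (auto simp: even_nonsing_def) (induction xs; simp)

lemma pfs_append:
  "pfs_dim m (xs @ ys) = pfs_dim m xs + pfs_dim m ys"
  "pfs_gram m (xs @ ys) = gsum (pfs_dim m xs) (pfs_gram m xs) (pfs_gram m ys)"
proof -
  show "pfs_dim m (xs @ ys) = pfs_dim m xs + pfs_dim m ys" by (induction xs) auto
  show "pfs_gram m (xs @ ys) = gsum (pfs_dim m xs) (pfs_gram m xs) (pfs_gram m ys)"
  proof (induction xs)
    case (Cons x xs)
    then show ?case by (cases x) (simp add: gsum_assoc)
  qed simp
qed

text \<open>Indexed by the number of bilinear slots: these classes generate
  \<open>Iq (Suc m)\<close>.\<close>

definition Iq_gens :: "nat \<Rightarrow> 'a::field qform set set" where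
  "Iq_gens m = {wc (pf_dim m) (gscale c (pf_gram \<beta>s \<alpha>)) |c \<beta>s \<alpha>. pf_slots UNIV m (c, \<beta>s, \<alpha>)}"

lemma quad_pfister_class:
  assumes "quad_pfister (Suc m) q"
  obtains \<beta>s \<alpha> g where "pf_slots UNIV m (1, \<beta>s, \<alpha>)" "q = mkq (pf_dim m) g"
    "isom UNIV (pf_dim m) g (pf_gram \<beta>s \<alpha>)" "even_nonsing (pf_dim m) g"
    "witt_class q = wc (pf_dim m) (pf_gram \<beta>s \<alpha>)"
proof -
  obtain \<beta>s \<alpha> where *: "is_qform q" "pf_slots UNIV m (1, \<beta>s, \<alpha>)"
    "isometric q (mkq (pf_dim m) (pf_gram \<beta>s \<alpha>))"
    using assms unfolding quad_pfister_iff by blast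
  obtain g where g: "q = mkq (qdim q) g" using qform_eq_mkq[OF *(1)] by blast
  then have d: "qdim q = pf_dim m" "isom UNIV (pf_dim m) g (pf_gram \<beta>s \<alpha>)"
    using *(3) isometric_mkq by metis+
  have "even_nonsing (pf_dim m) g"
    using isom_nonsing[OF isom_sym[OF d(2)]] even_nonsing_pf(1)[OF *(2)] by (simp add: even_nonsing_def)
  then show ?thesis
    using that[OF *(2) _ d(2)] g d wc_isom by (metis wc_def)
qed

lemma quad_pfister_mkq:
  assumes "pf_slots UNIV m (1, \<beta>s, \<alpha>)" shows "quad_pfister (Suc m) (mkq (pf_dim m) (pf_gram \<beta>s \<alpha>))"
  unfolding quad_pfister_iff using assms is_qform_mkq isometric_mkq isom_refl by blast

lemma pf_slots_scale: "pf_slots UNIV m (c, \<beta>s, \<alpha>) \<Longrightarrow> d \<noteq> 0 \<Longrightarrow> pf_slots UNIV m (d, \<beta>s, \<alpha>)"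
  by (simp add: pf_slots_def)

lemma Iq_gens_eq: "{witt_class (qscale c \<pi>) |c \<pi>. c \<noteq> 0 \<and> quad_pfister (Suc m) \<pi>} = Iq_gens m"
proof (intro equalityI subsetI)
  fix x :: "'a qform set" assume "x \<in> {witt_class (qscale c \<pi>) |c \<pi>. c \<noteq> 0 \<and> quad_pfister (Suc m) \<pi>}"
  then obtain c \<pi> where x: "x = witt_class (qscale c \<pi>)" "c \<noteq> 0" "quad_pfister (Suc m) \<pi>" by blast
  obtain \<beta>s \<alpha> g where p: "pf_slots UNIV m (1, \<beta>s, \<alpha>)" "\<pi> = mkq (pf_dim m) g"
    "isom UNIV (pf_dim m) g (pf_gram \<beta>s \<alpha>)" "even_nonsing (pf_dim m) g"
    "witt_class \<pi> = wc (pf_dim m) (pf_gram \<beta>s \<alpha>)"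
    by (rule quad_pfister_class[OF x(3)])
  have "x = wc (pf_dim m) (gscale c (pf_gram \<beta>s \<alpha>))"
    using wc_isom[OF even_nonsing_gscale[OF x(2) p(4)] isom_gscale[OF p(3)]] by (simp add: x p(2) qscale_mkq wc_def)
  then show "x \<in> Iq_gens m" unfolding Iq_gens_def using pf_slots_scale[OF p(1) x(2)] by blast
next
  fix x :: "'a qform set" assume "x \<in> Iq_gens m"
  then obtain c \<beta>s \<alpha> where x: "x = wc (pf_dim m) (gscale c (pf_gram \<beta>s \<alpha>))" "pf_slots UNIV m (c, \<beta>s, \<alpha>)"
    unfolding Iq_gens_def by blast
  then have "x = witt_class (qscale c (mkq (pf_dim m) (pf_gram \<beta>s \<alpha>)))" by (simp add: wc_def qscale_mkq)
  moreover have "c \<noteq> 0" using x(2) by (simp add: pf_slots_def)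
  moreover have "quad_pfister (Suc m) (mkq (pf_dim m) (pf_gram \<beta>s \<alpha>))"
    using pf_slots_scale[OF x(2), of 1] by (intro quad_pfister_mkq) simp
  ultimately show "x \<in> {witt_class (qscale c \<pi>) |c \<pi>. c \<noteq> 0 \<and> quad_pfister (Suc m) \<pi>}"
    by blast
qed

lemma Iq_Suc: "Iq (Suc m) = generate witt_group (Iq_gens m)"
  unfolding Iq_def Iq_gens_eq ..

lemma Iq_gens_carrier: "Iq_gens m \<subseteq> carrier witt_group"
  unfolding Iq_gens_def using even_nonsing_pf(2) wc_carrier by blast

text \<open>The inverse of the class of a multiple by \<open>c\<close> is the class of the multiple
  by \<open>- c\<close>, so every element is an orthogonal sum without signs.\<close>

lemma Iq_elements:
  assumes "x \<in> Iq (Suc m)"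
  shows "\<exists>xs. (\<forall>y\<in>set xs. pf_slots UNIV m y) \<and> x = wc (pfs_dim m xs) (pfs_gram m xs)"
  using assms unfolding Iq_Suc
proof (induction rule: generate.induct)
  case one
  show ?case by (intro exI[of _ "[]"]) (simp add: wc_one)
next
  case (incl h)
  then obtain c \<beta>s \<alpha> where h: "h = wc (pf_dim m) (gscale c (pf_gram \<beta>s \<alpha>))" "pf_slots UNIV m (c, \<beta>s, \<alpha>)"
    unfolding Iq_gens_def by blast
  have "h = wc (pfs_dim m [(c, \<beta>s, \<alpha>)]) (pfs_gram m [(c, \<beta>s, \<alpha>)])"
    using wc_single[OF even_nonsing_pf(2)[OF h(2)]] h(1) by simp
  then show ?case using h(2) by (intro exI[of _ "[(c, \<beta>s, \<alpha>)]"] conjI) simp_all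
next
  case (inv h)
  then obtain c \<beta>s \<alpha> where h: "h = wc (pf_dim m) (gscale c (pf_gram \<beta>s \<alpha>))" "pf_slots UNIV m (c, \<beta>s, \<alpha>)"
    unfolding Iq_gens_def by blast
  have s: "pf_slots UNIV m (- c, \<beta>s, \<alpha>)" using h(2) by (simp add: pf_slots_def)
  have i: "inv\<^bsub>witt_group\<^esub> h = wc (pf_dim m) (gscale (- c) (pf_gram \<beta>s \<alpha>))"
    using wc_inv[OF even_nonsing_pf(2)[OF h(2)]] by (simp add: h(1) gscale_gscale)
  have "inv\<^bsub>witt_group\<^esub> h = wc (pfs_dim m [(- c, \<beta>s, \<alpha>)]) (pfs_gram m [(- c, \<beta>s, \<alpha>)])"
    using wc_single[OF even_nonsing_pf(2)[OF s]] i by simp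
  then show ?case using s by (intro exI[of _ "[(- c, \<beta>s, \<alpha>)]"] conjI) simp_all
next
  case (eng h1 h2)
  then obtain xs ys where *: "\<forall>y\<in>set xs. pf_slots UNIV m y" "h1 = wc (pfs_dim m xs) (pfs_gram m xs)"
    "\<forall>y\<in>set ys. pf_slots UNIV m y" "h2 = wc (pfs_dim m ys) (pfs_gram m ys)" by blast
  then show ?case
    by (intro exI[of _ "xs @ ys"]) (auto simp: pfs_append wc_mult even_nonsing_pfs)
qed

lemma subgroup_Iq: "subgroup (Iq (Suc m)) witt_group"
  unfolding Iq_Suc
  by (intro group.generate_is_subgroup Iq_gens_carrier) (simp add: comm_group_witt_group comm_group.axioms(2))

lemma Iq_gens_Suc_subset: "Iq_gens (Suc m) \<subseteq> Iq (Suc m)"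
proof
  fix x :: "'a qform set" assume "x \<in> Iq_gens (Suc m)"
  then obtain c \<beta>s \<alpha> where x: "x = wc (pf_dim (Suc m)) (gscale c (pf_gram \<beta>s \<alpha>))" "pf_slots UNIV (Suc m) (c, \<beta>s, \<alpha>)"
    unfolding Iq_gens_def by blast
  then obtain \<beta> \<gamma>s where b: "\<beta>s = \<beta> # \<gamma>s" by (cases \<beta>s) (auto simp: pf_slots_def)
  have s: "pf_slots UNIV m (c, \<gamma>s, \<alpha>)" "pf_slots UNIV m (c * \<beta>, \<gamma>s, \<alpha>)"
    using x(2) by (auto simp: b pf_slots_def)
  have m: "length \<gamma>s = m" using s(1) by (simp add: pf_slots_def)
  have "x = wc (pf_dim m) (gscale c (pf_gram \<gamma>s \<alpha>)) \<otimes>\<^bsub>witt_group\<^esub> wc (pf_dim m) (gscale (c * \<beta>) (pf_gram \<gamma>s \<alpha>))"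
    using x(1) wc_mult[OF even_nonsing_pf(2)[OF s(1)] even_nonsing_pf(2)[OF s(2)]]
    by (simp only: b pf_gram.simps gscale_gsum gscale_gscale m pf_dim_Suc)
  moreover have "wc (pf_dim m) (gscale c (pf_gram \<gamma>s \<alpha>)) \<in> Iq_gens m"
    "wc (pf_dim m) (gscale (c * \<beta>) (pf_gram \<gamma>s \<alpha>)) \<in> Iq_gens m"
    unfolding Iq_gens_def using s by blast+
  ultimately show "x \<in> Iq (Suc m)"
    unfolding Iq_Suc by (simp only: generate.eng generate.incl)
qed

lemma Iq_Suc_subset: "Iq (Suc (Suc m)) \<subseteq> Iq (Suc m)"
  unfolding Iq_Suc[of "Suc m"]
  by (intro group.generate_subgroup_incl Iq_gens_Suc_subset subgroup_Iq)
     (simp add: comm_group_witt_group comm_group.axioms(2))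

text \<open>The uniqueness that makes \<open>pfister_rep\<close> meaningful.\<close>

lemma pfister_class_unique:
  assumes y: "pf_slots UNIV m (1, \<beta>s, \<alpha>)" "pf_slots UNIV m (1, \<beta>s', \<alpha>')"
    and c: "Iq (Suc (Suc m)) #>\<^bsub>witt_group\<^esub> wc (pf_dim m) (pf_gram \<beta>s \<alpha>) =
      Iq (Suc (Suc m)) #>\<^bsub>witt_group\<^esub> wc (pf_dim m) (pf_gram \<beta>s' \<alpha>')"
  shows "wc (pf_dim m) (pf_gram \<beta>s \<alpha>) = wc (pf_dim m) (pf_gram \<beta>s' \<alpha>')"
proof -
  let ?a = "wc (pf_dim m) (pf_gram \<beta>s \<alpha>)" and ?b = "wc (pf_dim m) (pf_gram \<beta>s' \<alpha>')"
  interpret comm_group witt_group by (rule comm_group_witt_group)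
  have H: "subgroup (Iq (Suc (Suc m))) witt_group" by (rule subgroup_Iq)
  have ab: "?a \<in> carrier witt_group" "?b \<in> carrier witt_group" using y even_nonsing_pf(1) wc_carrier by blast+
  have "?a \<in> Iq (Suc (Suc m)) #>\<^bsub>witt_group\<^esub> ?b"
    using rcos_self[OF ab(1) H] c by simp
  then obtain x where x: "x \<in> Iq (Suc (Suc m))" "?a = x \<otimes>\<^bsub>witt_group\<^esub> ?b"
    unfolding r_coset_def by blast
  obtain xs where xs: "\<forall>z\<in>set xs. pf_slots UNIV (Suc m) z" "x = wc (pfs_dim (Suc m) xs) (pfs_gram (Suc m) xs)"
    using Iq_elements[OF x(1)] by blast
  \<comment> \<open>The relation is rewritten as hyperbolicity of the sum of \<open>- x\<close> and
    the difference of the two Pfister forms, the shape required by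
    \<open>pfister_hauptsatz\<close>.\<close>
  define neg where "neg = map (\<lambda>(c, \<beta>s, \<alpha>). (- c, \<beta>s, \<alpha> :: 'a)) xs"
  have neg: "\<forall>z\<in>set neg. pf_slots UNIV (Suc m) z" "pfs_dim (Suc m) neg = pfs_dim (Suc m) xs"
    using xs(1) by (auto simp: neg_def pf_slots_def) (induction xs; auto)
  have negg: "pfs_gram (Suc m) neg = gscale (- 1) (pfs_gram (Suc m) xs)"
    unfolding neg_def
  proof (induction xs)
    case Nil
    show ?case by (simp add: gscale_def)
  next
    case (Cons z zs)
    then show ?case by (cases z) (simp add: gscale_gsum gscale_gscale)
  qed
  let ?ys = "[(1, \<beta>s, \<alpha>), (- 1, \<beta>s', \<alpha>')]"
  have y': "pf_slots UNIV m (- 1, \<beta>s', \<alpha>')" using pf_slots_scale[OF y(2)] by simp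
  have ys: "wc (pfs_dim m ?ys) (pfs_gram m ?ys) = ?a \<otimes>\<^bsub>witt_group\<^esub> inv\<^bsub>witt_group\<^esub> ?b"
    using wc_mult[OF even_nonsing_pf(1)[OF y(1)] even_nonsing_gsum[OF even_nonsing_pf(2)[OF y'] even_nonsing_zero[of "\<lambda>_ _. 0"]]]
      wc_mult[OF even_nonsing_pf(2)[OF y'] even_nonsing_zero[of "\<lambda>_ _. 0"]] wc_inv[OF even_nonsing_pf(1)[OF y(2)]] wc_carrier[OF even_nonsing_pf(2)[OF y']]
    by (simp add: wc_one)
  have even_nonsing: "even_nonsing (pfs_dim m ?ys) (pfs_gram m ?ys)" using y(1) y' by (intro even_nonsing_pfs) auto
  have xinv: "wc (pfs_dim (Suc m) neg) (pfs_gram (Suc m) neg) = inv\<^bsub>witt_group\<^esub> x"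
    unfolding neg(2) negg xs(2) by (rule wc_inv[OF even_nonsing_pfs[OF xs(1)], symmetric])
  have xc: "x \<in> carrier witt_group" using x(1) subgroup.subset[OF H] by blast
  have "?a \<otimes>\<^bsub>witt_group\<^esub> inv\<^bsub>witt_group\<^esub> ?b = x"
    using x(2) xc ab by (simp add: m_assoc)
  then have "wc (pfs_dim (Suc m) neg + pfs_dim m ?ys) (gsum (pfs_dim (Suc m) neg) (pfs_gram (Suc m) neg) (pfs_gram m ?ys)) = \<one>\<^bsub>witt_group\<^esub>"
    using wc_mult[OF even_nonsing_pfs[OF neg(1)] even_nonsing] xinv ys xc by simp
  then have "metab UNIV (pfs_dim (Suc m) neg + pfs_dim m ?ys) (gsum (pfs_dim (Suc m) neg) (pfs_gram (Suc m) neg) (pfs_gram m ?ys))"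
    using wc_eq_one_iff[OF even_nonsing_gsum[OF even_nonsing_pfs[OF neg(1)] even_nonsing]] by blast
  from pfister_hauptsatz[OF neg(1) y(1) y' this]
  have "?a \<otimes>\<^bsub>witt_group\<^esub> inv\<^bsub>witt_group\<^esub> ?b = \<one>\<^bsub>witt_group\<^esub>"
    using wc_eq_one_iff[OF even_nonsing] ys by simp
  then show ?thesis using ab by (metis inv_closed inv_equality inv_inv)
qed

section \<open>Right-linked Pfister forms\<close>

text \<open>\<open>k\<close> is the number of bilinear slots of the common factor, which is thus
  \<open>(k + 1)\<close>-fold; the linked forms are \<open>n\<close>-fold with
  \<open>n = k + 2\<close>.\<close>

locale linked =
  fixes k :: nat and \<gamma>s :: "'a::field list" and \<alpha> i :: 'a
  assumes slots: "pf_slots UNIV k (1, \<gamma>s, \<alpha>)" and i: "i * i = - 1"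

sublocale linked \<subseteq> W: comm_group "witt_group :: 'a qform set monoid"
  by (rule comm_group_witt_group)

context linked
begin

abbreviation W :: "'a qform set monoid" where "W \<equiv> witt_group"

definition B :: "'a \<Rightarrow> 'a qform set" where
  "B c = wc (pf_dim k) (gscale c (pf_gram \<gamma>s \<alpha>))"

definition P :: "'a \<Rightarrow> 'a qform set" where
  "P c = B 1 \<otimes>\<^bsub>W\<^esub> B c"

lemma len: "length \<gamma>s = k"
  using slots by (simp add: pf_slots_def)

lemma even_nonsing_B: "c \<noteq> 0 \<Longrightarrow> even_nonsing (pf_dim k) (gscale c (pf_gram \<gamma>s \<alpha>))"
  by (rule even_nonsing_pf(2)[OF pf_slots_scale[OF slots]])

lemma B_closed [simp]: "c \<noteq> 0 \<Longrightarrow> B c \<in> carrier W"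
  unfolding B_def by (rule wc_carrier[OF even_nonsing_B])

lemma P_closed [simp]: "c \<noteq> 0 \<Longrightarrow> P c \<in> carrier W"
  by (simp add: P_def)

text \<open>This is where the square root of \<open>-1\<close> is used.\<close>

lemma B_square: assumes "c \<noteq> 0" shows "B c \<otimes>\<^bsub>W\<^esub> B c = \<one>\<^bsub>W\<^esub>"
proof -
  let ?g = "gscale c (pf_gram \<gamma>s \<alpha>)"
  have "metab UNIV (pf_dim k + pf_dim k) (gsum (pf_dim k) ?g ?g)"
  proof (rule metab_graph[OF is_subfield_UNIV])
    show "linmap UNIV (pf_dim k) (pf_dim k) (\<lambda>v. i \<star> id v)"
      by (rule linmap_smul[OF is_subfield_UNIV UNIV_I linmap_id])
    show "qd (pf_dim k) ?g (i \<star> id v) = - qd (pf_dim k) ?g v" for v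
      unfolding qd_smul i by simp
  qed
  then show ?thesis
    using wc_mult[OF even_nonsing_B[OF assms] even_nonsing_B[OF assms]] wc_eq_one_iff[OF even_nonsing_gsum[OF even_nonsing_B[OF assms] even_nonsing_B[OF assms]]]
    by (simp only: B_def)
qed

lemma B_square_left: "c \<noteq> 0 \<Longrightarrow> x \<in> carrier W \<Longrightarrow> B c \<otimes>\<^bsub>W\<^esub> (B c \<otimes>\<^bsub>W\<^esub> x) = x"
  by (simp add: W.m_assoc[symmetric] B_square)

lemma slots_Cons: "c \<noteq> 0 \<Longrightarrow> pf_slots UNIV (Suc k) (1, c # \<gamma>s, \<alpha>)"
  using slots by (auto simp: pf_slots_def)

lemma P_eq: assumes "c \<noteq> 0" shows "P c = wc (pf_dim (Suc k)) (pf_gram (c # \<gamma>s) \<alpha>)"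
proof -
  have "P c = wc (pf_dim k + pf_dim k) (gsum (pf_dim k) (gscale 1 (pf_gram \<gamma>s \<alpha>)) (gscale c (pf_gram \<gamma>s \<alpha>)))"
    unfolding P_def B_def by (rule wc_mult[OF even_nonsing_B even_nonsing_B[OF assms]]) simp
  then show ?thesis by (simp only: pf_gram.simps len pf_dim_Suc gscale_1)
qed

lemma P_one: "P 1 = \<one>\<^bsub>W\<^esub>"
  by (simp add: P_def B_square)

lemma P_square: "c \<noteq> 0 \<Longrightarrow> P c \<otimes>\<^bsub>W\<^esub> P c = \<one>\<^bsub>W\<^esub>"
  by (simp add: P_def W.m_ac B_square B_square_left)

abbreviation N :: "'a qform set set" where "N \<equiv> Iq (Suc (Suc (Suc k)))"
abbreviation H :: "'a qform set set" where "H \<equiv> Iq (Suc (Suc k))"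

lemma P_in_H: assumes "c \<noteq> 0" shows "P c \<in> H"
proof -
  have "P c = wc (pf_dim (Suc k)) (gscale 1 (pf_gram (c # \<gamma>s) \<alpha>))"
    by (simp only: P_eq[OF assms] gscale_1)
  then have "P c \<in> Iq_gens (Suc k)"
    unfolding Iq_gens_def using slots_Cons[OF assms] by blast
  then show ?thesis unfolding Iq_Suc by (rule generate.incl)
qed

text \<open>Among the summands of \<open>P a\<close>, \<open>P b\<close> and
  \<open>P (a * b)\<close> the common factor occurs three times. Two copies cancel, and what remains
  is the class of the form \<open><<a, b>>\<close> tensored with it.\<close>

lemma P_triple_in_N:
  assumes "a \<noteq> 0" "b \<noteq> 0" shows "P a \<otimes>\<^bsub>W\<^esub> P b \<otimes>\<^bsub>W\<^esub> P (a * b) \<in> N"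
proof -
  let ?g = "pf_gram \<gamma>s \<alpha>"
  have s: "pf_slots UNIV (Suc (Suc k)) (1, a # b # \<gamma>s, \<alpha>)"
    using slots assms by (auto simp: pf_slots_def)
  have ab: "a * b \<noteq> 0" using assms by simp
  have sb: "even_nonsing (pf_dim (Suc k)) (pf_gram (b # \<gamma>s) \<alpha>)" by (rule even_nonsing_pf(1)[OF slots_Cons[OF assms(2)]])
  have "B a \<otimes>\<^bsub>W\<^esub> B (a * b) = wc (pf_dim (Suc k)) (gscale a (pf_gram (b # \<gamma>s) \<alpha>))"
    unfolding B_def using wc_mult[OF even_nonsing_B[OF assms(1)] even_nonsing_B[OF ab]]
    by (simp only: pf_gram.simps len pf_dim_Suc gscale_gsum gscale_gscale)
  then have "P b \<otimes>\<^bsub>W\<^esub> (B a \<otimes>\<^bsub>W\<^esub> B (a * b)) = wc (pf_dim (Suc (Suc k))) (gscale 1 (pf_gram (a # b # \<gamma>s) \<alpha>))"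
    using wc_mult[OF sb even_nonsing_gscale[OF assms(1) sb]] len
    by (simp only: P_eq[OF assms(2)] pf_gram.simps(2)[of a] length_Cons pf_dim_Suc[of "Suc k"] gscale_1)
  moreover have "P a \<otimes>\<^bsub>W\<^esub> P b \<otimes>\<^bsub>W\<^esub> P (a * b) = P b \<otimes>\<^bsub>W\<^esub> (B a \<otimes>\<^bsub>W\<^esub> B (a * b))"
    using assms by (simp add: P_def W.m_ac B_square_left)
  ultimately have "P a \<otimes>\<^bsub>W\<^esub> P b \<otimes>\<^bsub>W\<^esub> P (a * b) \<in> Iq_gens (Suc (Suc k))"
    unfolding Iq_gens_def using s by blast
  then show ?thesis unfolding Iq_Suc by (rule generate.incl)
qed

abbreviation Q :: "'a qform set set monoid" where "Q \<equiv> Iq_quot (Suc (Suc k))"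

definition h :: "'a \<Rightarrow> 'a qform set set" where
  "h c = N #>\<^bsub>W\<^esub> P c"

lemma N_subgroup: "subgroup N W" by (rule subgroup_Iq)

lemma normal_N: "N \<lhd> W\<lparr>carrier := H\<rparr>"
  by (rule W.normal_restrict_supergroup[OF subgroup_Iq W.subgroup_imp_normal[OF N_subgroup] Iq_Suc_subset])

lemma group_Q: "group Q"
  using normal.factorgroup_is_group[OF normal_N] by (simp add: Iq_quot_def)

lemma rcoset_H: "N #>\<^bsub>W\<lparr>carrier := H\<rparr>\<^esub> x = N #>\<^bsub>W\<^esub> x"
  by (simp add: r_coset_def)

lemma mult_Q: "x \<in> carrier W \<Longrightarrow> y \<in> carrier W \<Longrightarrow>
    (N #>\<^bsub>W\<^esub> x) \<otimes>\<^bsub>Q\<^esub> (N #>\<^bsub>W\<^esub> y) = N #>\<^bsub>W\<^esub> (x \<otimes>\<^bsub>W\<^esub> y)"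
  using normal.rcos_sum[OF W.subgroup_imp_normal[OF N_subgroup], of x y]
  by (simp add: Iq_quot_def FactGroup_def set_mult_def)

lemma h_closed: assumes "c \<noteq> 0" shows "h c \<in> carrier Q"
proof -
  have "h c \<in> rcosets\<^bsub>W\<lparr>carrier := H\<rparr>\<^esub> N"
    unfolding RCOSETS_def rcoset_H h_def using P_in_H[OF assms] by auto
  then show ?thesis by (simp add: Iq_quot_def FactGroup_def)
qed

lemma h_mult: assumes "a \<noteq> 0" "b \<noteq> 0" shows "h a \<otimes>\<^bsub>Q\<^esub> h b = h (a * b)"
proof -
  have ab: "a * b \<noteq> 0" using assms by simp
  have "h a \<otimes>\<^bsub>Q\<^esub> h b = N #>\<^bsub>W\<^esub> (P a \<otimes>\<^bsub>W\<^esub> P b)"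
    unfolding h_def using assms by (simp add: mult_Q)
  \<comment> \<open>\<open>P (a * b)\<close> is its own inverse, so it may be inserted twice; the
    bracketed triple lies in \<open>N\<close>.\<close>
  also have "P a \<otimes>\<^bsub>W\<^esub> P b = (P a \<otimes>\<^bsub>W\<^esub> P b \<otimes>\<^bsub>W\<^esub> P (a * b)) \<otimes>\<^bsub>W\<^esub> P (a * b)"
    using assms ab by (simp add: W.m_assoc P_square)
  also have "N #>\<^bsub>W\<^esub> \<dots> = (N #>\<^bsub>W\<^esub> (P a \<otimes>\<^bsub>W\<^esub> P b \<otimes>\<^bsub>W\<^esub> P (a * b))) #>\<^bsub>W\<^esub> P (a * b)"
    using assms ab subgroup.subset[OF N_subgroup] by (simp add: W.coset_mult_assoc)
  also have "N #>\<^bsub>W\<^esub> (P a \<otimes>\<^bsub>W\<^esub> P b \<otimes>\<^bsub>W\<^esub> P (a * b)) = N"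
    using assms ab by (intro W.coset_join2 N_subgroup P_triple_in_N) simp_all
  finally show ?thesis by (simp add: h_def)
qed

lemma h_one: "h 1 = \<one>\<^bsub>Q\<^esub>"
  unfolding h_def P_one using subgroup.subset[OF N_subgroup]
  by (simp add: Iq_quot_def FactGroup_def W.coset_mult_one)

lemma h_square: assumes "c \<noteq> 0" shows "h (c * c) = \<one>\<^bsub>Q\<^esub>"
proof -
  have "h (c * c) = N #>\<^bsub>W\<^esub> (P c \<otimes>\<^bsub>W\<^esub> P c)"
    unfolding h_mult[OF assms assms, symmetric] unfolding h_def using assms by (intro mult_Q) simp_all
  then show ?thesis using h_one by (simp add: P_square[OF assms] h_def P_one)
qed

lemma h_inv: assumes "c \<noteq> 0" shows "inv\<^bsub>Q\<^esub> h c = h c"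
proof (rule group.inv_equality[OF group_Q])
  show "h c \<otimes>\<^bsub>Q\<^esub> h c = \<one>\<^bsub>Q\<^esub>" using h_square[OF assms] h_mult[OF assms assms] by simp
qed (rule h_closed[OF assms])+

text \<open>Choice of a basis over the field with two elements, made on the scalars. A generator
  outside the subgroup obtained so far doubles it, just as a further entry doubles
  \<open>prods\<close>; distinctness records that no two subproducts give the same class.\<close>

lemma span_basis:
  assumes "0 \<notin> set bl"
  shows "\<exists>bs. 0 \<notin> set bs \<and> distinct (map h (prods bs)) \<and> h ` set (prods bs) = generate Q (h ` set bl)"
  using assms
proof (induction bl)
  case Nil
  show ?case
    by (intro exI[of _ "[]"]) (simp add: group.generate_empty[OF group_Q] h_one)
next
  case (Cons b bl)
  then have b: "b \<noteq> 0" and bl: "0 \<notin> set bl" by auto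
  interpret Q: group Q by (rule group_Q)
  obtain bs where bs: "0 \<notin> set bs" "distinct (map h (prods bs))" "h ` set (prods bs) = generate Q (h ` set bl)"
    using Cons by auto
  let ?A = "generate Q (h ` set bl)"
  have blc: "h ` set bl \<subseteq> carrier Q" using h_closed bl by (metis image_subsetI)
  have A: "subgroup ?A Q" by (rule Q.generate_is_subgroup[OF blc])
  have nz: "c \<noteq> 0" if "c \<in> set (prods bs)" for c using prods_nonzero[OF bs(1)] that by metis
  show ?case
  proof (cases "h b \<in> ?A")
    case True
    have "generate Q (h ` set (b # bl)) = ?A"
    proof
      have "h ` set (b # bl) \<subseteq> ?A" using True by (auto intro: generate.incl)
      then show "generate Q (h ` set (b # bl)) \<subseteq> ?A" by (rule Q.generate_subgroup_incl[OF _ A])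
      show "?A \<subseteq> generate Q (h ` set (b # bl))" by (rule Q.mono_generate) auto
    qed
    then show ?thesis using bs by (intro exI[of _ bs]) simp
  next
    case False
    let ?Z = "set (prods (b # bs))" and ?G = "generate Q (h ` set (b # bl))"
    have nzZ: "c \<noteq> 0" if "c \<in> ?Z" for c using nz b that by auto
    have cl: "\<exists>e\<in>set (prods bs). h e = h (c * d)" if "c \<in> set (prods bs)" "d \<in> set (prods bs)" for c d
    proof -
      have "h c \<otimes>\<^bsub>Q\<^esub> h d \<in> ?A" using that bs(3) by (intro subgroup.m_closed[OF A]) auto
      then have "h (c * d) \<in> h ` set (prods bs)" using h_mult nz that bs(3) by simp
      then show ?thesis by force
    qed
    have one: "1 \<in> set (prods cs)" for cs :: "'a list" by (induction cs) auto
    have sub: "subgroup (h ` ?Z) Q"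
    proof (rule Q.subgroupI)
      show "h ` ?Z \<subseteq> carrier Q" using h_closed nzZ by blast
      have "prods (b # bs) \<noteq> []" using one[of "b # bs"] by (metis empty_iff empty_set)
      then show "h ` ?Z \<noteq> {}" by simp
      show "inv\<^bsub>Q\<^esub> x \<in> h ` ?Z" if "x \<in> h ` ?Z" for x
      proof -
        from that obtain c where c: "c \<in> ?Z" "x = h c" by blast
        show ?thesis unfolding c(2) h_inv[OF nzZ[OF c(1)]] by (rule imageI[OF c(1)])
      qed
      fix x y assume "x \<in> h ` ?Z" "y \<in> h ` ?Z"
      then obtain c d where cd: "c \<in> ?Z" "d \<in> ?Z" "x = h c" "y = h d" by blast
      have xy: "x \<otimes>\<^bsub>Q\<^esub> y = h (c * d)" unfolding cd(3,4) using nzZ cd by (intro h_mult) auto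
      obtain c' d' where c': "c' \<in> set (prods bs)" "c = c' \<or> c = b * c'"
        and d': "d' \<in> set (prods bs)" "d = d' \<or> d = b * d'" using cd(1,2) by auto
      obtain e where e: "e \<in> set (prods bs)" "h e = h (c' * d')" using cl[OF c'(1) d'(1)] by blast
      have n: "c' \<noteq> 0" "d' \<noteq> 0" "e \<noteq> 0" using nz c'(1) d'(1) e(1) by auto
      have be: "h (b * (c' * d')) = h (b * e)"
        using h_mult[OF b, of "c' * d'"] h_mult[OF b n(3)] n e(2) by simp
      \<comment> \<open>If both factors involve \<open>b\<close>, the square of \<open>b\<close> has
        trivial class and the product falls back into the first half.\<close>
      have bb: "h (b * b * (c' * d')) = h e"
        using h_mult[of "b * b" "c' * d'"] h_square[OF b] b n e(2) h_closed[OF n(3)] by simp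
      consider "c * d = c' * d'" | "c * d = b * (c' * d')" | "c * d = b * b * (c' * d')"
        using c'(2) d'(2) by (auto simp: mult_ac)
      then have "\<exists>z\<in>?Z. h (c * d) = h z"
      proof cases
        case 1
        then show ?thesis using e by (intro bexI[of _ e]) auto
      next
        case 2
        then show ?thesis using e be by (intro bexI[of _ "b * e"]) auto
      next
        case 3
        then show ?thesis using e bb by (intro bexI[of _ e]) auto
      qed
      then show "x \<otimes>\<^bsub>Q\<^esub> y \<in> h ` ?Z" using xy by auto
    qed
    have "h ` ?Z = ?G"
    proof
      have "h ` set (b # bl) \<subseteq> h ` ?Z"
      proof -
        have "h ` set bl \<subseteq> h ` set (prods bs)" unfolding bs(3) by (auto intro: generate.incl)
        moreover have "b \<in> ?Z" using one[of bs] by force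
        ultimately show ?thesis by auto
      qed
      then show "?G \<subseteq> h ` ?Z" by (rule Q.generate_subgroup_incl[OF _ sub])
      have AG: "?A \<subseteq> ?G" by (rule Q.mono_generate) auto
      show "h ` ?Z \<subseteq> ?G"
      proof
        fix x assume "x \<in> h ` ?Z"
        then obtain c where c: "c \<in> set (prods bs)" "x = h c \<or> x = h (b * c)" by auto
        have hc: "h c \<in> ?G" using AG bs(3) c(1) by auto
        have "h b \<otimes>\<^bsub>Q\<^esub> h c \<in> ?G" by (rule generate.eng[OF generate.incl hc]) simp
        then show "x \<in> ?G" using c hc h_mult[OF b nz[OF c(1)]] by auto
      qed
    qed
    moreover have "distinct (map h (prods (b # bs)))"
    proof -
      have inj: "inj_on h (set (prods bs))" "distinct (prods bs)" using bs(2) by (simp_all add: distinct_map)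
      have canc: "h c = h d" if "c \<in> set (prods bs)" "d \<in> set (prods bs)" "h (b * c) = h (b * d)" for c d
      proof -
        have "h b \<otimes>\<^bsub>Q\<^esub> h c = h b \<otimes>\<^bsub>Q\<^esub> h d" using that h_mult[OF b] nz by metis
        then show ?thesis using h_closed b nz that Q.l_cancel by metis
      qed
      have "distinct (map (h \<circ> (*) b) (prods bs))"
        unfolding distinct_map
      proof
        show "inj_on (h \<circ> (*) b) (set (prods bs))"
        proof (rule inj_onI)
          fix c d assume "c \<in> set (prods bs)" "d \<in> set (prods bs)" "(h \<circ> (*) b) c = (h \<circ> (*) b) d"
          then show "c = d" using canc[of c d] inj_onD[OF inj(1)] by simp
        qed
      qed (rule inj(2))
      \<comment> \<open>The two halves are disjoint: an equality would put \<open>h b\<close> into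
        the subgroup spanned so far, as \<open>h (c * d)\<close>.\<close>
      moreover have "h c \<noteq> h (b * d)" if "c \<in> set (prods bs)" "d \<in> set (prods bs)" for c d
      proof
        assume a: "h c = h (b * d)"
        have n: "c \<noteq> 0" "d \<noteq> 0" using nz[OF that(1)] nz[OF that(2)] .
        have "h (c * d) = h c \<otimes>\<^bsub>Q\<^esub> h d" using h_mult n by simp
        also have "\<dots> = h (b * d) \<otimes>\<^bsub>Q\<^esub> h d" unfolding a ..
        also have "\<dots> = h (b * (d * d))" using h_mult[of "b * d" d] b n by (simp add: mult.assoc)
        also have "\<dots> = h b" using h_mult[OF b, of "d * d"] h_square[OF n(2)] n h_closed[OF b] by simp
        finally have "h b \<in> h ` set (prods bs)" using cl[OF that] by (metis imageI)
        then show False using False bs(3) by simp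
      qed
      ultimately show ?thesis using bs(2) by (auto simp: map_map)
    qed
    moreover have "0 \<notin> set (b # bs)" using b bs(1) by auto
    ultimately show ?thesis by blast
  qed
qed

lemma pfister_rep_h: assumes "c \<noteq> 0" shows "pfister_rep (Suc (Suc k)) (h c) = P c"
  unfolding pfister_rep_def
proof (rule the_equality)
  let ?\<pi> = "mkq (pf_dim (Suc k)) (pf_gram (c # \<gamma>s) \<alpha>)"
  have "witt_class ?\<pi> = P c" unfolding P_eq[OF assms] wc_def ..
  then show "\<exists>\<pi>. quad_pfister (Suc (Suc k)) \<pi> \<and> quot_class (Suc (Suc k)) \<pi> = h c \<and> P c = witt_class \<pi>"
    using quad_pfister_mkq[OF slots_Cons[OF assms]]
    by (intro exI[of _ ?\<pi>]) (simp add: quot_class_def h_def)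
next
  fix w assume "\<exists>\<pi>. quad_pfister (Suc (Suc k)) \<pi> \<and> quot_class (Suc (Suc k)) \<pi> = h c \<and> w = witt_class \<pi>"
  then obtain \<pi> where p: "quad_pfister (Suc (Suc k)) \<pi>" "quot_class (Suc (Suc k)) \<pi> = h c" "w = witt_class \<pi>"
    by blast
  obtain \<beta>s \<alpha>' g where q: "pf_slots UNIV (Suc k) (1, \<beta>s, \<alpha>')" "\<pi> = mkq (pf_dim (Suc k)) g"
    "isom UNIV (pf_dim (Suc k)) g (pf_gram \<beta>s \<alpha>')" "even_nonsing (pf_dim (Suc k)) g"
    "witt_class \<pi> = wc (pf_dim (Suc k)) (pf_gram \<beta>s \<alpha>')"
    by (rule quad_pfister_class[OF p(1)])
  have "N #>\<^bsub>W\<^esub> wc (pf_dim (Suc k)) (pf_gram \<beta>s \<alpha>') = N #>\<^bsub>W\<^esub> wc (pf_dim (Suc k)) (pf_gram (c # \<gamma>s) \<alpha>)"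
    using p(2) unfolding quot_class_def h_def q(5) P_eq[OF assms] by simp
  from pfister_class_unique[OF q(1) slots_Cons[OF assms] this]
  show "w = P c" unfolding p(3) q(5) P_eq[OF assms] .
qed

text \<open>A product along a list, which can follow the recursion of \<open>prods\<close>. By
  \<open>finprod_h\<close> it computes the product over the subgroup when the classes are
  distinct.\<close>

definition prod_W :: "('a \<Rightarrow> 'a qform set) \<Rightarrow> 'a list \<Rightarrow> 'a qform set" where
  "prod_W f cs = foldr (\<lambda>c x. f c \<otimes>\<^bsub>W\<^esub> x) cs \<one>\<^bsub>W\<^esub>"

lemma prod_W_simps [simp]: "prod_W f [] = \<one>\<^bsub>W\<^esub>" "prod_W f (c # cs) = f c \<otimes>\<^bsub>W\<^esub> prod_W f cs"
  by (simp_all add: prod_W_def)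

lemma prod_W_closed: "0 \<notin> set cs \<Longrightarrow> (\<And>c. c \<noteq> 0 \<Longrightarrow> f c \<in> carrier W) \<Longrightarrow> prod_W f cs \<in> carrier W"
  by (induction cs) auto

lemma prod_W_append:
  assumes "\<And>c. c \<noteq> 0 \<Longrightarrow> f c \<in> carrier W"
  shows "0 \<notin> set cs \<Longrightarrow> 0 \<notin> set ds \<Longrightarrow> prod_W f (cs @ ds) = prod_W f cs \<otimes>\<^bsub>W\<^esub> prod_W f ds"
  by (induction cs) (auto simp: assms prod_W_closed W.m_assoc)

lemma finprod_h:
  "distinct (map h cs) \<Longrightarrow> 0 \<notin> set cs \<Longrightarrow>
    finprod W (pfister_rep (Suc (Suc k))) (h ` set cs) = prod_W P cs"
proof (induction cs)
  case (Cons c cs)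
  have nz: "d \<noteq> 0" if "d \<in> set cs" for d using Cons.prems(2) that by auto
  have "finprod W (pfister_rep (Suc (Suc k))) (insert (h c) (h ` set cs)) =
      pfister_rep (Suc (Suc k)) (h c) \<otimes>\<^bsub>W\<^esub> finprod W (pfister_rep (Suc (Suc k))) (h ` set cs)"
    using Cons.prems nz by (intro W.finprod_insert) (auto simp: pfister_rep_h)
  then show ?case using Cons by (simp add: pfister_rep_h)
qed simp

text \<open>The elements are paired as \<open>c\<close> and \<open>b * c\<close>: each pair
  contributes the common factor \<open>B 1\<close> twice, and these copies cancel.\<close>

lemma prod_P_double:
  assumes b: "b \<noteq> 0"
  shows "0 \<notin> set cs \<Longrightarrow> prod_W P (cs @ map ((*) b) cs) = prod_W B (cs @ map ((*) b) cs)"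
proof (induction cs)
  case (Cons c cs)
  then have c: "c \<noteq> 0" "b * c \<noteq> 0" "0 \<notin> set cs" "0 \<notin> set (map ((*) b) cs)" using b by auto
  have cl: "prod_W f cs \<in> carrier W" "prod_W f (map ((*) b) cs) \<in> carrier W"
    if "\<And>c. c \<noteq> 0 \<Longrightarrow> f c \<in> carrier W" for f
    using prod_W_closed[where f = f, OF c(3) that] prod_W_closed[where f = f, OF c(4) that] by auto
  have split: "prod_W f ((c # cs) @ map ((*) b) (c # cs)) =
      (f c \<otimes>\<^bsub>W\<^esub> f (b * c)) \<otimes>\<^bsub>W\<^esub> prod_W f (cs @ map ((*) b) cs)"
    if f: "\<And>c. c \<noteq> 0 \<Longrightarrow> f c \<in> carrier W" for f
  proof -
    have "prod_W f ((c # cs) @ map ((*) b) (c # cs)) =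
        f c \<otimes>\<^bsub>W\<^esub> (prod_W f cs \<otimes>\<^bsub>W\<^esub> (f (b * c) \<otimes>\<^bsub>W\<^esub> prod_W f (map ((*) b) cs)))"
      using prod_W_append[where f = f, OF f, of cs "(b * c) # map ((*) b) cs"] c by simp
    also have "\<dots> = (f c \<otimes>\<^bsub>W\<^esub> f (b * c)) \<otimes>\<^bsub>W\<^esub> (prod_W f cs \<otimes>\<^bsub>W\<^esub> prod_W f (map ((*) b) cs))"
      using cl[where f = f, OF f] f c by (simp add: W.m_ac)
    finally show ?thesis using prod_W_append[where f = f, OF f c(3,4)] by simp
  qed
  have "P c \<otimes>\<^bsub>W\<^esub> P (b * c) = B c \<otimes>\<^bsub>W\<^esub> B (b * c)"
    using c by (simp add: P_def W.m_ac B_square_left)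
  then show ?case using split[where f = P] split[where f = B] Cons.IH c(3) by simp
qed simp

text \<open>The scalar \<open>d\<close> is carried for the sake of the induction, where the second
  half of \<open>prods\<close> is multiplied by \<open>b\<close>.\<close>

lemma prod_B_prods:
  assumes "0 \<notin> set bs"
  shows "d \<noteq> 0 \<Longrightarrow> prod_W B (map ((*) d) (prods bs)) =
    wc (pf_dim (length (bs @ \<gamma>s))) (gscale d (pf_gram (bs @ \<gamma>s) \<alpha>))"
  using assms
proof (induction bs arbitrary: d)
  case Nil
  then have "prod_W B (map ((*) d) (prods [])) = B d" by simp
  then show ?case by (simp add: B_def len)
next
  case (Cons b bs)
  let ?m = "length (bs @ \<gamma>s)" and ?g = "pf_gram (bs @ \<gamma>s) \<alpha>"
  have b: "b \<noteq> 0" "d * b \<noteq> 0" "0 \<notin> set bs" using Cons.prems by auto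
  have nz: "0 \<notin> set (map ((*) e) (prods bs))" if "e \<noteq> 0" for e
    using prods_nonzero[OF b(3)] that by auto
  have s: "pf_slots UNIV ?m (e, bs @ \<gamma>s, \<alpha>)" if "e \<noteq> 0" for e
    using slots b(3) that by (auto simp: pf_slots_def)
  have split: "map ((*) d) (prods (b # bs)) = map ((*) d) (prods bs) @ map ((*) (d * b)) (prods bs)"
    by (simp add: comp_def mult.assoc)
  have "prod_W B (map ((*) d) (prods (b # bs))) =
      prod_W B (map ((*) d) (prods bs)) \<otimes>\<^bsub>W\<^esub> prod_W B (map ((*) (d * b)) (prods bs))"
    unfolding split by (rule prod_W_append[OF _ nz[OF Cons.prems(1)] nz[OF b(2)]]) (rule B_closed)
  also have "\<dots> = wc (pf_dim ?m) (gscale d ?g) \<otimes>\<^bsub>W\<^esub> wc (pf_dim ?m) (gscale (d * b) ?g)"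
    unfolding Cons.IH[OF Cons.prems(1) b(3)] Cons.IH[OF b(2,3)] ..
  also have "\<dots> = wc (pf_dim ?m + pf_dim ?m) (gsum (pf_dim ?m) (gscale d ?g) (gscale (d * b) ?g))"
    by (rule wc_mult[OF even_nonsing_pf(2)[OF s[OF Cons.prems(1)]] even_nonsing_pf(2)[OF s[OF b(2)]]])
  also have "\<dots> = wc (pf_dim (length ((b # bs) @ \<gamma>s))) (gscale d (pf_gram ((b # bs) @ \<gamma>s) \<alpha>))"
    by (simp only: append_Cons length_Cons pf_gram.simps pf_dim_Suc gscale_gsum gscale_gscale)
  finally show ?case .
qed

lemma prod_P_prods:
  assumes "0 \<notin> set bs"
  shows "\<exists>\<pi>. quad_pfister (Suc k + length bs) \<pi> \<and> prod_W P (prods bs) = witt_class \<pi>"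
proof (cases bs)
  case Nil
  \<comment> \<open>The subgroup is trivial and the sum is \<open>P 1\<close>, which is neutral. The
    form with \<open>k\<close> slots 1 and \<open>\<alpha> = 0\<close> is a hyperbolic
    \<open>(k + 1)\<close>-fold Pfister form representing it.\<close>
  let ?bs = "replicate k (1 :: 'a)"
  have s: "pf_slots UNIV k (1, ?bs, 0)" by (auto simp: pf_slots_def)
  have "isotropic UNIV (pf_dim (length ?bs)) (pf_gram ?bs 0)"
    unfolding isotropic_def
  proof (intro exI[of _ "unitv 1"] conjI)
    show "\<exists>i<pf_dim (length ?bs). (unitv 1 :: nat \<Rightarrow> 'a) i \<noteq> 0"
      using one_less_pf_dim[of k] by (intro exI[of _ 1]) (simp add: unitv_def)
    show "qd (pf_dim (length ?bs)) (pf_gram ?bs 0) (unitv 1) = 0" by (rule pf_second)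
  qed (simp add: ovec_def)
  then have "metab UNIV (pf_dim (length ?bs)) (pf_gram ?bs 0)"
    by (intro isotropic_pf_metab[OF is_subfield_UNIV]) auto
  then have "wc (pf_dim k) (pf_gram ?bs 0) = \<one>\<^bsub>W\<^esub>"
    using wc_eq_one_iff[OF even_nonsing_pf(1)[OF s]] by simp
  then show ?thesis
    using quad_pfister_mkq[OF s] Nil
    by (intro exI[of _ "mkq (pf_dim k) (pf_gram ?bs 0)"]) (simp add: P_one wc_def)
next
  case (Cons b bs')
  let ?m = "length (bs @ \<gamma>s)"
  have b: "b \<noteq> 0" "0 \<notin> set bs'" using assms Cons by auto
  have s: "pf_slots UNIV ?m (1, bs @ \<gamma>s, \<alpha>)" using slots assms by (auto simp: pf_slots_def)
  have "prod_W P (prods bs) = prod_W B (prods bs)"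
    using prod_P_double[OF b(1) prods_nonzero[OF b(2)]] by (simp add: Cons)
  also have "\<dots> = prod_W B (map ((*) 1) (prods bs))" by (simp add: map_idI)
  also have "\<dots> = wc (pf_dim ?m) (gscale 1 (pf_gram (bs @ \<gamma>s) \<alpha>))"
    by (rule prod_B_prods[OF assms]) simp
  finally have "prod_W P (prods bs) = witt_class (mkq (pf_dim ?m) (pf_gram (bs @ \<gamma>s) \<alpha>))"
    by (simp only: gscale_1 wc_def)
  \<comment> \<open>The slots are those of the common factor and the entries of \<open>bs\<close>;
    one more is added to obtain the fold number.\<close>
  moreover have "Suc ?m = Suc k + length bs" by (simp add: len)
  ultimately show ?thesis using quad_pfister_mkq[OF s] by metis
qed

text \<open>The given common factor is only isometric to \<open>pf_gram \<gamma>s \<alpha>\<close>.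
  Carrying the linking isometry over to the latter makes the class of every form in question a value
  of \<open>h\<close>.\<close>

lemma quot_class_linked:
  assumes q: "quad_pfister (Suc (Suc k)) q" and b: "b \<noteq> 0"
    and g: "isom UNIV (pf_dim k) g (pf_gram \<gamma>s \<alpha>)"
    and iso: "isometric q (qtensor (diag_form [1, b]) (mkq (pf_dim k) g))"
  shows "quot_class (Suc (Suc k)) q = h b"
proof -
  obtain \<beta>s a g' where p: "pf_slots UNIV (Suc k) (1, \<beta>s, a)" "q = mkq (pf_dim (Suc k)) g'"
    "isom UNIV (pf_dim (Suc k)) g' (pf_gram \<beta>s a)" "even_nonsing (pf_dim (Suc k)) g'"
    "witt_class q = wc (pf_dim (Suc k)) (pf_gram \<beta>s a)"
    by (rule quad_pfister_class[OF q])
  have "qtensor (diag_form [1, b]) (mkq (pf_dim k) g) =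
      mkq (2 ^ length [b] * pf_dim k) (tensor_gram [b] (pf_dim k) g)"
    unfolding bil_pfister_single[symmetric] by (rule qtensor_pfister)
  also have "\<dots> = mkq (pf_dim k + pf_dim k) (gsum (pf_dim k) g (gscale b g))"
    by (simp add: mult_2)
  finally have "isom UNIV (pf_dim (Suc k)) g' (gsum (pf_dim k) g (gscale b g))"
    using iso unfolding p(2) by (simp add: isometric_mkq)
  moreover have "isom UNIV (pf_dim k + pf_dim k) (gsum (pf_dim k) g (gscale b g))
      (gsum (pf_dim k) (pf_gram \<gamma>s \<alpha>) (gscale b (pf_gram \<gamma>s \<alpha>)))"
    by (rule isom_gsum[OF is_subfield_UNIV g isom_gscale[OF g]])
  ultimately have "isom UNIV (pf_dim (Suc k)) g' (pf_gram (b # \<gamma>s) \<alpha>)"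
    unfolding pf_gram.simps len pf_dim_Suc[symmetric] by (rule isom_trans)
  from wc_isom[OF p(4) this] have "witt_class q = P b"
    unfolding P_eq[OF b] by (simp only: p(2) wc_def)
  then show ?thesis by (simp add: quot_class_def h_def)
qed

end

theorem proposition4p3:
  fixes S :: "'a::field qform set" and n s :: nat
  assumes "CHAR('a) \<noteq> 2 \<Longrightarrow> \<exists>i::'a. i\<^sup>2 = - 1"
    and "n \<ge> 2"
    and "finite S" and "card S > 1"
    and "\<forall>q\<in>S. quad_pfister n q"
    and "right_linked n S"
    and "card (quot_span n S) = 2 ^ s"
  shows "\<exists>\<pi>. quad_pfister (n + s - 1) \<pi> \<and> pfister_sum n S = witt_class \<pi>"
proof -
  obtain k where n: "n = Suc (Suc k)" using assms(2) by (metis Suc_le_D numeral_2_eq_2 Suc_le_mono)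
  obtain i :: 'a where i: "i * i = - 1"
  proof (cases "CHAR('a) = 2")
    case True
    then have "(of_nat 2 :: 'a) = 0" by (metis of_nat_CHAR)
    then have "(1 :: 'a) * 1 = - 1" by (simp add: eq_neg_iff_add_eq_0)
    then show ?thesis by (rule that)
  next
    case False
    then show ?thesis using assms(1) that by (auto simp: power2_eq_square)
  qed
  obtain \<phi> where \<phi>: "quad_pfister (Suc k) \<phi>"
    "\<forall>q\<in>S. \<exists>\<beta>. \<beta> \<noteq> 0 \<and> isometric q (qtensor (diag_form [1, \<beta>]) \<phi>)"
    using assms(6) unfolding right_linked_def n by auto
  obtain \<gamma>s \<alpha> g where g: "pf_slots UNIV k (1, \<gamma>s, \<alpha>)" "\<phi> = mkq (pf_dim k) g"
    "isom UNIV (pf_dim k) g (pf_gram \<gamma>s \<alpha>)" "even_nonsing (pf_dim k) g" "witt_class \<phi> = wc (pf_dim k) (pf_gram \<gamma>s \<alpha>)"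
    by (rule quad_pfister_class[OF \<phi>(1)])
  interpret linked k \<gamma>s \<alpha> i using g(1) i by unfold_locales
  from bchoice[OF \<phi>(2)] obtain b where b: "\<And>q. q \<in> S \<Longrightarrow> b q \<noteq> 0 \<and> isometric q (qtensor (diag_form [1, b q]) \<phi>)"
    by (elim exE) blast
  have qc: "quot_class n q = h (b q)" if "q \<in> S" for q
    using quot_class_linked[of q "b q" g] b[OF that] assms(5) that g(2,3) n by simp
  obtain bl where bl: "set bl = b ` S" using finite_list[OF finite_imageI[OF assms(3)]] ..
  have "quot_class n ` S = h ` set bl" unfolding bl image_image using qc by simp
  then have span: "quot_span n S = generate Q (h ` set bl)" by (simp add: quot_span_def n)
  have "0 \<notin> set bl" using b by (auto simp: bl)
  from span_basis[OF this] obtain bs where bs: "0 \<notin> set bs" "distinct (map h (prods bs))"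
    "h ` set (prods bs) = generate Q (h ` set bl)" by (elim exE conjE)
  have "card (h ` set (prods bs)) = 2 ^ length bs"
    using distinct_card[OF bs(2)] by simp
  then have "length bs = s" using assms(7) bs(3) span by simp
  moreover have "pfister_sum n S = prod_W P (prods bs)"
    unfolding pfister_sum_def span bs(3)[symmetric] unfolding n by (rule finprod_h[OF bs(2) prods_nonzero[OF bs(1)]])
  ultimately show ?thesis using prod_P_prods[OF bs(1)] n by simp
qed

end
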